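(* Suppose Assumption 1 holds and let $(\sigma_n)$ be a positive sequence with $\sigma_n\to0$. Then $\lim_{n\to\infty}\sigma_n^{-6}\mathbb{E}[\rho_n^2]=\theta^2$, where $\theta^2\in[0,\infty)$ is given by $$\theta^2=\mu_6\Big\{\tfrac{1}{144}A_\phi+\big(\tfrac14+\mathfrak g\big)^2B_\phi-\tfrac16\big(\tfrac14+\mathfrak g\big)C_\phi\Big\}+\mu_4\Big\{\tfrac16\big(\tfrac12+\mathfrak g\big)C_\phi-2\big(\tfrac14+\mathfrak g\big)\big(\tfrac12+\mathfrak g\big)B_\phi\Big\}+\big(\tfrac12+\mathfrak g\big)^2B_\phi .$$ Moreover, if $\theta>0$ and $\lim_{n\to\infty}n^{1/6}\sigma_n=\ell\in(0,\infty)$, then $$\sum_{i=1}^n\rho_n(X_{n,i},Y_{n,i})\Rightarrow N\!\left(-\tfrac12\ell^6\theta^2,\ \ell^6\theta^2\right)\quad (n\to\infty)$$ in distribution.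
   Context: Let $\phi:\mathbb{R}\to\mathbb{R}$ be such that $\pi(x)=e^{\phi(x)}$ is a probability density on $\mathbb{R}$. A balancing function is $g:[0,\infty)\to[0,\infty)$ with $g(0)=0$ and $g(t)=tg(1/t)$ for $t>0$; normalize $g(1)=1$ and set $b(x)=\log g(e^x)$, $\mathfrak g=g''(1)$. Let $\mu$ be a centred symmetric probability distribution on $\mathbb{R}$ and $\mu_k=\int z^k\mu(dz)$. For $\sigma>0$ let $Z_\sigma(x)=\int g(e^{\sigma z\phi'(x)})\mu(dz)$ and let $Q_\sigma(x,\cdot)$ be the law of $x+\sigma W$ where $W$ has distribution $Z_\sigma(x)^{-1}g(e^{\sigma w\phi'(x)})\mu(dw)$ (first-order locally-balanced proposal). For $X\sim\pi$, $Y\sim Q_{\sigma_n}(X,\cdot)$, the log-Metropolis–Hastings variable is $\rho_n=\rho_n(X,Y)=\log\frac{\pi(dy)Q_{\sigma_n}(y,dx)}{\pi(dx)Q_{\sigma_n}(x,dy)}$ on the symmetric set where this Radon–Nikodym derivative is positive and finite, and $\rho_n=0$ otherwise; explicitly there $\rho_n(x,y)=\phi(y)-\phi(x)+b(\phi'(y)(x-y))-b(\phi'(x)(y-x))+\log Z_{\sigma_n}(x)-\log Z_{\sigma_n}(y)$. In dimension $n$, $X_n=(X_{n,1},\dots,X_{n,n})\sim\prod_i\pi(x_i)dx_i$ and $Y_n$ has law $\prod_iQ_{\sigma_n}(X_{n,i},dy_i)$, so the $\rho_n(X_{n,i},Y_{n,i})$ are i.i.d. copies of $\rho_n$. Write $A_\phi=\mathbb{E}_\pi[(\phi''')^2]$,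 $B_\phi=\mathbb{E}_\pi[(\phi'\phi'')^2]$, $C_\phi=\mathbb{E}_\pi[\phi'\phi''\phi''']$. Assumption 1: there are constants $H\in(0,1)$, $\gamma>0$, $\beta\ge0$, $\epsilon>0$ such that (i) $\phi\in\mathcal{C}^{3+H}(\mathbb{R})$ and for each $f\in\{\phi''',\ \phi''\phi',\ (\phi')^3,\ \phi''|\phi'|^{1+\beta}\}$ one has $\int|f(x)|^{2+\epsilon}(1+|\phi'(x)|^\beta)\pi(x)dx<\infty$ and $|f(x+\delta)-f(x)|\le K(x)\max(|\delta|^H,|\delta|^\gamma)$ for all $x,\delta$, for a function $K$ with $\int K(x)^2(1+|\phi'(x)|^\beta)\pi(x)dx<\infty$; (ii) $b\in\mathcal{C}^3(\mathbb{R})$ with $b',b'',b'''$ bounded; (iii) $\int z^2\mu(dz)=1$, $\int|z|^\xi\mu(dz)<\infty$ with $\xi=\max(6+3\epsilon,2+2H,2+2\gamma)$, and for some $C_\mu>0$ and all $a\in\mathbb{R}$, $\int e^{b(az)}|z|^\xi\mu(dz)\le C_\mu(1+|a|^\beta)\int e^{b(az)}\mu(dz)<\infty$. *)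

theory Defs
  imports "HOL-Probability.Probability"
begin

(* |x|^a with the convention |x|^0 = 1 (Isabelle's 0 powr 0 = 0) *)
definition apow :: "real \<Rightarrow> real \<Rightarrow> real" where
  "apow x a = (if a = 0 then 1 else \<bar>x\<bar> powr a)"

definition dk :: "nat \<Rightarrow> (real \<Rightarrow> real) \<Rightarrow> real \<Rightarrow> real" where
  "dk k f = (deriv ^^ k) f"

definition C3 :: "(real \<Rightarrow> real) \<Rightarrow> bool" where
  "C3 f \<longleftrightarrow> (\<forall>k<3. \<forall>x. dk k f differentiable at x) \<and> continuous_on UNIV (dk 3 f)"

definition C3H :: "real \<Rightarrow> (real \<Rightarrow> real) \<Rightarrow> bool" where
  "C3H H f \<longleftrightarrow> C3 f \<and>
     (\<forall>a b. \<exists>C. \<forall>x\<in>{a..b}. \<forall>y\<in>{a..b}. \<bar>dk 3 f x - dk 3 f y\<bar> \<le> C * \<bar>x - y\<bar> powr H)"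

definition balancing :: "(real \<Rightarrow> real) \<Rightarrow> bool" where
  "balancing g \<longleftrightarrow> (\<forall>t\<ge>0. g t \<ge> 0) \<and> g 0 = 0 \<and> (\<forall>t>0. g t = t * g (1 / t))"

definition bfun :: "(real \<Rightarrow> real) \<Rightarrow> real \<Rightarrow> real" where
  "bfun g x = ln (g (exp x))"

definition Zs :: "(real \<Rightarrow> real) \<Rightarrow> real measure \<Rightarrow> (real \<Rightarrow> real) \<Rightarrow> real \<Rightarrow> real \<Rightarrow> real" where
  "Zs g \<mu> \<phi> \<sigma> x = (\<integral>z. g (exp (\<sigma> * z * deriv \<phi> x)) \<partial>\<mu>)"

definition target :: "(real \<Rightarrow> real) \<Rightarrow> real measure" where
  "target \<phi> = density lborel (\<lambda>x. ennreal (exp (\<phi> x)))"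

definition propQ :: "(real \<Rightarrow> real) \<Rightarrow> real measure \<Rightarrow> (real \<Rightarrow> real) \<Rightarrow> real \<Rightarrow> real \<Rightarrow> real measure" where
  "propQ g \<mu> \<phi> \<sigma> x =
     distr (density \<mu> (\<lambda>w. ennreal (g (exp (\<sigma> * w * deriv \<phi> x)) / Zs g \<mu> \<phi> \<sigma> x))) borel
           (\<lambda>w. x + \<sigma> * w)"

(* joint law pi(dx) Q_sigma(x,dy) of (X,Y), X ~ pi, Y ~ Q_sigma(X,.),
   written via Y = X + sigma W with (X,W) having density
   pi(x) Z(x)^{-1} g(e^{sigma w phi'(x)}) w.r.t. Lebesgue x mu *)
definition jointXY :: "(real \<Rightarrow> real) \<Rightarrow> real measure \<Rightarrow> (real \<Rightarrow> real) \<Rightarrow> real \<Rightarrow> (real \<times> real) measure" where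
  "jointXY g \<mu> \<phi> \<sigma> =
     distr (density (lborel \<Otimes>\<^sub>M \<mu>)
              (\<lambda>(x, w). ennreal (exp (\<phi> x) * g (exp (\<sigma> * w * deriv \<phi> x)) / Zs g \<mu> \<phi> \<sigma> x)))
           (borel \<Otimes>\<^sub>M borel) (\<lambda>(x, w). (x, x + \<sigma> * w))"

(* log Metropolis-Hastings ratio (explicit form) *)
definition rho :: "(real \<Rightarrow> real) \<Rightarrow> real measure \<Rightarrow> (real \<Rightarrow> real) \<Rightarrow> real \<Rightarrow> real \<Rightarrow> real \<Rightarrow> real" where
  "rho g \<mu> \<phi> \<sigma> x y =
     \<phi> y - \<phi> x + bfun g (deriv \<phi> y * (x - y)) - bfun g (deriv \<phi> x * (y - x))
     + ln (Zs g \<mu> \<phi> \<sigma> x) - ln (Zs g \<mu> \<phi> \<sigma> y)"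

definition mom :: "real measure \<Rightarrow> nat \<Rightarrow> real" where
  "mom \<mu> k = (\<integral>z. z ^ k \<partial>\<mu>)"

definition Aphi :: "(real \<Rightarrow> real) \<Rightarrow> real" where
  "Aphi \<phi> = (\<integral>x. (dk 3 \<phi> x)\<^sup>2 \<partial>target \<phi>)"
definition Bphi :: "(real \<Rightarrow> real) \<Rightarrow> real" where
  "Bphi \<phi> = (\<integral>x. (dk 1 \<phi> x * dk 2 \<phi> x)\<^sup>2 \<partial>target \<phi>)"
definition Cphi :: "(real \<Rightarrow> real) \<Rightarrow> real" where
  "Cphi \<phi> = (\<integral>x. dk 1 \<phi> x * dk 2 \<phi> x * dk 3 \<phi> x \<partial>target \<phi>)"

definition gfrak :: "(real \<Rightarrow> real) \<Rightarrow> real" where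
  "gfrak g = deriv (deriv g) 1"

definition theta2 :: "(real \<Rightarrow> real) \<Rightarrow> real measure \<Rightarrow> (real \<Rightarrow> real) \<Rightarrow> real" where
  "theta2 g \<mu> \<phi> =
     mom \<mu> 6 * (Aphi \<phi> / 144 + (1/4 + gfrak g)\<^sup>2 * Bphi \<phi> - (1/6) * (1/4 + gfrak g) * Cphi \<phi>)
   + mom \<mu> 4 * ((1/6) * (1/2 + gfrak g) * Cphi \<phi> - 2 * (1/4 + gfrak g) * (1/2 + gfrak g) * Bphi \<phi>)
   + (1/2 + gfrak g)\<^sup>2 * Bphi \<phi>"

definition assumption1 ::
  "(real \<Rightarrow> real) \<Rightarrow> (real \<Rightarrow> real) \<Rightarrow> real measure \<Rightarrow> real \<Rightarrow> real \<Rightarrow> real \<Rightarrow> real \<Rightarrow> real \<Rightarrow> bool" where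
  "assumption1 \<phi> g \<mu> H \<gamma> \<beta> \<epsilon> C\<mu> \<longleftrightarrow>
     0 < H \<and> H < 1 \<and> \<gamma> > 0 \<and> \<beta> \<ge> 0 \<and> \<epsilon> > 0 \<and>
     \<comment> \<open>(i)\<close>
     C3H H \<phi> \<and>
     (\<forall>f \<in> {dk 3 \<phi>, \<lambda>x. dk 2 \<phi> x * dk 1 \<phi> x, \<lambda>x. (dk 1 \<phi> x) ^ 3,
              \<lambda>x. dk 2 \<phi> x * apow (dk 1 \<phi> x) (1 + \<beta>)}.
        integrable lborel (\<lambda>x. \<bar>f x\<bar> powr (2 + \<epsilon>) * (1 + apow (dk 1 \<phi> x) \<beta>) * exp (\<phi> x))) \<and>
     (\<exists>K. integrable lborel (\<lambda>x. (K x)\<^sup>2 * (1 + apow (dk 1 \<phi> x) \<beta>) * exp (\<phi> x)) \<and>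
        (\<forall>f \<in> {dk 3 \<phi>, \<lambda>x. dk 2 \<phi> x * dk 1 \<phi> x, \<lambda>x. (dk 1 \<phi> x) ^ 3,
                 \<lambda>x. dk 2 \<phi> x * apow (dk 1 \<phi> x) (1 + \<beta>)}.
           \<forall>x \<delta>. \<bar>f (x + \<delta>) - f x\<bar> \<le> K x * max (\<bar>\<delta>\<bar> powr H) (\<bar>\<delta>\<bar> powr \<gamma>))) \<and>
     \<comment> \<open>(ii): b real-valued (g > 0 on (0,oo)), C^3, with bounded b', b'', b'''\<close>
     (\<forall>t>0. g t > 0) \<and> C3 (bfun g) \<and>
     (\<forall>k\<in>{1,2,3}. bounded (range (dk k (bfun g)))) \<and>
     \<comment> \<open>(iii)\<close>
     integrable \<mu> (\<lambda>z. z\<^sup>2) \<and> (\<integral>z. z\<^sup>2 \<partial>\<mu>) = 1 \<and>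
     (let \<xi> = max (6 + 3 * \<epsilon>) (max (2 + 2 * H) (2 + 2 * \<gamma>)) in
        integrable \<mu> (\<lambda>z. \<bar>z\<bar> powr \<xi>) \<and> C\<mu> > 0 \<and>
        (\<forall>a. integrable \<mu> (\<lambda>z. exp (bfun g (a * z))) \<and>
             integrable \<mu> (\<lambda>z. exp (bfun g (a * z)) * \<bar>z\<bar> powr \<xi>) \<and>
             (\<integral>z. exp (bfun g (a * z)) * \<bar>z\<bar> powr \<xi> \<partial>\<mu>)
               \<le> C\<mu> * (1 + apow a \<beta>) * (\<integral>z. exp (bfun g (a * z)) \<partial>\<mu>)))"

end

(*
Write Y = X + s W. Symmetry of the balancing function makes b(t) - t/2 even, so rho splits into the
error of the trapezoidal rule for phi' on [X, Y], an increment of b(t) - t/2 and an increment of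
log Z; each is of order s^3, and rho / s^3 converges pointwise to the cubic T(x, w), whose second
moment under pi x mu is theta^2. For |s W| <= 1 the Hoelder-type growth conditions bound rho / s^3 by
a function of x times 1 + |w|^3; for |s W| > 1 a cruder bound of rho, using the growth of (phi')^3, is
of order |s W| max(|s W|^H, |s W|^gamma), and the moment of order xi > 6 absorbs the factor s^(-3).
Hence s^(-6) E[v(rho)] -> c theta^2 whenever |v(r)| <= B r^2 and v(r) / r^2 -> c at 0.

The function v(r) = r^2 gives the first claim. For the mean, reversibility yields
E[u(rho)] = E[u(-rho) e^rho] for every u, hence E[rho e^rho / (1 + e^rho)] = 0 and
E[rho] = - E[rho tanh(rho / 2)], which is asymptotically - theta^2 s^6 / 2. Together with
v(r) = cos(t r) - 1 and v(r) = sin(t r) - t r this determines the limit of n (char(t) - 1), and Levy's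
continuity theorem gives the central limit theorem.
*)
theory Submission
  imports Defs
begin

text \<open>Two obstacles shape the argument. The tilted weights \<open>exp (b (a * z))\<close> are
  not assumed to have a dominating function uniform in \<open>a\<close>; only their moment of order
  \<xi> is controlled, relative to their mass. Limits in w therefore rest on uniform integrability
  of integrands of order w^6. Dominated convergence is kept for the variable x, where integrating
  out w costs a factor 1 + |\<phi>'|^\<beta>; hence that weight in the integrability hypotheses. The
  other obstacle is that rho is of order \<sigma>^3 but its mean of order \<sigma>^6, and \<phi> has
  too few derivatives to expand the mean directly. Reversibility trades the mean for that of an even
  function of second order. As for the constants in \<theta>^2: 1/4 + g''(1) is b''(0), and 1/2 +
  g''(1) is the second derivative at 0 of log Z as a function of a = \<sigma> \<phi>'(x). Its first
  derivative at 0 vanishes because \<mu> is centred; this raises the increment of log Z from order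
  \<sigma>^2 to \<sigma>^3.\<close>

lemma integrable_abs_bound:
  fixes f w :: "'a \<Rightarrow> real"
  assumes "integrable N w" "f \<in> borel_measurable N" "\<And>x. \<bar>f x\<bar> \<le> w x"
  shows "integrable N f"
  by (rule Bochner_Integration.integrable_bound[OF assms(1,2)])
     (use assms(3) in \<open>auto intro: order_trans[OF _ abs_ge_self]\<close>)

section \<open>Mean value theorem, trapezoidal rule and difference quotients\<close>

lemma mvt_between:
  fixes F F' :: "real \<Rightarrow> real"
  assumes "\<And>s. (F has_real_derivative F' s) (at s)"
  obtains \<eta> where "\<bar>\<eta> - x\<bar> \<le> \<bar>y - x\<bar>" "F y - F x = (y - x) * F' \<eta>"
proof (cases x y rule: linorder_cases)
  case less
  from MVT2[OF less, of F F'] assms obtain z where "x < z" "z < y" "F y - F x = (y - x) * F' z" by blast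
  with that[of z] less show ?thesis by auto
next
  case equal with that[of x] show ?thesis by auto
next
  case greater
  from MVT2[OF greater, of F F'] assms obtain z where "y < z" "z < x" "F x - F y = (x - y) * F' z" by blast
  with that[of z] greater show ?thesis by (auto simp: algebra_simps)
qed

text \<open>Cauchy's mean value theorem is applied twice, against s^3 and then against 3 s^2. The
  third derivative has to exist but not to be continuous, and the final quotient of - s f3 / 2 by 6
  s is the source of 1/12.\<close>

lemma trapezoid_error_pos:
  fixes f f1 f2 f3 :: "real \<Rightarrow> real"
  assumes f: "\<And>s. (f has_real_derivative f1 s) (at s)"
    and f1: "\<And>s. (f1 has_real_derivative f2 s) (at s)"
    and f2: "\<And>s. (f2 has_real_derivative f3 s) (at s)"
    and d: "d > 0"
  obtains \<eta> where "\<bar>\<eta> - x\<bar> \<le> d"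
    "f (x + d) - f x - d * (f1 x + f1 (x + d)) / 2 = - (d ^ 3 / 12) * f3 \<eta>"
proof -
  note [derivative_intros] = DERIV_chain2[OF f] DERIV_chain2[OF f1] DERIV_chain2[OF f2]
  \<comment> \<open>\<open>t\<close> is the error of the rule with a moving right end point,
    \<open>t1\<close> and \<open>t2\<close> are its derivatives; \<open>t\<close> and
    \<open>t1\<close> vanish at 0, as the two applications require.\<close>
  define t where "t s = f (x + s) - f x - s * (f1 x + f1 (x + s)) / 2" for s
  define t1 where "t1 s = f1 (x + s) / 2 - f1 x / 2 - s * f2 (x + s) / 2" for s
  define t2 where "t2 s = - s * f3 (x + s) / 2" for s
  have t: "(t has_real_derivative t1 s) (at s)" for s
    unfolding t_def t1_def by (auto intro!: derivative_eq_intros simp: field_simps)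
  have t1: "(t1 has_real_derivative t2 s) (at s)" for s
    unfolding t1_def t2_def by (auto intro!: derivative_eq_intros simp: field_simps)
  have cube: "((\<lambda>s. s ^ 3) has_real_derivative 3 * s ^ 2) (at s)" for s :: real
    by (auto intro!: derivative_eq_intros)
  have sq: "((\<lambda>s. 3 * s ^ 2) has_real_derivative 6 * s) (at s)" for s :: real
    by (auto intro!: derivative_eq_intros)
  have "\<exists>c. 0 < c \<and> c < d \<and> (t d - t 0) * (3 * c ^ 2) = (d ^ 3 - 0 ^ 3) * t1 c"
    using d t cube by (intro GMVT'[of 0 d t "\<lambda>s. s ^ 3" "\<lambda>s. 3 * s ^ 2" t1]) (auto intro: DERIV_isCont)
  then obtain c where c: "0 < c" "c < d" "t d * (3 * c ^ 2) = d ^ 3 * t1 c"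
    by (auto simp: t_def)
  have "\<exists>e. 0 < e \<and> e < c \<and> (t1 c - t1 0) * (6 * e) = (3 * c ^ 2 - 3 * 0 ^ 2) * t2 e"
    using c t1 sq by (intro GMVT'[of 0 c t1 "\<lambda>s. 3 * s ^ 2" "\<lambda>s. 6 * s" t2]) (auto intro: DERIV_isCont)
  then obtain e where e: "0 < e" "e < c" "t1 c * (6 * e) = 3 * c ^ 2 * t2 e"
    by (auto simp: t1_def)
  from e(3) have "e * (4 * t1 c + c ^ 2 * f3 (x + e)) = 0" by (simp add: t2_def algebra_simps)
  with e have t1c: "t1 c = - (c ^ 2) * f3 (x + e) / 4" by simp
  from c(3) have "c ^ 2 * (3 * t d + d ^ 3 * f3 (x + e) / 4) = 0" by (simp add: t1c algebra_simps)
  with c have "t d = - (d ^ 3 / 12) * f3 (x + e)" by simp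
  with c e show ?thesis by (intro that[of "x + e"]) (auto simp: t_def)
qed

lemma trapezoid_error:
  fixes f f1 f2 f3 :: "real \<Rightarrow> real"
  assumes f: "\<And>s. (f has_real_derivative f1 s) (at s)"
    and f1: "\<And>s. (f1 has_real_derivative f2 s) (at s)"
    and f2: "\<And>s. (f2 has_real_derivative f3 s) (at s)"
  obtains \<eta> where "\<bar>\<eta> - x\<bar> \<le> \<bar>d\<bar>"
    "f (x + d) - f x - d * (f1 x + f1 (x + d)) / 2 = - (d ^ 3 / 12) * f3 \<eta>"
proof (cases d "0 :: real" rule: linorder_cases)
  case less
  note [derivative_intros] = DERIV_chain2[OF f] DERIV_chain2[OF f1] DERIV_chain2[OF f2]
  \<comment> \<open>The reflection u -> - u turns a negative step into a positive one; the odd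
    derivatives change sign, and so does the cube of the step.\<close>
  have 1: "((\<lambda>u. f (- u)) has_real_derivative - f1 (- s)) (at s)" for s
    by (auto intro!: derivative_eq_intros)
  have 2: "((\<lambda>u. - f1 (- u)) has_real_derivative f2 (- s)) (at s)" for s
    by (auto intro!: derivative_eq_intros)
  have 3: "((\<lambda>u. f2 (- u)) has_real_derivative - f3 (- s)) (at s)" for s
    by (auto intro!: derivative_eq_intros)
  obtain \<eta> where \<eta>: "\<bar>\<eta> - (- x)\<bar> \<le> - d"
    "f (- (- x + - d)) - f (- (- x)) - (- d) * (- f1 (- (- x)) + - f1 (- (- x + - d))) / 2
      = - ((- d) ^ 3 / 12) * (- f3 (- \<eta>))"
    using trapezoid_error_pos[OF 1 2 3, of "- d" "- x"] less by auto
  show ?thesis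
    by (rule that[of "- \<eta>"]) (use \<eta> less in \<open>auto simp: algebra_simps\<close>)
next
  case equal with that[of x] show ?thesis by auto
next
  case greater
  with trapezoid_error_pos[OF f f1 f2 greater, of x] that show ?thesis by auto
qed

lemma C3_DERIV:
  assumes "C3 f"
  shows "(f has_real_derivative dk 1 f x) (at x)"
    and "(dk 1 f has_real_derivative dk 2 f x) (at x)"
    and "(dk 2 f has_real_derivative dk 3 f x) (at x)"
    and "continuous_on UNIV (dk 3 f)"
proof -
  have d: "(dk k f has_real_derivative dk (Suc k) f x) (at x)" if "k < 3" for k x
  proof -
    from assms that have "dk k f differentiable at x" by (auto simp: C3_def)
    then have "(dk k f has_real_derivative deriv (dk k f) x) (at x)"
      by (meson DERIV_deriv_iff_real_differentiable)
    then show ?thesis by (simp add: dk_def)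
  qed
  from d[of 0 x] d[of 1 x] d[of 2 x] assms
  show "(f has_real_derivative dk 1 f x) (at x)"
    "(dk 1 f has_real_derivative dk 2 f x) (at x)"
    "(dk 2 f has_real_derivative dk 3 f x) (at x)" "continuous_on UNIV (dk 3 f)"
    by (simp_all add: dk_def C3_def numeral_2_eq_2 numeral_3_eq_3)
qed

lemma apow_nonneg: "apow x a \<ge> 0" by (simp add: apow_def)

lemma apow_mono: "a \<ge> 0 \<Longrightarrow> \<bar>x\<bar> \<le> \<bar>y\<bar> \<Longrightarrow> apow x a \<le> apow y a"
  by (simp add: apow_def powr_mono2)

lemma apow_measurable [measurable]: "(\<lambda>x. apow x a) \<in> borel_measurable borel"
  unfolding apow_def by (cases "a = 0") auto

text \<open>Caratheodory's form of the derivative at 0. For \<open>f 0 = 0\<close> with derivative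
  \<open>D\<close> there, the value \<open>D\<close> at 0 makes \<open>f t = t * slope f D t\<close>
  hold without exception, with a factor continuous at 0.\<close>

definition slope :: "(real \<Rightarrow> real) \<Rightarrow> real \<Rightarrow> real \<Rightarrow> real" where
  "slope f D t = (if t = 0 then D else f t / t)"

lemma slope_eq: "f 0 = 0 \<Longrightarrow> f t = t * slope f D t"
  by (simp add: slope_def)

lemma isCont_slope:
  assumes "(f has_real_derivative D) (at 0)" "f 0 = 0"
  shows "isCont (slope f D) 0"
proof -
  from assms have "((\<lambda>t. f t / t) \<longlongrightarrow> D) (at 0)" by (simp add: has_field_derivative_iff)
  then have "(slope f D \<longlongrightarrow> D) (at 0)"
    by (rule Lim_transform_eventually) (auto simp: slope_def eventually_at_filter)
  then show ?thesis by (simp add: isCont_def slope_def)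
qed

text \<open>Carries bounds on the derivative over to the difference quotient. That \<open>s\<close>
  is no farther from 0 than \<open>t\<close> matters for bounds that grow with the argument.\<close>

lemma slope_mvt:
  assumes "\<And>s. (f has_real_derivative f' s) (at s)" "f 0 = 0"
  shows "\<exists>s. \<bar>s\<bar> \<le> \<bar>t\<bar> \<and> slope f (f' 0) t = f' s"
proof (cases "t = 0")
  case False
  obtain \<eta> where "\<bar>\<eta> - 0\<bar> \<le> \<bar>t - 0\<bar>" "f t - f 0 = (t - 0) * f' \<eta>"
    using mvt_between[OF assms(1), where x = 0 and y = t] by blast
  with False assms(2) show ?thesis by (intro exI[of _ \<eta>]) (auto simp: slope_def)
qed (auto simp: slope_def)

text \<open>Only exp w \<ge> 1 + w is used. Weights at the two end points, instead of a supremum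
  over the segment between them, keep the right side integrable when \<open>u\<close> and
  \<open>v\<close> are values of \<open>b\<close>.\<close>

lemma exp_diff_le:
  fixes u v :: real
  shows "\<bar>exp u - exp v\<bar> \<le> \<bar>u - v\<bar> * (exp u + exp v)"
proof -
  have *: "exp u - exp v \<le> \<bar>u - v\<bar> * (exp u + exp v)" for u v :: real
  proof -
    have "1 - exp (v - u) \<le> \<bar>u - v\<bar>" using exp_ge_add_one_self[of "v - u"] by linarith
    then have "(1 - exp (v - u)) * exp u \<le> \<bar>u - v\<bar> * exp u" by (intro mult_right_mono) auto
    also have "\<dots> \<le> \<bar>u - v\<bar> * (exp u + exp v)" by (intro mult_left_mono) auto
    finally show ?thesis by (simp add: algebra_simps exp_diff)
  qed
  from *[of u v] *[of v u] show ?thesis by (simp add: abs_minus_commute add.commute abs_le_iff)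
qed

subsection \<open>Limits of integrals and of characteristic functions\<close>

lemma power_le_one_plus_powr:
  fixes z :: real
  assumes "real j \<le> x"
  shows "\<bar>z\<bar> ^ j \<le> 1 + \<bar>z\<bar> powr x"
proof (cases "\<bar>z\<bar> \<le> 1")
  case True
  then have "\<bar>z\<bar> ^ j \<le> 1" by (simp add: power_le_one)
  then show ?thesis by (simp add: add_increasing2)
next
  case False
  then have "\<bar>z\<bar> ^ j = \<bar>z\<bar> powr real j" by (simp add: powr_realpow)
  also have "\<dots> \<le> \<bar>z\<bar> powr x" using False assms by (intro powr_mono) auto
  finally show ?thesis by simp
qed

text \<open>For |z| \<ge> R the negative power |z|^(6 - x) is at most R^(6 - x), which tends to 0 as
  R grows; this gain makes integrands of order six uniformly integrable.\<close>

lemma tail_power_le_powr: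
  fixes z :: real
  assumes R: "1 \<le> R" "R \<le> \<bar>z\<bar>" and x: "x > 6"
  shows "1 + z ^ 6 \<le> 2 * R powr (6 - x) * \<bar>z\<bar> powr x"
proof -
  have z: "\<bar>z\<bar> \<ge> 1" using R by linarith
  then have "1 + z ^ 6 \<le> 2 * \<bar>z\<bar> ^ 6"
    using one_le_power[of "\<bar>z\<bar>" 6] by (simp add: power_even_abs)
  also have "\<bar>z\<bar> ^ 6 = \<bar>z\<bar> powr (6 - x) * \<bar>z\<bar> powr x"
    using z powr_realpow[of "\<bar>z\<bar>" 6] by (simp add: powr_add[symmetric])
  also have "\<dots> \<le> R powr (6 - x) * \<bar>z\<bar> powr x"
    using powr_mono2'[of "6 - x" R "\<bar>z\<bar>"] R x by (intro mult_right_mono) auto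
  finally show ?thesis by simp
qed

text \<open>A form of Vitali's theorem: the weights \<open>k n\<close> have uniformly bounded moments of an order
  above 6, so integrands of order \<open>z ^ 6\<close> are uniformly integrable.\<close>

lemma integral_tendsto_of_moment_bound:
  fixes F k :: "nat \<Rightarrow> real \<Rightarrow> real" and f :: "real \<Rightarrow> real" and \<mu> :: "real measure"
  assumes mu: "finite_measure \<mu>" "sets \<mu> = sets borel"
    and F [measurable]: "\<And>n. F n \<in> borel_measurable borel"
    and lim: "\<And>z. (\<lambda>n. F n z) \<longlonglongrightarrow> f z"
    and k0: "\<And>n z. 0 \<le> k n z"
    and kint: "\<And>n. integrable \<mu> (k n)" "\<And>n. integrable \<mu> (\<lambda>z. \<bar>z\<bar> powr x * k n z)"
    and B: "\<And>n. (\<integral>z. \<bar>z\<bar> powr x * k n z \<partial>\<mu>) \<le> B"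
    and bd: "\<And>n z. \<bar>F n z\<bar> \<le> (C * (1 + z ^ 6) + \<eta> n * \<bar>z\<bar> powr x) * k n z"
    and \<eta>: "\<eta> \<longlonglongrightarrow> 0" "\<And>n. 0 \<le> \<eta> n" and C: "0 \<le> C" and x: "x > 6"
    and loc: "\<And>R. \<exists>D. \<forall>n z. \<bar>z\<bar> \<le> R \<longrightarrow> \<bar>F n z\<bar> \<le> D"
  shows "integrable \<mu> f" and "(\<lambda>n. \<integral>z. F n z \<partial>\<mu>) \<longlonglongrightarrow> (\<integral>z. f z \<partial>\<mu>)"
proof -
  interpret finite_measure \<mu> by fact
  note mu(2)[measurable_cong]
  have f [measurable]: "f \<in> borel_measurable borel"
    by (rule borel_measurable_LIMSEQ_real[OF lim F])
  have "0 \<le> (\<integral>z. \<bar>z\<bar> powr x * k 0 z \<partial>\<mu>)" by (intro Bochner_Integration.integral_nonneg mult_nonneg_nonneg k0) simp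
  then have B0: "0 \<le> B" using B[of 0] by linarith
  \<comment> \<open>\<open>\<tau> n R\<close> bounds the integral of |F n| over |z| > R: the part of
    order six gains R^(6 - x), the remaining part has the vanishing coefficient
    \<open>\<eta> n\<close>.\<close>
  define \<tau> where "\<tau> n R = (2 * C * R powr (6 - x) + \<eta> n) * B" for n R
  define S where "S R = {z::real. R < \<bar>z\<bar>}" for R
  have S [measurable]: "S R \<in> sets borel" for R unfolding S_def by measurable
  have tail: "integrable \<mu> (\<lambda>z. indicator (S R) z * F n z)"
    "(\<integral>z. \<bar>indicator (S R) z * F n z\<bar> \<partial>\<mu>) \<le> \<tau> n R" if "1 \<le> R" for n R
  proof -
    have le: "\<bar>indicator (S R) z * F n z\<bar> \<le> (2 * C * R powr (6 - x) + \<eta> n) * (\<bar>z\<bar> powr x * k n z)" for z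
    proof (cases "z \<in> S R")
      case True
      have "C * (1 + z ^ 6) + \<eta> n * \<bar>z\<bar> powr x \<le> C * (2 * R powr (6 - x) * \<bar>z\<bar> powr x) + \<eta> n * \<bar>z\<bar> powr x"
        using True that x C by (intro add_right_mono mult_left_mono tail_power_le_powr) (auto simp: S_def)
      from mult_right_mono[OF this k0[of n z]] bd[of n z] True show ?thesis
        by (simp add: algebra_simps)
    qed (use k0 \<eta>(2) C in auto)
    show "integrable \<mu> (\<lambda>z. indicator (S R) z * F n z)"
      using order_trans[OF le abs_ge_self]
      by (intro Bochner_Integration.integrable_bound[OF integrable_mult_right[OF kint(2)[of n],
            of "2 * C * R powr (6 - x) + \<eta> n"]]) auto
    then have "(\<integral>z. \<bar>indicator (S R) z * F n z\<bar> \<partial>\<mu>)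
        \<le> (\<integral>z. (2 * C * R powr (6 - x) + \<eta> n) * (\<bar>z\<bar> powr x * k n z) \<partial>\<mu>)"
      by (intro integral_mono integrable_abs integrable_mult_right kint le) auto
    also have "\<dots> \<le> \<tau> n R"
      unfolding \<tau>_def using \<eta>(2) C by (simp add: mult_left_mono B)
    finally show "(\<integral>z. \<bar>indicator (S R) z * F n z\<bar> \<partial>\<mu>) \<le> \<tau> n R" .
  qed
  have \<tau>lim: "(\<lambda>n. \<tau> n R) \<longlonglongrightarrow> 2 * C * R powr (6 - x) * B" for R
  proof -
    have "(\<lambda>n. \<tau> n R) \<longlonglongrightarrow> (2 * C * R powr (6 - x) + 0) * B"
      unfolding \<tau>_def by (intro tendsto_intros \<eta>(1))
    then show ?thesis by simp
  qed
  \<comment> \<open>In the absence of a dominating function the tail bound passes to the limit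
    \<open>f\<close> by Fatou's lemma.\<close>
  have ftail_nn: "(\<integral>\<^sup>+z. ennreal \<bar>indicator (S R) z * f z\<bar> \<partial>\<mu>) \<le> ennreal (2 * C * R powr (6 - x) * B)"
    if "1 \<le> R" for R
  proof -
    have lm: "(\<lambda>n. ennreal \<bar>indicator (S R) z * F n z\<bar>) \<longlonglongrightarrow> ennreal \<bar>indicator (S R) z * f z\<bar>" for z
      by (intro tendsto_intros lim)
    have "(\<integral>\<^sup>+z. ennreal \<bar>indicator (S R) z * f z\<bar> \<partial>\<mu>)
        = (\<integral>\<^sup>+z. liminf (\<lambda>n. ennreal \<bar>indicator (S R) z * F n z\<bar>) \<partial>\<mu>)"
      using lim_imp_Liminf[OF _ lm] by simp
    also have "\<dots> \<le> liminf (\<lambda>n. \<integral>\<^sup>+z. ennreal \<bar>indicator (S R) z * F n z\<bar> \<partial>\<mu>)"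
      by (rule nn_integral_liminf) simp
    also have "\<dots> \<le> liminf (\<lambda>n. ennreal (\<tau> n R))"
    proof (intro Liminf_mono always_eventually allI)
      fix n
      have "(\<integral>\<^sup>+z. ennreal \<bar>indicator (S R) z * F n z\<bar> \<partial>\<mu>) = ennreal (\<integral>z. \<bar>indicator (S R) z * F n z\<bar> \<partial>\<mu>)"
        by (rule nn_integral_eq_integral) (use tail(1)[OF that] in auto)
      then show "(\<integral>\<^sup>+z. ennreal \<bar>indicator (S R) z * F n z\<bar> \<partial>\<mu>) \<le> ennreal (\<tau> n R)"
        using tail(2)[OF that, of n] by (simp add: ennreal_leI)
    qed
    also have "\<dots> = ennreal (2 * C * R powr (6 - x) * B)"
      by (intro lim_imp_Liminf tendsto_ennrealI \<tau>lim) simp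
    finally show ?thesis .
  qed
  have ftail: "integrable \<mu> (\<lambda>z. indicator (S R) z * f z)"
    "(\<integral>z. \<bar>indicator (S R) z * f z\<bar> \<partial>\<mu>) \<le> 2 * C * R powr (6 - x) * B" if "1 \<le> R" for R
  proof -
    show 1: "integrable \<mu> (\<lambda>z. indicator (S R) z * f z)"
      by (rule integrableI_bounded) (use le_less_trans[OF ftail_nn[OF that]] in auto)
    have "(\<integral>\<^sup>+z. ennreal \<bar>indicator (S R) z * f z\<bar> \<partial>\<mu>) = ennreal (\<integral>z. \<bar>indicator (S R) z * f z\<bar> \<partial>\<mu>)"
      by (rule nn_integral_eq_integral) (use 1 in auto)
    from ftail_nn[OF that, unfolded this]
    show "(\<integral>z. \<bar>indicator (S R) z * f z\<bar> \<partial>\<mu>) \<le> 2 * C * R powr (6 - x) * B"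
      using C B0 by (subst (asm) ennreal_le_iff) auto
  qed
  \<comment> \<open>On the ball the hypothesis \<open>loc\<close> gives a constant bound and
    \<open>\<mu>\<close> is finite, so dominated convergence applies there.\<close>
  have body: "integrable \<mu> (\<lambda>z. indicator (- S R) z * F n z)"
    "integrable \<mu> (\<lambda>z. indicator (- S R) z * f z)"
    "(\<lambda>n. \<integral>z. indicator (- S R) z * F n z \<partial>\<mu>) \<longlonglongrightarrow> (\<integral>z. indicator (- S R) z * f z \<partial>\<mu>)" for R n
  proof -
    obtain D where D: "\<And>n z. \<bar>z\<bar> \<le> R \<Longrightarrow> \<bar>F n z\<bar> \<le> D" using loc[of R] by blast
    then have D': "norm (indicator (- S R) z * F n z) \<le> \<bar>D\<bar>" for n z
    proof (cases "\<bar>z\<bar> \<le> R")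
      case True
      with D[OF True, of n] show ?thesis by (simp add: S_def)
    qed (simp add: S_def)
    have cm: "- S R \<in> sets borel" by simp
    show "integrable \<mu> (\<lambda>z. indicator (- S R) z * F n z)"
      by (rule integrable_const_bound[of _ "\<bar>D\<bar>"]) (use D' cm in auto)
    show "integrable \<mu> (\<lambda>z. indicator (- S R) z * f z)"
      by (rule integrable_dominated_convergence[where s = "\<lambda>n z. indicator (- S R) z * F n z" and w = "\<lambda>_. \<bar>D\<bar>"])
         (use D' cm in \<open>auto intro!: tendsto_intros lim AE_I2\<close>)
    show "(\<lambda>n. \<integral>z. indicator (- S R) z * F n z \<partial>\<mu>) \<longlonglongrightarrow> (\<integral>z. indicator (- S R) z * f z \<partial>\<mu>)"
      by (rule integral_dominated_convergence[where w = "\<lambda>_. \<bar>D\<bar>"])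
         (use D' cm in \<open>auto intro!: tendsto_intros lim AE_I2\<close>)
  qed
  have split: "indicator (- S R) z * c + indicator (S R) z * c = c" for R z and c :: real
    by (auto simp: indicator_def)
  from Bochner_Integration.integrable_add[OF body(2)[of 1] ftail(1)[of 1]]
  show "integrable \<mu> f" by (simp add: split)
  show "(\<lambda>n. \<integral>z. F n z \<partial>\<mu>) \<longlonglongrightarrow> (\<integral>z. f z \<partial>\<mu>)"
  proof (rule LIMSEQ_I)
    fix e :: real assume e: "e > 0"
    \<comment> \<open>Since 6 - x < 0, some radius has a small limiting tail; \<open>n\<close> is
      taken large only afterwards, for that fixed radius.\<close>
    have lim0: "((\<lambda>R. 2 * C * R powr (6 - x) * B) \<longlongrightarrow> 2 * C * 0 * B) at_top"
      using x by (intro tendsto_intros tendsto_neg_powr filterlim_ident) auto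
    have "\<forall>\<^sub>F R in at_top. 2 * C * R powr (6 - x) * B < e / 4"
      by (rule order_tendstoD(2)[OF lim0]) (use e in simp)
    then have "\<forall>\<^sub>F R in at_top. 2 * C * R powr (6 - x) * B < e / 4 \<and> 1 \<le> R"
      using eventually_ge_at_top[of "1::real"] by eventually_elim auto
    then obtain R where R: "2 * C * R powr (6 - x) * B < e / 4" "1 \<le> R"
      using eventually_happens'[OF trivial_limit_at_top_linorder] by blast
    have "\<forall>\<^sub>F n in sequentially. \<tau> n R < e / 4"
      by (rule order_tendstoD(2)[OF \<tau>lim R(1)])
    moreover have "\<forall>\<^sub>F n in sequentially.
        dist (\<integral>z. indicator (- S R) z * F n z \<partial>\<mu>) (\<integral>z. indicator (- S R) z * f z \<partial>\<mu>) < e / 4"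
      using body(3)[of R] e by (intro tendstoD) auto
    ultimately have "\<forall>\<^sub>F n in sequentially. norm ((\<integral>z. F n z \<partial>\<mu>) - (\<integral>z. f z \<partial>\<mu>)) < e"
    proof eventually_elim
      case (elim n)
      have 1: "(\<integral>z. F n z \<partial>\<mu>) = (\<integral>z. indicator (- S R) z * F n z \<partial>\<mu>) + (\<integral>z. indicator (S R) z * F n z \<partial>\<mu>)"
        using body(1)[of R n] tail(1)[OF R(2), of n]
        by (simp add: Bochner_Integration.integral_add[symmetric] split)
      have 2: "(\<integral>z. f z \<partial>\<mu>) = (\<integral>z. indicator (- S R) z * f z \<partial>\<mu>) + (\<integral>z. indicator (S R) z * f z \<partial>\<mu>)"
        using body(2)[of R] ftail(1)[OF R(2)]
        by (simp add: Bochner_Integration.integral_add[symmetric] split)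
      have 3: "\<bar>\<integral>z. indicator (S R) z * F n z \<partial>\<mu>\<bar> \<le> \<tau> n R"
        by (rule order_trans[OF integral_abs_bound tail(2)[OF R(2)]])
      have 4: "\<bar>\<integral>z. indicator (S R) z * f z \<partial>\<mu>\<bar> \<le> 2 * C * R powr (6 - x) * B"
        by (rule order_trans[OF integral_abs_bound ftail(2)[OF R(2)]])
      from 1 2 3 4 elim R(1) e show ?case unfolding dist_real_def real_norm_def by linarith
    qed
    then show "\<exists>no. \<forall>n\<ge>no. norm ((\<integral>z. F n z \<partial>\<mu>) - (\<integral>z. f z \<partial>\<mu>)) < e"
      by (simp add: eventually_sequentially)
  qed
qed

text \<open>Caratheodory's factorization \<open>exp z - 1 = r z * z\<close> at z = c / n turns the
  expression into \<open>r (c / of_nat n) * c\<close> for n > 0.\<close>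

lemma n_times_exp_minus_1:
  fixes c :: complex
  shows "(\<lambda>n. of_nat n * (exp (c / of_nat n) - 1)) \<longlonglongrightarrow> c"
proof -
  have "(exp has_field_derivative 1) (at (0::complex))" using DERIV_exp[of "0::complex"] by simp
  then obtain r where r: "\<And>z. exp z - 1 = r z * z" "isCont r (0::complex)" "r 0 = 1"
    unfolding CARAT_DERIV by auto
  have "(\<lambda>n. c / of_nat n) \<longlonglongrightarrow> 0" by (rule tendsto_divide_0[OF tendsto_const tendsto_of_nat])
  then have "(\<lambda>n. r (c / of_nat n) * c) \<longlonglongrightarrow> r 0 * c"
    by (intro tendsto_intros isCont_tendsto_compose[OF r(2)])
  moreover have "\<forall>\<^sub>F n in sequentially. r (c / of_nat n) * c = of_nat n * (exp (c / of_nat n) - 1)"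
    using eventually_gt_at_top[of 0] by eventually_elim (simp add: r(1))
  ultimately show ?thesis using r(3) by (auto intro: Lim_transform_eventually)
qed

text \<open>Comparison with exp (c / n): n-th powers of two points of the unit disc differ by at
  most n times their distance, so no complex logarithm is needed. The condition
  \<open>Re c \<le> 0\<close> places the comparison points in the disc.\<close>

lemma power_tendsto_exp:
  fixes z :: "nat \<Rightarrow> complex"
  assumes z: "\<And>n. norm (z n) \<le> 1" and lim: "(\<lambda>n. of_nat n * (z n - 1)) \<longlonglongrightarrow> c" and c: "Re c \<le> 0"
  shows "(\<lambda>n. z n ^ n) \<longlonglongrightarrow> exp c"
proof -
  define w where "w n = exp (c / of_nat n)" for n
  have w: "norm (w n) \<le> 1" for n
    using c by (simp add: w_def Re_divide_of_nat divide_nonpos_nonneg)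
  have "(\<lambda>n. of_nat n * (z n - 1) - of_nat n * (w n - 1)) \<longlonglongrightarrow> c - c"
    unfolding w_def by (intro tendsto_diff lim n_times_exp_minus_1)
  then have "(\<lambda>n. norm (of_nat n * (z n - 1) - of_nat n * (w n - 1))) \<longlonglongrightarrow> 0"
    by (intro tendsto_norm_zero) simp
  moreover have "norm (z n ^ n - w n ^ n) \<le> norm (of_nat n * (z n - 1) - of_nat n * (w n - 1))" for n
  proof -
    have "norm (z n ^ n - w n ^ n) \<le> real n * norm (z n - w n)" by (rule norm_power_diff[OF z w])
    also have "\<dots> = norm (of_nat n * (z n - w n))" by (simp add: norm_mult)
    finally show ?thesis by (simp add: algebra_simps)
  qed
  ultimately have "(\<lambda>n. z n ^ n - w n ^ n) \<longlonglongrightarrow> 0"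
    by (auto intro!: Lim_null_comparison[where g = "\<lambda>n. norm (of_nat n * (z n - 1) - of_nat n * (w n - 1))"])
  moreover have "(\<lambda>n. w n ^ n) \<longlonglongrightarrow> exp c"
  proof (rule Lim_transform_eventually[OF tendsto_const])
    show "\<forall>\<^sub>F n in sequentially. exp c = w n ^ n"
      using eventually_gt_at_top[of 0] by eventually_elim (simp add: w_def exp_of_nat_mult[symmetric])
  qed
  ultimately show ?thesis using tendsto_add[of "\<lambda>n. z n ^ n - w n ^ n" 0 sequentially "\<lambda>n. w n ^ n"] by simp
qed

text \<open>Lets the characteristic function of a general normal law be read off from the standard
  one.\<close>

lemma normal_distribution_eq_distr:
  assumes "0 < s"
  shows "density lborel (normal_density m s) = distr std_normal_distribution borel (\<lambda>x. m + s * x)"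
proof -
  interpret real_distribution std_normal_distribution by (rule real_dist_normal_dist)
  have "distributed std_normal_distribution lborel (\<lambda>x. x) std_normal_density"
    by (auto simp: distributed_def distr_id2)
  from normal_density_affine[OF this, of s m] assms
  have "distributed std_normal_distribution lborel (\<lambda>x. m + s * x) (normal_density m s)" by simp
  then have "distr std_normal_distribution lborel (\<lambda>x. m + s * x) = density lborel (normal_density m s)"
    by (simp add: distributed_def)
  moreover have "distr std_normal_distribution lborel (\<lambda>x. m + s * x) = distr std_normal_distribution borel (\<lambda>x. m + s * x)"
    by (rule distr_cong) simp_all
  ultimately show ?thesis by simp
qed

lemma char_normal:
  assumes "0 < s"
  shows "char (density lborel (normal_density m s)) t = exp (- complex_of_real (s\<^sup>2 * t\<^sup>2 / 2) + \<i> * of_real (t * m))"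
proof -
  have "char (density lborel (normal_density m s)) t = (CLINT x|std_normal_distribution. iexp (t * m) * iexp ((t * s) * x))"
    unfolding normal_distribution_eq_distr[OF assms] char_def
    by (subst integral_distr) (simp_all add: exp_add[symmetric] algebra_simps)
  also have "\<dots> = iexp (t * m) * char std_normal_distribution (t * s)"
    by (simp add: char_def)
  also have "\<dots> = iexp (t * m) * exp (- complex_of_real (s\<^sup>2 * t\<^sup>2 / 2))"
    by (simp add: char_std_normal_distribution exp_of_real[symmetric] power_mult_distrib mult.commute)
  finally show ?thesis by (simp add: exp_add[symmetric] add.commute)
qed

lemma char_sum_PiM:
  fixes X :: "'a \<Rightarrow> real"
  assumes "prob_space N" and X [measurable]: "X \<in> borel_measurable N" and "finite I"
  shows "char (distr (PiM I (\<lambda>_. N)) borel (\<lambda>\<omega>. \<Sum>i\<in>I. X (\<omega> i))) t = (char (distr N borel X) t) ^ card I"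
proof -
  interpret N: prob_space N by fact
  interpret P: product_sigma_finite "\<lambda>_. N" by standard
  have "char (distr (PiM I (\<lambda>_. N)) borel (\<lambda>\<omega>. \<Sum>i\<in>I. X (\<omega> i))) t
      = (CLINT \<omega>|PiM I (\<lambda>_. N). (\<Prod>i\<in>I. iexp (t * X (\<omega> i))))"
    unfolding char_def using assms(3)
    by (subst integral_distr) (simp_all add: sum_distrib_left exp_sum)
  also have "\<dots> = (\<Prod>i\<in>I. CLINT x|N. iexp (t * X x))"
    by (rule P.product_integral_prod[OF assms(3)]) (auto intro!: N.integrable_const_bound[where B = 1])
  also have "\<dots> = (char (distr N borel X) t) ^ card I"
    unfolding char_def by (subst integral_distr) simp_all
  finally show ?thesis .
qed

text \<open>The entries of a row are i.i.d., so the characteristic function of the row sum is an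
  n-th power, and the limit of n (char - 1) takes the place of a Lindeberg condition. The common law
  of a row may change with \<open>n\<close>, as the scale of the proposal does.\<close>

lemma row_sums_weak_conv_normal:
  fixes X :: "nat \<Rightarrow> 'a \<Rightarrow> real"
  assumes N: "\<And>n. prob_space (N n)" and X: "\<And>n. X n \<in> borel_measurable (N n)" and s: "0 < s"
    and lim: "\<And>t. (\<lambda>n. of_nat n * (char (distr (N n) borel (X n)) t - 1))
      \<longlonglongrightarrow> - complex_of_real (s\<^sup>2 * t\<^sup>2 / 2) + \<i> * of_real (t * m)"
  shows "weak_conv_m (\<lambda>n. distr (PiM {1..n} (\<lambda>i. N n)) borel (\<lambda>\<omega>. \<Sum>i\<in>{1..n}. X n (\<omega> i)))
    (density lborel (normal_density m s))"
proof (rule levy_continuity)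
  fix n
  interpret P: prob_space "PiM {1..n} (\<lambda>i. N n)" by (rule prob_space_PiM) (rule N)
  note X[measurable]
  show "real_distribution (distr (PiM {1..n} (\<lambda>i. N n)) borel (\<lambda>\<omega>. \<Sum>i\<in>{1..n}. X n (\<omega> i)))"
    by (rule P.real_distribution_distr) measurable
next
  interpret real_distribution std_normal_distribution by (rule real_dist_normal_dist)
  show "real_distribution (density lborel (normal_density m s))"
    unfolding normal_distribution_eq_distr[OF s] by (rule real_distribution_distr) simp
next
  fix t
  have "(\<lambda>n. char (distr (N n) borel (X n)) t ^ n) \<longlonglongrightarrow> exp (- complex_of_real (s\<^sup>2 * t\<^sup>2 / 2) + \<i> * of_real (t * m))"
  proof (rule power_tendsto_exp[OF _ lim])
    show "norm (char (distr (N n) borel (X n)) t) \<le> 1" for n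
      using N X by (intro real_distribution.cmod_char_le_1 prob_space.real_distribution_distr)
  qed simp
  then show "(\<lambda>n. char (distr (PiM {1..n} (\<lambda>i. N n)) borel (\<lambda>\<omega>. \<Sum>i\<in>{1..n}. X n (\<omega> i))) t)
      \<longlonglongrightarrow> char (density lborel (normal_density m s)) t"
    using N X by (simp add: char_sum_PiM char_normal[OF s])
qed

section \<open>Elementary functions of second order at the origin\<close>

lemma abs_sin_diff_le: "\<bar>sin x - x\<bar> \<le> x\<^sup>2" "\<bar>sin x - x\<bar> \<le> \<bar>x\<bar> ^ 3" for x :: real
proof -
  have *: "a \<le> c" if "a \<le> k * c" "0 \<le> c" "k \<le> 1" for a c k :: real
    using that mult_right_mono[of k 1 c] by simp
  have "\<bar>sin x - x\<bar> \<le> 1 / 2 * x\<^sup>2" "\<bar>sin x - x\<bar> \<le> 1 / 6 * \<bar>x\<bar> ^ 3"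
    using Maclaurin_sin_bound[of x 2] Maclaurin_sin_bound[of x 3]
    by (simp_all add: numeral_2_eq_2 numeral_3_eq_3 sin_coeff_def field_simps abs_mult)
  from this[THEN *] show "\<bar>sin x - x\<bar> \<le> x\<^sup>2" "\<bar>sin x - x\<bar> \<le> \<bar>x\<bar> ^ 3" by simp_all
qed

lemma abs_cos_minus_1_le: "\<bar>cos x - 1\<bar> \<le> x\<^sup>2" for x :: real
proof -
  have "cos x - 1 = - 2 * (sin (x / 2))\<^sup>2" using cos_double_sin[of "x / 2"] by simp
  then have "\<bar>cos x - 1\<bar> = 2 * (sin (x / 2))\<^sup>2" by simp
  also have "\<dots> \<le> 2 * (x / 2)\<^sup>2"
    using abs_sin_x_le_abs_x[of "x / 2"] by (intro mult_left_mono) (simp_all add: abs_le_square_iff[symmetric])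
  also have "\<dots> \<le> x\<^sup>2" by (simp add: power_divide)
  finally show ?thesis .
qed

text \<open>The cubic bound on sin x - x gives the zero limit; the quadratic bound is the domination
  required of test functions.\<close>

lemma sin_second_order: "((\<lambda>s. (sin (t * s) - t * s) / s\<^sup>2) \<longlongrightarrow> 0) (at (0::real))"
proof (rule Lim_null_comparison)
  have "\<bar>(sin (t * s) - t * s) / s\<^sup>2\<bar> \<le> \<bar>t\<bar> ^ 3 * \<bar>s\<bar>" if "s \<noteq> 0" for s
  proof -
    have "\<bar>sin (t * s) - t * s\<bar> \<le> \<bar>t\<bar> ^ 3 * \<bar>s\<bar> * s\<^sup>2"
      using abs_sin_diff_le(2)[of "t * s"]
      by (simp add: abs_mult power_mult_distrib power3_eq_cube[of "\<bar>s\<bar>"] power2_eq_square mult.assoc)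
    then show ?thesis using that by (simp add: abs_divide divide_le_eq)
  qed
  then show "\<forall>\<^sub>F s in at 0. norm ((sin (t * s) - t * s) / s\<^sup>2) \<le> \<bar>t\<bar> ^ 3 * \<bar>s\<bar>"
    by (auto simp: eventually_at_filter)
  show "((\<lambda>s. \<bar>t\<bar> ^ 3 * \<bar>s\<bar>) \<longlongrightarrow> 0) (at 0)" by (auto intro!: tendsto_eq_intros)
qed

text \<open>The half-angle identity reduces the second-order limit to the derivative of sin at
  0.\<close>

lemma cos_second_order: "((\<lambda>s. (cos (t * s) - 1) / s\<^sup>2) \<longlongrightarrow> - (t\<^sup>2 / 2)) (at (0::real))"
proof -
  have "((\<lambda>s. sin (t * s / 2)) has_real_derivative t / 2) (at 0)"
    by (auto intro!: derivative_eq_intros)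
  then have S: "((\<lambda>s. sin (t * s / 2) / s) \<longlongrightarrow> t / 2) (at 0)" by (simp add: has_field_derivative_iff)
  have "((\<lambda>s. - 2 * (sin (t * s / 2) / s)\<^sup>2) \<longlongrightarrow> - 2 * (t / 2)\<^sup>2) (at 0)"
    by (rule tendsto_mult[OF tendsto_const tendsto_power[OF S]])
  moreover have "- 2 * (sin (t * s / 2) / s)\<^sup>2 = (cos (t * s) - 1) / s\<^sup>2" for s
    using cos_double_sin[of "t * s / 2"] by (simp add: power_divide)
  ultimately show ?thesis by (simp add: power_divide)
qed

text \<open>This is - s tanh (s / 2), an even function that behaves like - s^2 / 2 near 0.\<close>

definition drift_part :: "real \<Rightarrow> real" where
  "drift_part s = s * ((1 - exp s) / (1 + exp s))"

text \<open>\<open>exp_diff_le\<close> at 0 and \<open>s\<close> carries the factor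
  \<open>1 + exp s\<close>, which cancels the denominator.\<close>

lemma drift_part_le: "\<bar>drift_part s\<bar> \<le> s\<^sup>2"
proof -
  have p: "0 < 1 + exp s" by (simp add: add_pos_pos)
  have "\<bar>1 - exp s\<bar> \<le> \<bar>s\<bar> * (1 + exp s)" using exp_diff_le[of 0 s] by simp
  then have "\<bar>(1 - exp s) / (1 + exp s)\<bar> \<le> \<bar>s\<bar>" using p by (simp add: abs_divide divide_le_eq)
  then have "\<bar>drift_part s\<bar> \<le> \<bar>s\<bar> * \<bar>s\<bar>" unfolding drift_part_def abs_mult by (rule mult_left_mono) simp
  then show ?thesis by (simp add: power2_eq_square)
qed

lemma drift_part_second_order: "((\<lambda>s. drift_part s / s\<^sup>2) \<longlongrightarrow> - (1 / 2)) (at 0)"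
proof -
  have "((\<lambda>s. (exp s - 1) / s) \<longlongrightarrow> 1) (at (0::real))"
    using DERIV_exp[of "0::real"] by (simp add: has_field_derivative_iff)
  then have "((\<lambda>s. - ((exp s - 1) / s) / (1 + exp s)) \<longlongrightarrow> - 1 / (1 + exp 0)) (at (0::real))"
    by (intro tendsto_intros) auto
  moreover have "- ((exp s - 1) / s) / (1 + exp s) = drift_part s / s\<^sup>2" for s
  proof (cases "s = 0")
    case False
    have "- ((e - 1) / s) / c = s * ((1 - e) / c) / (s * s)" if "c \<noteq> 0" for e c
      using that False by (simp add: field_simps)
    moreover have "1 + exp s \<noteq> 0" using exp_gt_zero[of s] by linarith
    ultimately show ?thesis by (simp only: drift_part_def power2_eq_square not_False_eq_True)
  qed (simp add: drift_part_def)
  ultimately show ?thesis by simp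
qed

subsection \<open>The normalizing constant\<close>

locale locally_balanced =
  fixes \<phi> g :: "real \<Rightarrow> real" and \<mu> :: "real measure" and H \<gamma> \<beta> \<epsilon> C\<mu> :: real
  assumes dens: "integrable lborel (\<lambda>x. exp (\<phi> x))" "(\<integral>x. exp (\<phi> x) \<partial>lborel) = 1"
    and bal: "balancing g" "g 1 = 1"
    and mu_prob: "prob_space \<mu>" and mu_sets [measurable_cong]: "sets \<mu> = sets borel"
    and mu_sym: "distr \<mu> borel uminus = \<mu>"
    and mu_centred: "integrable \<mu> (\<lambda>z. z)" "(\<integral>z. z \<partial>\<mu>) = 0"
    and A1: "assumption1 \<phi> g \<mu> H \<gamma> \<beta> \<epsilon> C\<mu>"
begin

declare One_nat_def [simp del] \<comment> \<open>keeps \<open>dk 1\<close> from being rewritten to \<open>dk (Suc 0)\<close>\<close>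

sublocale mu: prob_space \<mu> by (rule mu_prob)

abbreviation b :: "real \<Rightarrow> real" where "b \<equiv> bfun g"
abbreviation b1 :: "real \<Rightarrow> real" where "b1 \<equiv> dk 1 b"
abbreviation b2 :: "real \<Rightarrow> real" where "b2 \<equiv> dk 2 b"
abbreviation \<phi>1 :: "real \<Rightarrow> real" where "\<phi>1 \<equiv> dk 1 \<phi>"
abbreviation \<phi>2 :: "real \<Rightarrow> real" where "\<phi>2 \<equiv> dk 2 \<phi>"
abbreviation \<phi>3 :: "real \<Rightarrow> real" where "\<phi>3 \<equiv> dk 3 \<phi>"

definition \<xi> :: real where "\<xi> = max (6 + 3 * \<epsilon>) (max (2 + 2 * H) (2 + 2 * \<gamma>))"

lemma params: "0 < H" "0 < \<gamma>" "0 \<le> \<beta>" "0 < \<epsilon>" "6 < \<xi>" "2 + 2 * H \<le> \<xi>" "2 + 2 * \<gamma> \<le> \<xi>" "0 < C\<mu>"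
  using A1 by (auto simp: assumption1_def \<xi>_def Let_def)

lemma g_pos: "t > 0 \<Longrightarrow> g t > 0"
  using A1 by (auto simp: assumption1_def)

lemma exp_b: "exp (b t) = g (exp t)"
  by (simp add: bfun_def g_pos)

lemma C3_b: "C3 b" and C3_phi: "C3 \<phi>"
  using A1 by (auto simp: assumption1_def C3H_def)

lemmas b_DERIV = C3_DERIV(1,2)[OF C3_b]
lemmas phi_DERIV = C3_DERIV(1,2,3)[OF C3_phi]
lemmas b_chain [derivative_intros] = b_DERIV[THEN DERIV_chain2]
lemmas phi_chain [derivative_intros] = phi_DERIV[THEN DERIV_chain2]

lemma b_isCont: "isCont b x" "isCont b1 x" "isCont b2 x"
  using b_DERIV C3_DERIV(3)[OF C3_b] by (auto intro: DERIV_isCont)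

lemma phi_isCont: "isCont \<phi> x" "isCont \<phi>1 x" "isCont \<phi>2 x" "isCont \<phi>3 x"
  using phi_DERIV C3_DERIV(4)[OF C3_phi]
  by (auto intro: DERIV_isCont simp: continuous_on_eq_continuous_at)

lemma b_measurable [measurable]:
  "b \<in> borel_measurable borel" "b1 \<in> borel_measurable borel" "b2 \<in> borel_measurable borel"
  by (auto intro!: borel_measurable_continuous_onI simp: continuous_on_eq_continuous_at b_isCont)

lemma phi_measurable [measurable]:
  "\<phi> \<in> borel_measurable borel" "\<phi>1 \<in> borel_measurable borel" "\<phi>2 \<in> borel_measurable borel"
  "\<phi>3 \<in> borel_measurable borel"
  by (auto intro!: borel_measurable_continuous_onI simp: continuous_on_eq_continuous_at phi_isCont)

text \<open>The requirement \<open>1 \<le> M\<close> gives \<open>M \<le> M\<^sup>2\<close>, so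
  bounds linear and quadratic in the derivatives of \<open>b\<close> combine into one.\<close>

definition M :: real where
  "M = (SOME M. 1 \<le> M \<and> (\<forall>t. \<bar>b1 t\<bar> \<le> M) \<and> (\<forall>t. \<bar>b2 t\<bar> \<le> M))"

lemma M: "1 \<le> M" "\<bar>b1 t\<bar> \<le> M" "\<bar>b2 t\<bar> \<le> M"
proof -
  from A1 have "bounded (range b1)" "bounded (range b2)" by (auto simp: assumption1_def)
  then obtain B1 B2 where "\<And>t. \<bar>b1 t\<bar> \<le> B1" "\<And>t. \<bar>b2 t\<bar> \<le> B2"
    unfolding bounded_iff by auto
  then have "\<exists>M. 1 \<le> M \<and> (\<forall>t. \<bar>b1 t\<bar> \<le> M) \<and> (\<forall>t. \<bar>b2 t\<bar> \<le> M)"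
    by (intro exI[of _ "max 1 (max B1 B2)"]) (simp add: le_max_iff_disj)
  from someI_ex[OF this] show "1 \<le> M" "\<bar>b1 t\<bar> \<le> M" "\<bar>b2 t\<bar> \<le> M"
    unfolding M_def by blast+
qed

section \<open>The balancing function in logarithmic coordinates\<close>

lemma b_reflect: "b (- t) = b t - t"
proof -
  have "g (exp t) = exp t * g (1 / exp t)" using bal(1) unfolding balancing_def by (metis exp_gt_zero)
  then have "exp (b t) = exp t * exp (b (- t))" by (simp add: exp_b exp_minus inverse_eq_divide)
  then have "exp (b t) = exp (t + b (- t))" by (simp add: exp_add)
  then have "b t = t + b (- t)" by (rule exp_inj_iff[THEN iffD1])
  then show ?thesis by simp
qed

lemma b_0: "b 0 = 0"
  by (simp add: bfun_def bal)

lemma b1_0: "b1 0 = 1 / 2"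
proof -
  have "((\<lambda>t. b (- t)) has_real_derivative - b1 (- 0)) (at 0)"
    by (auto intro!: derivative_eq_intros)
  moreover have "((\<lambda>t. b t - t) has_real_derivative b1 0 - 1) (at 0)"
    by (auto intro!: derivative_eq_intros)
  ultimately have "- b1 0 = b1 0 - 1" by (simp add: b_reflect DERIV_unique)
  then show ?thesis by simp
qed

text \<open>With g t = exp (b (ln t)), differentiating twice at 1 gives b''(0) - b'(0) + b'(0)^2,
  and b'(0) = 1/2 accounts for the 1/4.\<close>

lemma gfrak_eq: "gfrak g = b2 0 - 1 / 4"
proof -
  have g: "g t = exp (b (ln t))" if "t > 0" for t using that by (simp add: exp_b)
  have dg: "deriv g t = b1 (ln t) / t * exp (b (ln t))" if t: "t > 0" for t
  proof (rule DERIV_imp_deriv)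
    have "((\<lambda>t. exp (b (ln t))) has_real_derivative b1 (ln t) / t * exp (b (ln t))) (at t)"
      using t by (auto intro!: derivative_eq_intros)
    \<comment> \<open>The representation through ln is valid only for positive arguments; equality
      near \<open>t\<close> suffices to transfer the derivative.\<close>
    moreover have "\<forall>\<^sub>F s in nhds t. exp (b (ln s)) = g s"
      using eventually_nhds_in_open[of "{0<..}" t] t by (auto elim!: eventually_mono simp: g)
    ultimately show "(g has_real_derivative b1 (ln t) / t * exp (b (ln t))) (at t)"
      by (subst (asm) DERIV_cong_ev[OF refl _ refl])
  qed
  have "((\<lambda>t. b1 (ln t) / t * exp (b (ln t))) has_real_derivative
      b2 0 - b1 0 + b1 0 * b1 0) (at 1)"
    by (auto intro!: derivative_eq_intros simp: b_0)
  moreover have "\<forall>\<^sub>F s in nhds 1. b1 (ln s) / s * exp (b (ln s)) = deriv g s"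
    using eventually_nhds_in_open[of "{0<..}" "1::real"] by (auto elim!: eventually_mono simp: dg)
  ultimately have "(deriv g has_real_derivative b2 0 - b1 0 + b1 0 * b1 0) (at 1)"
    by (subst (asm) DERIV_cong_ev[OF refl _ refl])
  then show ?thesis by (simp add: gfrak_def DERIV_imp_deriv b1_0)
qed

lemma b_lipschitz: "\<bar>b s - b t\<bar> \<le> M * \<bar>s - t\<bar>"
proof -
  obtain \<eta> where "b s - b t = (s - t) * b1 \<eta>" using mvt_between[OF b_DERIV(1)] by metis
  then show ?thesis using mult_right_mono[OF M(2)[of \<eta>], of "\<bar>s - t\<bar>"] by (simp add: abs_mult mult.commute)
qed

lemma b_abs: "\<bar>b t\<bar> \<le> M * \<bar>t\<bar>"
  using b_lipschitz[of t 0] by (simp add: b_0)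

text \<open>The normalizing constant depends on \<open>\<sigma>\<close> and \<open>x\<close> only
  through \<sigma> \<phi>'(x), so its regularity is a question about this function of one
  variable.\<close>

definition h :: "real \<Rightarrow> real" where "h a = (\<integral>z. exp (b (a * z)) \<partial>\<mu>)"

lemma exp_b_integrable: "integrable \<mu> (\<lambda>z. exp (b (a * z)))"
  and exp_b_powr_integrable: "integrable \<mu> (\<lambda>z. \<bar>z\<bar> powr \<xi> * exp (b (a * z)))"
  and exp_b_powr_le: "(\<integral>z. \<bar>z\<bar> powr \<xi> * exp (b (a * z)) \<partial>\<mu>) \<le> C\<mu> * (1 + apow a \<beta>) * h a"
proof -
  note * = A1[unfolded assumption1_def Let_def, folded \<xi>_def]
  from * have "integrable \<mu> (\<lambda>z. exp (b (a * z))) \<and>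
      integrable \<mu> (\<lambda>z. exp (b (a * z)) * \<bar>z\<bar> powr \<xi>) \<and>
      (\<integral>z. exp (b (a * z)) * \<bar>z\<bar> powr \<xi> \<partial>\<mu>) \<le> C\<mu> * (1 + apow a \<beta>) * (\<integral>z. exp (b (a * z)) \<partial>\<mu>)"
    by blast
  then show "integrable \<mu> (\<lambda>z. exp (b (a * z)))"
    "integrable \<mu> (\<lambda>z. \<bar>z\<bar> powr \<xi> * exp (b (a * z)))"
    "(\<integral>z. \<bar>z\<bar> powr \<xi> * exp (b (a * z)) \<partial>\<mu>) \<le> C\<mu> * (1 + apow a \<beta>) * h a"
    by (simp_all add: h_def mult.commute[of "exp _" "_ powr _"])
qed

lemma powr_integrable: "integrable \<mu> (\<lambda>z. \<bar>z\<bar> powr \<xi>)"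
  and sq_integrable: "integrable \<mu> (\<lambda>z. z\<^sup>2)" and sq_integral: "(\<integral>z. z\<^sup>2 \<partial>\<mu>) = 1"
  using A1 by (auto simp: assumption1_def Let_def \<xi>_def)

lemma Zs_eq: "Zs g \<mu> \<phi> \<sigma> x = h (\<sigma> * \<phi>1 x)"
  by (simp add: Zs_def h_def exp_b dk_def One_nat_def mult_ac)

lemma h_0: "h 0 = 1"
  by (simp add: h_def b_0 mu.prob_space)

text \<open>Jensen's inequality by hand, with the explicit bound h a \<ge> exp (- M |a|). From |z|
  \<le> (1 + z^2) / 2 the exponent is at least - M |a| - M |a| (z^2 - 1) / 2; after linearizing exp
  at - M |a|, the term in z^2 - 1 integrates to 0 because the second moment is 1.\<close>

lemma h_pos: "h a > 0"
proof -
  have "exp (- M * \<bar>a\<bar>) * (1 - M * \<bar>a\<bar> * (z\<^sup>2 - 1) / 2) \<le> exp (b (a * z))" for z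
  proof -
    have "exp (- M * \<bar>a\<bar>) * (1 - M * \<bar>a\<bar> * (z\<^sup>2 - 1) / 2)
        \<le> exp (- M * \<bar>a\<bar>) * exp (- (M * \<bar>a\<bar> * (z\<^sup>2 - 1) / 2))"
      using exp_ge_add_one_self[of "- (M * \<bar>a\<bar> * (z\<^sup>2 - 1) / 2)"] by (intro mult_left_mono) auto
    also have "\<dots> = exp (- (M * \<bar>a\<bar> * ((1 + z\<^sup>2) / 2)))"
      by (simp add: exp_add[symmetric] field_simps)
    also have "\<dots> \<le> exp (- (M * \<bar>a\<bar> * \<bar>z\<bar>))"
    proof -
      have "0 \<le> (\<bar>z\<bar> - 1)\<^sup>2" by simp
      then have "\<bar>z\<bar> \<le> (1 + z\<^sup>2) / 2" by (simp add: power2_eq_square algebra_simps)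
      then show ?thesis using M(1) by (auto intro: mult_left_mono)
    qed
    also have "\<dots> \<le> exp (b (a * z))"
      using b_abs[of "a * z"] by (auto simp: abs_mult mult.assoc)
    finally show ?thesis .
  qed
  then have "(\<integral>z. exp (- M * \<bar>a\<bar>) * (1 - M * \<bar>a\<bar> * (z\<^sup>2 - 1) / 2) \<partial>\<mu>) \<le> h a"
    unfolding h_def using sq_integrable exp_b_integrable by (intro integral_mono) auto
  also have "(\<integral>z. exp (- M * \<bar>a\<bar>) * (1 - M * \<bar>a\<bar> * (z\<^sup>2 - 1) / 2) \<partial>\<mu>) = exp (- M * \<bar>a\<bar>)"
    using sq_integrable by (simp add: sq_integral mu.prob_space)
  finally show ?thesis by (rule less_le_trans[rotated]) simp
qed

lemma exp_b_bound: "\<bar>a\<bar> \<le> A \<Longrightarrow> \<bar>z\<bar> \<le> R \<Longrightarrow> exp (b (a * z)) \<le> exp (M * A * R)"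
proof -
  assume "\<bar>a\<bar> \<le> A" "\<bar>z\<bar> \<le> R"
  then have "\<bar>a * z\<bar> \<le> A * R" unfolding abs_mult by (intro mult_mono) auto
  then have "M * \<bar>a * z\<bar> \<le> M * (A * R)" using M(1) by (intro mult_left_mono) auto
  with b_abs[of "a * z"] show ?thesis by simp
qed

text \<open>The moment condition forces half of the mass of the tilted measure into a ball whose radius is
  locally bounded in \<open>a\<close>; on that ball the tilt is bounded.\<close>

lemma h_locally_bounded:
  obtains D where "\<And>a. \<bar>a\<bar> \<le> A \<Longrightarrow> h a \<le> D"
    "\<And>a. \<bar>a\<bar> \<le> A \<Longrightarrow> (\<integral>z. \<bar>z\<bar> powr \<xi> * exp (b (a * z)) \<partial>\<mu>) \<le> D"
proof -
  define K where "K = C\<mu> * (1 + apow A \<beta>)"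
  \<comment> \<open>Outside the ball of radius \<open>R\<close> the weight |z|^\<xi> is at least R
    \<ge> 2 K, so the outer mass is at most K h(a) / R \<le> h(a) / 2 and can be absorbed on the
    left.\<close>
  define R where "R = max 1 (2 * K)"
  have K: "K > 0" using params apow_nonneg[of A \<beta>] by (auto simp: K_def intro!: mult_pos_pos)
  have R: "1 \<le> R" "2 * K \<le> R" by (auto simp: R_def)
  have mom: "(\<integral>z. \<bar>z\<bar> powr \<xi> * exp (b (a * z)) \<partial>\<mu>) \<le> K * h a" if "\<bar>a\<bar> \<le> A" for a
  proof -
    have "C\<mu> * (1 + apow a \<beta>) \<le> K"
      unfolding K_def using that params by (intro mult_left_mono add_left_mono apow_mono) auto
    from mult_right_mono[OF this, of "h a"] show ?thesis
      using exp_b_powr_le[of a] h_pos[of a] by linarith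
  qed
  have le: "h a \<le> 2 * exp (M * A * R)" if a: "\<bar>a\<bar> \<le> A" for a
  proof -
    have "exp (b (a * z)) \<le> exp (M * A * R) + \<bar>z\<bar> powr \<xi> * exp (b (a * z)) / R" for z
    proof (cases "\<bar>z\<bar> \<le> R")
      case True
      then have "exp (b (a * z)) \<le> exp (M * A * R)" by (rule exp_b_bound[OF a])
      then show ?thesis using R by (simp add: add_increasing2)
    next
      case False
      then have "R \<le> \<bar>z\<bar> powr 1" using R by simp
      also have "\<dots> \<le> \<bar>z\<bar> powr \<xi>" using False R params by (intro powr_mono) auto
      finally have "R * exp (b (a * z)) \<le> \<bar>z\<bar> powr \<xi> * exp (b (a * z))"
        by (intro mult_right_mono) auto
      then have "exp (b (a * z)) \<le> \<bar>z\<bar> powr \<xi> * exp (b (a * z)) / R"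
        using R by (simp add: field_simps)
      then show ?thesis by (simp add: add_increasing)
    qed
    then have "h a \<le> (\<integral>z. exp (M * A * R) + \<bar>z\<bar> powr \<xi> * exp (b (a * z)) / R \<partial>\<mu>)"
      unfolding h_def using exp_b_integrable exp_b_powr_integrable
      by (intro integral_mono) auto
    also have "\<dots> = exp (M * A * R) + (\<integral>z. \<bar>z\<bar> powr \<xi> * exp (b (a * z)) \<partial>\<mu>) / R"
      using exp_b_powr_integrable by (simp add: mu.prob_space)
    also have "(\<integral>z. \<bar>z\<bar> powr \<xi> * exp (b (a * z)) \<partial>\<mu>) / R \<le> K * h a / R"
      using mom[OF a] R by (intro divide_right_mono) auto
    also have "K * h a / R \<le> h a / 2"
      using R h_pos[of a] by (simp add: field_simps)
    finally show ?thesis by simp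
  qed
  show ?thesis
  proof (rule that[of "max 1 K * (2 * exp (M * A * R))"])
    fix a assume a: "\<bar>a\<bar> \<le> A"
    have "1 * h a \<le> max 1 K * (2 * exp (M * A * R))"
      using le[OF a] h_pos[of a] by (intro mult_mono) auto
    then show "h a \<le> max 1 K * (2 * exp (M * A * R))" by simp
    have "K * h a \<le> max 1 K * (2 * exp (M * A * R))"
      using le[OF a] h_pos[of a] by (intro mult_mono) auto
    with mom[OF a] show "(\<integral>z. \<bar>z\<bar> powr \<xi> * exp (b (a * z)) \<partial>\<mu>) \<le> max 1 K * (2 * exp (M * A * R))"
      by linarith
  qed
qed

text \<open>Differentiation under the integral without a dominating function: difference quotients
  along a sequence are handled by \<open>integral_tendsto_of_moment_bound\<close>. Each derivative
  brings down one more factor z, so \<open>j \<le> 5\<close> keeps the order at six. The choices q =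
  1 and q = b' yield the first two derivatives of \<open>h\<close>.\<close>

lemma DERIV_tilted_moment:
  fixes q q' :: "real \<Rightarrow> real" and j :: nat
  assumes q: "\<And>t. (q has_real_derivative q' t) (at t)" "\<And>t. \<bar>q t\<bar> \<le> Q" "\<And>t. \<bar>q' t\<bar> \<le> Q"
    and j: "j \<le> 5"
  shows "((\<lambda>a. \<integral>z. z ^ j * (q (a * z) * exp (b (a * z))) \<partial>\<mu>) has_real_derivative
      (\<integral>z. z ^ Suc j * ((q' (a * z) + q (a * z) * b1 (a * z)) * exp (b (a * z))) \<partial>\<mu>)) (at a)"
proof -
  note [derivative_intros] = q(1)[THEN DERIV_chain2]
  have "continuous_on UNIV q" using q(1) by (meson DERIV_isCont continuous_on_eq_continuous_at open_UNIV)
  then have [measurable]: "q \<in> borel_measurable borel" by (rule borel_measurable_continuous_onI)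
  define P where "P a z = z ^ j * (q (a * z) * exp (b (a * z)))" for a z
  have Q0: "0 \<le> Q" using q(2)[of 0] by linarith
  \<comment> \<open>The constant Q bounds the increment of \<open>q\<close>; Q M comes from the
    bound on \<open>q\<close> and the Lipschitz constant of \<open>b\<close> in the
    exponent.\<close>
  have qe: "\<bar>q s * exp (b s) - q t * exp (b t)\<bar> \<le> Q * (1 + M) * (\<bar>s - t\<bar> * (exp (b s) + exp (b t)))" for s t
  proof -
    obtain \<eta> where "q s - q t = (s - t) * q' \<eta>" using mvt_between[OF q(1)] by metis
    then have 1: "\<bar>q s - q t\<bar> \<le> Q * \<bar>s - t\<bar>"
      using mult_right_mono[OF q(3)[of \<eta>], of "\<bar>s - t\<bar>"] by (simp add: abs_mult mult.commute)
    have "\<bar>exp (b s) - exp (b t)\<bar> \<le> \<bar>b s - b t\<bar> * (exp (b s) + exp (b t))" by (rule exp_diff_le)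
    also have "\<dots> \<le> (M * \<bar>s - t\<bar>) * (exp (b s) + exp (b t))"
      by (intro mult_right_mono b_lipschitz add_nonneg_nonneg) auto
    finally have 2: "\<bar>q t\<bar> * \<bar>exp (b s) - exp (b t)\<bar> \<le> Q * ((M * \<bar>s - t\<bar>) * (exp (b s) + exp (b t)))"
      using Q0 q(2) by (intro mult_mono) auto
    have "q s * exp (b s) - q t * exp (b t) = (q s - q t) * exp (b s) + q t * (exp (b s) - exp (b t))"
      by (simp add: algebra_simps)
    then have "\<bar>q s * exp (b s) - q t * exp (b t)\<bar> \<le> \<bar>q s - q t\<bar> * exp (b s) + \<bar>q t\<bar> * \<bar>exp (b s) - exp (b t)\<bar>"
      using abs_triangle_ineq[of "(q s - q t) * exp (b s)" "q t * (exp (b s) - exp (b t))"]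
      by (simp add: abs_mult)
    also have "\<bar>q s - q t\<bar> * exp (b s) \<le> (Q * \<bar>s - t\<bar>) * (exp (b s) + exp (b t))"
      using 1 Q0 by (intro mult_mono) auto
    finally show ?thesis using 2 by (simp add: algebra_simps)
  qed
  have "((\<lambda>y. ((\<integral>z. P y z \<partial>\<mu>) - (\<integral>z. P a z \<partial>\<mu>)) / (y - a)) \<longlongrightarrow>
      (\<integral>z. z ^ Suc j * ((q' (a * z) + q (a * z) * b1 (a * z)) * exp (b (a * z))) \<partial>\<mu>)) (at a)"
    unfolding tendsto_at_iff_sequentially comp_def
  proof (intro allI impI)
    fix X :: "nat \<Rightarrow> real" assume X: "\<forall>i. X i \<in> UNIV - {a}" "X \<longlonglongrightarrow> a"
    from X(2) obtain A where A: "\<And>n. \<bar>X n\<bar> \<le> A"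
      using convergentI[OF X(2), THEN convergent_imp_Bseq] by (auto simp: Bseq_def)
    have aA: "\<bar>a\<bar> \<le> A" by (rule LIMSEQ_le_const2[OF tendsto_rabs[OF X(2)]]) (use A in auto)
    obtain D where D: "\<And>a. \<bar>a\<bar> \<le> A \<Longrightarrow> (\<integral>z. \<bar>z\<bar> powr \<xi> * exp (b (a * z)) \<partial>\<mu>) \<le> D"
      using h_locally_bounded[of A] by metis
    \<comment> \<open>The difference quotient compares the parameters \<open>X n\<close> and
      \<open>a\<close>, so the weight is the sum of both tilts; its \<xi>-moment is at most 2 D,
      uniformly in \<open>n\<close>.\<close>
    define k where "k n z = exp (b (X n * z)) + exp (b (a * z))" for n z
    have Pint: "integrable \<mu> (P y)" for y
    proof (rule Bochner_Integration.integrable_bound)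
      show "integrable \<mu> (\<lambda>z. Q * (exp (b (y * z)) + \<bar>z\<bar> powr \<xi> * exp (b (y * z))))"
        using exp_b_integrable exp_b_powr_integrable by auto
      have "\<bar>P y z\<bar> \<le> Q * (exp (b (y * z)) + \<bar>z\<bar> powr \<xi> * exp (b (y * z)))" for z
      proof -
        have "\<bar>z\<bar> ^ j * (\<bar>q (y * z)\<bar> * exp (b (y * z))) \<le> (1 + \<bar>z\<bar> powr \<xi>) * (Q * exp (b (y * z)))"
          using j params q(2) Q0 by (intro mult_mono power_le_one_plus_powr) auto
        then show ?thesis by (simp add: P_def abs_mult power_abs algebra_simps)
      qed
      then show "AE z in \<mu>. norm (P y z) \<le> norm (Q * (exp (b (y * z)) + \<bar>z\<bar> powr \<xi> * exp (b (y * z))))"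
        by (auto intro: order_trans[OF _ abs_ge_self])
    qed (simp add: P_def[abs_def])
    define F where "F n z = (P (X n) z - P a z) / (X n - a)" for n z
    have bd: "\<bar>F n z\<bar> \<le> 2 * Q * (1 + M) * (1 + z ^ 6) * k n z" for n z
    proof -
      have ne: "\<bar>X n - a\<bar> > 0" using X(1) by auto
      have "\<bar>P (X n) z - P a z\<bar> = \<bar>z\<bar> ^ j * \<bar>q (X n * z) * exp (b (X n * z)) - q (a * z) * exp (b (a * z))\<bar>"
        by (simp add: P_def right_diff_distrib[symmetric] abs_mult power_abs)
      also have "\<dots> \<le> \<bar>z\<bar> ^ j * (Q * (1 + M) * (\<bar>X n * z - a * z\<bar> * k n z))"
        unfolding k_def by (intro mult_left_mono qe) auto
      also have "\<bar>X n * z - a * z\<bar> = \<bar>X n - a\<bar> * \<bar>z\<bar>"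
        by (simp add: abs_mult left_diff_distrib[symmetric])
      finally have F: "\<bar>F n z\<bar> \<le> \<bar>z\<bar> ^ Suc j * (Q * (1 + M) * k n z)"
        using ne by (simp add: F_def abs_divide field_simps)
      have "\<bar>z\<bar> ^ Suc j \<le> 2 * (1 + z ^ 6)"
      proof (cases "\<bar>z\<bar> \<le> 1")
        case True
        then have "\<bar>z\<bar> ^ Suc j \<le> 1" by (rule power_le_one[rotated]) simp
        then show ?thesis by (simp add: add_increasing2)
      next
        case False
        then have "\<bar>z\<bar> ^ Suc j \<le> \<bar>z\<bar> ^ 6" using j by (intro power_increasing) auto
        also have "\<bar>z\<bar> ^ 6 \<le> 2 * (1 + z ^ 6)"
        proof -
          have "t \<le> 2 * (1 + t)" if "0 \<le> t" for t :: real using that by simp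
          from this[of "z ^ 6"] show ?thesis by (simp add: power_even_abs)
        qed
        finally show ?thesis .
      qed
      then have "\<bar>z\<bar> ^ Suc j * (Q * (1 + M) * k n z) \<le> 2 * (1 + z ^ 6) * (Q * (1 + M) * k n z)"
        using Q0 M(1) by (intro mult_right_mono) (auto simp: k_def)
      also have "\<dots> = 2 * Q * (1 + M) * (1 + z ^ 6) * k n z" by (simp only: mult_ac)
      finally show ?thesis using F by linarith
    qed
    have "(\<lambda>n. \<integral>z. F n z \<partial>\<mu>) \<longlonglongrightarrow>
        (\<integral>z. z ^ Suc j * ((q' (a * z) + q (a * z) * b1 (a * z)) * exp (b (a * z))) \<partial>\<mu>)"
    proof (rule integral_tendsto_of_moment_bound(2)[where k = k and x = \<xi> and B = "2 * D"
          and C = "2 * Q * (1 + M)" and \<eta> = "\<lambda>_. 0"])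
      fix n z
      show "F n \<in> borel_measurable borel" unfolding F_def P_def by measurable
      have "((\<lambda>y. P y z) has_real_derivative z ^ Suc j * ((q' (a * z) + q (a * z) * b1 (a * z)) * exp (b (a * z)))) (at a)"
        unfolding P_def by (auto intro!: derivative_eq_intros simp: algebra_simps)
      then have "((\<lambda>y. (P y z - P a z) / (y - a)) \<longlongrightarrow> z ^ Suc j * ((q' (a * z) + q (a * z) * b1 (a * z)) * exp (b (a * z)))) (at a)"
        by (simp add: has_field_derivative_iff)
      then show "(\<lambda>n. F n z) \<longlonglongrightarrow> z ^ Suc j * ((q' (a * z) + q (a * z) * b1 (a * z)) * exp (b (a * z)))"
        unfolding F_def tendsto_at_iff_sequentially comp_def using X by blast
      show "0 \<le> k n z" by (simp add: k_def)
      show "integrable \<mu> (k n)" unfolding k_def by (intro Bochner_Integration.integrable_add exp_b_integrable)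
      have keq: "\<bar>z\<bar> powr \<xi> * k n z = \<bar>z\<bar> powr \<xi> * exp (b (X n * z)) + \<bar>z\<bar> powr \<xi> * exp (b (a * z))" for z
        by (simp add: k_def distrib_left)
      show "integrable \<mu> (\<lambda>z. \<bar>z\<bar> powr \<xi> * k n z)"
        unfolding keq by (intro Bochner_Integration.integrable_add exp_b_powr_integrable)
      show "(\<integral>z. \<bar>z\<bar> powr \<xi> * k n z \<partial>\<mu>) \<le> 2 * D"
        unfolding keq using exp_b_powr_integrable D[OF A[of n]] D[OF aA] by simp
      show "\<bar>F n z\<bar> \<le> (2 * Q * (1 + M) * (1 + z ^ 6) + 0 * \<bar>z\<bar> powr \<xi>) * k n z"
        using bd[of n z] by simp
    next
      fix R
      show "\<exists>D. \<forall>n z. \<bar>z\<bar> \<le> R \<longrightarrow> \<bar>F n z\<bar> \<le> D"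
      proof (intro exI allI impI)
        fix n z assume z: "\<bar>z\<bar> \<le> R"
        have "z ^ 6 \<le> R ^ 6" using power_mono[OF z, of 6] by (simp add: power_even_abs)
        moreover have "k n z \<le> 2 * exp (M * A * R)"
          using exp_b_bound[OF A[of n] z] exp_b_bound[OF aA z] unfolding k_def by linarith
        ultimately have "2 * Q * (1 + M) * (1 + z ^ 6) * k n z \<le> 2 * Q * (1 + M) * (1 + R ^ 6) * (2 * exp (M * A * R))"
          using Q0 M(1) by (intro mult_mono mult_nonneg_nonneg add_nonneg_nonneg) (auto simp: k_def)
        with bd[of n z] show "\<bar>F n z\<bar> \<le> 2 * Q * (1 + M) * (1 + R ^ 6) * (2 * exp (M * A * R))"
          by linarith
      qed
    qed (use params Q0 M(1) mu_sets mu.finite_measure_axioms in auto)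
    then show "(\<lambda>n. ((\<integral>z. P (X n) z \<partial>\<mu>) - (\<integral>z. P a z \<partial>\<mu>)) / (X n - a)) \<longlonglongrightarrow>
        (\<integral>z. z ^ Suc j * ((q' (a * z) + q (a * z) * b1 (a * z)) * exp (b (a * z))) \<partial>\<mu>)"
      using Pint by (simp add: F_def)
  qed
  then show ?thesis unfolding P_def has_field_derivative_iff .
qed

definition h1 :: "real \<Rightarrow> real" where
  "h1 a = (\<integral>z. z * (b1 (a * z) * exp (b (a * z))) \<partial>\<mu>)"
definition h2 :: "real \<Rightarrow> real" where
  "h2 a = (\<integral>z. z\<^sup>2 * ((b2 (a * z) + (b1 (a * z))\<^sup>2) * exp (b (a * z))) \<partial>\<mu>)"

lemma h_DERIV: "(h has_real_derivative h1 a) (at a)"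
  using DERIV_tilted_moment[of "\<lambda>_. 1" "\<lambda>_. 0" 1 0 a]
  by (simp add: h_def[abs_def] h1_def)

lemma h1_DERIV: "(h1 has_real_derivative h2 a) (at a)"
  using DERIV_tilted_moment[of b1 b2 M 1 a] b_DERIV(2) M
  by (simp add: h1_def[abs_def] h2_def power2_eq_square numeral_2_eq_2)

definition L1 :: "real \<Rightarrow> real" where "L1 a = h1 a / h a"
definition L2 :: "real \<Rightarrow> real" where "L2 a = h2 a / h a - (h1 a / h a)\<^sup>2"

lemma ln_h_DERIV: "((\<lambda>a. ln (h a)) has_real_derivative L1 a) (at a)"
  using h_pos[of a] by (auto intro!: derivative_eq_intros h_DERIV simp: L1_def)

lemma L1_DERIV: "(L1 has_real_derivative L2 a) (at a)"
proof -
  have "((\<lambda>a. h1 a / h a) has_real_derivative L2 a) (at a)"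
    using h_pos[of a]
    by (auto intro!: derivative_eq_intros h_DERIV h1_DERIV simp: L2_def field_simps power2_eq_square)
  then show ?thesis by (simp add: L1_def[abs_def])
qed

lemma L1_0: "L1 0 = 0"
  using mu_centred by (simp add: L1_def h1_def)

text \<open>Centring gives h'(0) = 0, and the unit second moment gives h''(0) = b''(0) + 1/4 =
  g''(1) + 1/2. This is the source of the constant 1/2 + g''(1) in \<open>theta2\<close>.\<close>

lemma L2_0: "L2 0 = gfrak g + 1 / 2"
proof -
  have "h1 0 = 0" using mu_centred by (simp add: h1_def)
  moreover have "h2 0 = b2 0 + (b1 0)\<^sup>2"
    by (simp add: h2_def b_0 sq_integral)
  ultimately show ?thesis
    by (simp add: L2_def h_0 gfrak_eq b1_0 power2_eq_square)
qed

text \<open>A quadratic is dominated by 1 + |z|^\<xi>, to which the moment hypothesis applies. The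
  factor \<open>h a\<close> on the right cancels upon normalization, leaving growth of order
  |a|^\<beta>.\<close>

lemma tilted_moment_le:
  assumes "\<And>z. \<bar>f z\<bar> \<le> c * z\<^sup>2" and [measurable]: "f \<in> borel_measurable borel"
  shows "integrable \<mu> (\<lambda>z. f z * exp (b (a * z)))"
    "\<bar>\<integral>z. f z * exp (b (a * z)) \<partial>\<mu>\<bar> \<le> c * (1 + C\<mu>) * (1 + apow a \<beta>) * h a"
proof -
  have c: "0 \<le> c" using assms(1)[of 1] by (simp add: order_trans[OF abs_ge_zero])
  let ?w = "\<lambda>z. c * (exp (b (a * z)) + \<bar>z\<bar> powr \<xi> * exp (b (a * z)))"
  have w: "integrable \<mu> ?w" using exp_b_integrable exp_b_powr_integrable by auto
  have le: "\<bar>f z * exp (b (a * z))\<bar> \<le> ?w z" for z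
  proof -
    have "\<bar>f z\<bar> \<le> c * (1 + \<bar>z\<bar> powr \<xi>)"
      using assms(1)[of z] power_le_one_plus_powr[of 2 \<xi> z] params c
      by (auto intro: order_trans[OF _ mult_left_mono])
    from mult_right_mono[OF this, of "exp (b (a * z))"] show ?thesis
      by (simp add: abs_mult algebra_simps)
  qed
  show i: "integrable \<mu> (\<lambda>z. f z * exp (b (a * z)))"
    by (rule Bochner_Integration.integrable_bound[OF w])
       (use order_trans[OF le abs_ge_self] in auto)
  have "\<bar>\<integral>z. f z * exp (b (a * z)) \<partial>\<mu>\<bar> \<le> (\<integral>z. ?w z \<partial>\<mu>)"
    by (rule order_trans[OF integral_abs_bound integral_mono[OF integrable_abs[OF i] w le]])
  also have "\<dots> = c * (h a + (\<integral>z. \<bar>z\<bar> powr \<xi> * exp (b (a * z)) \<partial>\<mu>))"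
    using exp_b_integrable exp_b_powr_integrable by (simp add: h_def)
  also have "\<dots> \<le> c * (h a + C\<mu> * (1 + apow a \<beta>) * h a)"
    using c by (intro mult_left_mono add_left_mono exp_b_powr_le)
  also have "\<dots> \<le> c * ((1 + apow a \<beta>) * h a + C\<mu> * (1 + apow a \<beta>) * h a)"
    using c h_pos[of a] apow_nonneg[of a \<beta>] by (intro mult_left_mono add_right_mono) (simp_all add: algebra_simps)
  finally show "\<bar>\<integral>z. f z * exp (b (a * z)) \<partial>\<mu>\<bar> \<le> c * (1 + C\<mu>) * (1 + apow a \<beta>) * h a"
    by (simp add: algebra_simps)
qed

lemma L2_bound: "\<bar>L2 a\<bar> \<le> 4 * M\<^sup>2 * (1 + C\<mu>) * (1 + apow a \<beta>)"
proof -
  have M2: "M \<le> M\<^sup>2" "1 \<le> M\<^sup>2" using M(1) mult_mono[of 1 M 1 M] mult_right_mono[of 1 M M]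
    by (auto simp: power2_eq_square)
  have bM: "(b1 t)\<^sup>2 \<le> M\<^sup>2" for t using M(2)[of t] power_mono[of "\<bar>b1 t\<bar>" M 2] by simp
  define V where "V a = (\<integral>z. (z\<^sup>2 * (b1 (a * z))\<^sup>2) * exp (b (a * z)) \<partial>\<mu>)" for a
  have f1: "\<bar>z\<^sup>2 * (b2 (a * z) + (b1 (a * z))\<^sup>2)\<bar> \<le> (2 * M\<^sup>2) * z\<^sup>2" for z
  proof -
    have "\<bar>b2 (a * z) + (b1 (a * z))\<^sup>2\<bar> \<le> 2 * M\<^sup>2"
      using bM[of "a * z"] M(3)[of "a * z"] M2 by (auto intro: order_trans[OF abs_triangle_ineq])
    then show ?thesis by (simp add: abs_mult mult_left_mono mult.commute)
  qed
  have f2: "\<bar>z\<^sup>2 * (b1 (a * z))\<^sup>2\<bar> \<le> M\<^sup>2 * z\<^sup>2" for z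
    using mult_left_mono[OF bM[of "a * z"], of "z\<^sup>2"] by (simp add: mult.commute)
  have "\<bar>h2 a\<bar> \<le> 2 * M\<^sup>2 * (1 + C\<mu>) * (1 + apow a \<beta>) * h a"
    using tilted_moment_le(2)[OF f1, of a] by (simp add: h2_def mult_ac)
  then have A: "\<bar>h2 a / h a\<bar> \<le> 2 * M\<^sup>2 * (1 + C\<mu>) * (1 + apow a \<beta>)"
    using h_pos[of a] by (simp add: abs_divide divide_le_eq)
  have iV: "integrable \<mu> (\<lambda>z. (z\<^sup>2 * (b1 (a * z))\<^sup>2) * exp (b (a * z)))"
    and V: "\<bar>V a\<bar> \<le> M\<^sup>2 * (1 + C\<mu>) * (1 + apow a \<beta>) * h a"
    using tilted_moment_le[OF f2, of a] by (simp_all add: V_def)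
  define m where "m = h1 a / h a"
  have i1: "integrable \<mu> (\<lambda>z. z * (b1 (a * z) * exp (b (a * z))))"
  proof (rule Bochner_Integration.integrable_bound)
    show "integrable \<mu> (\<lambda>z. exp (b (a * z)) + (z\<^sup>2 * (b1 (a * z))\<^sup>2) * exp (b (a * z)))"
      using iV exp_b_integrable by simp
    have "\<bar>t\<bar> * e \<le> e + t\<^sup>2 * e" if "e \<ge> 0" for t e :: real
    proof -
      have "0 \<le> (\<bar>t\<bar> - 1 / 2)\<^sup>2" by simp
      then have "\<bar>t\<bar> \<le> 1 + t\<^sup>2" by (simp add: power2_eq_square algebra_simps)
      from mult_right_mono[OF this that] show ?thesis by (simp add: algebra_simps)
    qed
    from this[of "exp (b (a * z))" "z * b1 (a * z)" for z]
    show "AE z in \<mu>. norm (z * (b1 (a * z) * exp (b (a * z))))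
        \<le> norm (exp (b (a * z)) + (z\<^sup>2 * (b1 (a * z))\<^sup>2) * exp (b (a * z)))"
      by (auto intro!: AE_I2 order_trans[OF _ abs_ge_self] simp: abs_mult power_mult_distrib mult_ac)
  qed simp
  \<comment> \<open>Cauchy-Schwarz, in the form of a nonnegative tilted variance, bounds m^2 by V(a)
    / h(a). Bounding m itself by order 1 + |a|^\<beta> and then squaring would double the exponent
    \<beta>.\<close>
  have "0 \<le> (\<integral>z. (z * b1 (a * z) - m)\<^sup>2 * exp (b (a * z)) \<partial>\<mu>)"
    by (intro Bochner_Integration.integral_nonneg) simp
  also have "\<dots> = (\<integral>z. (z\<^sup>2 * (b1 (a * z))\<^sup>2) * exp (b (a * z)) - 2 * m * (z * (b1 (a * z) * exp (b (a * z))))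
      + m\<^sup>2 * exp (b (a * z)) \<partial>\<mu>)"
    by (intro Bochner_Integration.integral_cong) (auto simp: power2_eq_square algebra_simps)
  also have "\<dots> = V a - 2 * m * h1 a + m\<^sup>2 * h a"
    using iV i1 exp_b_integrable by (simp add: V_def h1_def h_def)
  also have "\<dots> = V a - m\<^sup>2 * h a"
    using h_pos[of a] by (simp add: m_def power2_eq_square field_simps)
  finally have "m\<^sup>2 * h a \<le> \<bar>V a\<bar>" by linarith
  with V have "m\<^sup>2 * h a \<le> M\<^sup>2 * (1 + C\<mu>) * (1 + apow a \<beta>) * h a" by linarith
  then have "m\<^sup>2 \<le> M\<^sup>2 * (1 + C\<mu>) * (1 + apow a \<beta>)"
    using h_pos[of a] by (simp add: mult_le_cancel_right)
  moreover have "\<bar>L2 a\<bar> \<le> \<bar>h2 a / h a\<bar> + m\<^sup>2"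
    unfolding L2_def m_def[symmetric] using abs_triangle_ineq4[of "h2 a / h a" "m\<^sup>2"] by simp
  moreover have "0 \<le> M\<^sup>2 * (1 + C\<mu>) * (1 + apow a \<beta>)"
    using params apow_nonneg[of a \<beta>] by (intro mult_nonneg_nonneg) auto
  ultimately show ?thesis using A by linarith
qed

lemma h_isCont: "isCont h a"
  using h_DERIV by (rule DERIV_isCont)

lemma h_measurable [measurable]: "h \<in> borel_measurable borel"
  by (intro borel_measurable_continuous_onI) (simp add: continuous_on_eq_continuous_at h_isCont)

subsection \<open>Expansion of the log-ratio\<close>

lemma deriv_phi: "deriv \<phi> = \<phi>1"
  by (simp add: dk_def One_nat_def)

text \<open>\<open>rb\<close> and \<open>rL\<close> divide out the zero at 0 of b' - 1/2 and of the
  derivative of ln h. Each of these zeros supplies one further power, of the step d or of \<sigma>,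
  in the expansion of the log-ratio.\<close>

definition rb :: "real \<Rightarrow> real" where "rb = slope (\<lambda>t. b1 t - 1 / 2) (b2 0)"
definition rL :: "real \<Rightarrow> real" where "rL = slope L1 (L2 0)"
definition CL :: real where "CL = 4 * M\<^sup>2 * (1 + C\<mu>)"

lemma b1_shift_DERIV: "((\<lambda>t. b1 t - 1 / 2) has_real_derivative b2 t) (at t)"
  by (auto intro!: derivative_eq_intros)

lemma rb: "b1 t - 1 / 2 = t * rb t" "isCont rb 0" "rb 0 = b2 0" "\<bar>rb t\<bar> \<le> M"
proof -
  show "b1 t - 1 / 2 = t * rb t" "isCont rb 0" "rb 0 = b2 0"
    unfolding rb_def using slope_eq[of "\<lambda>t. b1 t - 1 / 2"] isCont_slope[OF b1_shift_DERIV]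
    by (auto simp: b1_0 slope_def)
  obtain s where "rb t = b2 s"
    using slope_mvt[OF b1_shift_DERIV, of t] unfolding rb_def by (auto simp: b1_0)
  then show "\<bar>rb t\<bar> \<le> M" using M(3) by simp
qed

lemma CL_ge_1: "1 \<le> CL"
proof -
  have "1 * 1 \<le> (4 * M\<^sup>2) * (1 + C\<mu>)"
  proof (intro mult_mono)
    show "1 \<le> 4 * M\<^sup>2" using one_le_power[OF M(1), of 2] by linarith
  qed (use params in auto)
  then show ?thesis by (simp add: CL_def)
qed

lemma rL: "L1 t = t * rL t" "isCont rL 0" "rL 0 = L2 0" "\<bar>rL t\<bar> \<le> CL * (1 + apow t \<beta>)"
proof -
  show "L1 t = t * rL t" "isCont rL 0" "rL 0 = L2 0"
    unfolding rL_def using slope_eq[of L1] isCont_slope[OF L1_DERIV]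
    by (auto simp: L1_0 slope_def)
  obtain s where s: "\<bar>s\<bar> \<le> \<bar>t\<bar>" "rL t = L2 s"
    using slope_mvt[OF L1_DERIV L1_0, of t] unfolding rL_def by auto
  have "\<bar>L2 s\<bar> \<le> CL * (1 + apow s \<beta>)" using L2_bound by (simp add: CL_def)
  also have "\<dots> \<le> CL * (1 + apow t \<beta>)"
    using CL_ge_1 params by (intro mult_left_mono add_left_mono apow_mono s(1)) auto
  finally show "\<bar>rL t\<bar> \<le> CL * (1 + apow t \<beta>)" using s(2) by simp
qed

text \<open>The derivative of ln h vanishes at 0, so the increment carries d \<sigma>^2 instead of d
  \<sigma>; the factor \<phi>'' \<phi>' arises from the chain rule and from that zero.\<close>

lemma ln_Zs_diff:
  "\<exists>\<eta>. \<bar>\<eta> - x\<bar> \<le> \<bar>d\<bar> \<and> ln (h (\<sigma> * \<phi>1 x)) - ln (h (\<sigma> * \<phi>1 (x + d)))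
    = - d * \<sigma>\<^sup>2 * (\<phi>2 \<eta> * \<phi>1 \<eta>) * rL (\<sigma> * \<phi>1 \<eta>)"
proof -
  have "((\<lambda>s. ln (h (\<sigma> * \<phi>1 s))) has_real_derivative L1 (\<sigma> * \<phi>1 s) * (\<sigma> * \<phi>2 s)) (at s)" for s
    by (auto intro!: derivative_eq_intros DERIV_chain2[OF ln_h_DERIV])
  then obtain \<eta> where "\<bar>\<eta> - x\<bar> \<le> \<bar>d\<bar>" "ln (h (\<sigma> * \<phi>1 (x + d))) - ln (h (\<sigma> * \<phi>1 x)) = d * (L1 (\<sigma> * \<phi>1 \<eta>) * (\<sigma> * \<phi>2 \<eta>))"
    using mvt_between[of "\<lambda>s. ln (h (\<sigma> * \<phi>1 s))" "\<lambda>s. L1 (\<sigma> * \<phi>1 s) * (\<sigma> * \<phi>2 s)" x "x + d"] by auto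
  then show ?thesis by (intro exI[of _ \<eta>]) (simp add: rL(1) power2_eq_square algebra_simps)
qed

text \<open>\<open>b_reflect\<close> turns the first value into b at d \<phi>'(x + d) minus a linear
  term. What remains is an increment of the even function b(t) - t/2 along t = d \<phi>'(s), whose
  derivative vanishes at t = 0, together with the linear terms split off.\<close>

lemma b_diff:
  "\<exists>\<eta>. \<bar>\<eta> - x\<bar> \<le> \<bar>d\<bar> \<and> b (\<phi>1 (x + d) * (- d)) - b (\<phi>1 x * d)
    = d ^ 3 * (\<phi>2 \<eta> * \<phi>1 \<eta>) * rb (d * \<phi>1 \<eta>) - d * (\<phi>1 x + \<phi>1 (x + d)) / 2"
proof -
  have "((\<lambda>s. b (d * \<phi>1 s) - d * \<phi>1 s / 2) has_real_derivative (b1 (d * \<phi>1 s) - 1 / 2) * (d * \<phi>2 s)) (at s)" for s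
    by (auto intro!: derivative_eq_intros simp: algebra_simps)
  then obtain \<eta> where "\<bar>\<eta> - x\<bar> \<le> \<bar>d\<bar>" "(b (d * \<phi>1 (x + d)) - d * \<phi>1 (x + d) / 2) - (b (d * \<phi>1 x) - d * \<phi>1 x / 2)
      = d * ((b1 (d * \<phi>1 \<eta>) - 1 / 2) * (d * \<phi>2 \<eta>))"
    using mvt_between[of "\<lambda>s. b (d * \<phi>1 s) - d * \<phi>1 s / 2" "\<lambda>s. (b1 (d * \<phi>1 s) - 1 / 2) * (d * \<phi>2 s)" x "x + d"] by auto
  then show ?thesis
    using b_reflect[of "d * \<phi>1 (x + d)"]
    by (intro exI[of _ \<eta>]) (simp add: rb(1) power3_eq_cube algebra_simps add_divide_distrib diff_divide_distrib)
qed

lemma rho_eq: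
  "rho g \<mu> \<phi> \<sigma> x (x + d) = \<phi> (x + d) - \<phi> x + (b (\<phi>1 (x + d) * (- d)) - b (\<phi>1 x * d))
    + (ln (h (\<sigma> * \<phi>1 x)) - ln (h (\<sigma> * \<phi>1 (x + d))))"
  by (simp add: rho_def Zs_eq deriv_phi)

text \<open>The linear terms left by the trapezoidal rule and by \<open>b_diff\<close> are equal
  with opposite signs and cancel, so only third-order terms remain. The identity is exact, and each
  term keeps its own intermediate point.\<close>

lemma rho_expansion:
  "\<exists>\<eta>1 \<eta>2 \<eta>3. \<bar>\<eta>1 - x\<bar> \<le> \<bar>d\<bar> \<and> \<bar>\<eta>2 - x\<bar> \<le> \<bar>d\<bar> \<and> \<bar>\<eta>3 - x\<bar> \<le> \<bar>d\<bar> \<and>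
    rho g \<mu> \<phi> \<sigma> x (x + d) = - (d ^ 3 / 12) * \<phi>3 \<eta>1 + d ^ 3 * (\<phi>2 \<eta>2 * \<phi>1 \<eta>2) * rb (d * \<phi>1 \<eta>2)
      - d * \<sigma>\<^sup>2 * (\<phi>2 \<eta>3 * \<phi>1 \<eta>3) * rL (\<sigma> * \<phi>1 \<eta>3)"
proof -
  obtain \<eta>1 where "\<bar>\<eta>1 - x\<bar> \<le> \<bar>d\<bar>"
    "\<phi> (x + d) - \<phi> x - d * (\<phi>1 x + \<phi>1 (x + d)) / 2 = - (d ^ 3 / 12) * \<phi>3 \<eta>1"
    using trapezoid_error[OF phi_DERIV] by blast
  moreover obtain \<eta>2 where "\<bar>\<eta>2 - x\<bar> \<le> \<bar>d\<bar>" "b (\<phi>1 (x + d) * (- d)) - b (\<phi>1 x * d)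
    = d ^ 3 * (\<phi>2 \<eta>2 * \<phi>1 \<eta>2) * rb (d * \<phi>1 \<eta>2) - d * (\<phi>1 x + \<phi>1 (x + d)) / 2"
    using b_diff by blast
  moreover obtain \<eta>3 where "\<bar>\<eta>3 - x\<bar> \<le> \<bar>d\<bar>" "ln (h (\<sigma> * \<phi>1 x)) - ln (h (\<sigma> * \<phi>1 (x + d)))
    = - d * \<sigma>\<^sup>2 * (\<phi>2 \<eta>3 * \<phi>1 \<eta>3) * rL (\<sigma> * \<phi>1 \<eta>3)"
    using ln_Zs_diff by blast
  ultimately show ?thesis
    unfolding rho_eq by (intro exI[of _ \<eta>1] exI[of _ \<eta>2] exI[of _ \<eta>3] conjI) linarith+
qed

definition T :: "real \<Rightarrow> real \<Rightarrow> real" where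
  "T x w = - (w ^ 3 / 12) * \<phi>3 x + w ^ 3 * (\<phi>2 x * \<phi>1 x) * b2 0 - w * (\<phi>2 x * \<phi>1 x) * L2 0"

lemma rho_scaled_tendsto:
  assumes pos: "\<And>n. 0 < \<sigma> n" and lim: "\<sigma> \<longlonglongrightarrow> 0"
  shows "(\<lambda>n. rho g \<mu> \<phi> (\<sigma> n) x (x + \<sigma> n * w) / \<sigma> n ^ 3) \<longlonglongrightarrow> T x w"
proof -
  have "\<exists>\<eta>1 \<eta>2 \<eta>3. \<forall>n. \<bar>\<eta>1 n - x\<bar> \<le> \<bar>\<sigma> n * w\<bar> \<and> \<bar>\<eta>2 n - x\<bar> \<le> \<bar>\<sigma> n * w\<bar> \<and> \<bar>\<eta>3 n - x\<bar> \<le> \<bar>\<sigma> n * w\<bar> \<and>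
    rho g \<mu> \<phi> (\<sigma> n) x (x + \<sigma> n * w) = - ((\<sigma> n * w) ^ 3 / 12) * \<phi>3 (\<eta>1 n)
      + (\<sigma> n * w) ^ 3 * (\<phi>2 (\<eta>2 n) * \<phi>1 (\<eta>2 n)) * rb ((\<sigma> n * w) * \<phi>1 (\<eta>2 n))
      - (\<sigma> n * w) * (\<sigma> n)\<^sup>2 * (\<phi>2 (\<eta>3 n) * \<phi>1 (\<eta>3 n)) * rL (\<sigma> n * \<phi>1 (\<eta>3 n))"
    using rho_expansion[of x "\<sigma> n * w" "\<sigma> n" for n] by metis
  then obtain \<eta>1 \<eta>2 \<eta>3 where close: "\<And>n. \<bar>\<eta>1 n - x\<bar> \<le> \<bar>\<sigma> n * w\<bar>" "\<And>n. \<bar>\<eta>2 n - x\<bar> \<le> \<bar>\<sigma> n * w\<bar>"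
      "\<And>n. \<bar>\<eta>3 n - x\<bar> \<le> \<bar>\<sigma> n * w\<bar>"
    and eq: "\<And>n. rho g \<mu> \<phi> (\<sigma> n) x (x + \<sigma> n * w) = - ((\<sigma> n * w) ^ 3 / 12) * \<phi>3 (\<eta>1 n)
      + (\<sigma> n * w) ^ 3 * (\<phi>2 (\<eta>2 n) * \<phi>1 (\<eta>2 n)) * rb ((\<sigma> n * w) * \<phi>1 (\<eta>2 n))
      - (\<sigma> n * w) * (\<sigma> n)\<^sup>2 * (\<phi>2 (\<eta>3 n) * \<phi>1 (\<eta>3 n)) * rL (\<sigma> n * \<phi>1 (\<eta>3 n))"
    by blast
  have d: "(\<lambda>n. \<sigma> n * w) \<longlonglongrightarrow> 0" using tendsto_mult_left_zero[OF lim] .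
  \<comment> \<open>Nothing is known of the intermediate points except their distance from
    \<open>x\<close>, and this squeezes them to \<open>x\<close>.\<close>
  have conv: "\<eta> \<longlonglongrightarrow> x" if "\<And>n. \<bar>\<eta> n - x\<bar> \<le> \<bar>\<sigma> n * w\<bar>" for \<eta>
  proof -
    have "(\<lambda>n. \<eta> n - x) \<longlonglongrightarrow> 0"
      by (rule Lim_null_comparison[OF _ tendsto_rabs_zero[OF d]]) (use that in simp)
    then show ?thesis by (simp add: LIM_zero_iff)
  qed
  note \<eta> = conv[OF close(1)] conv[OF close(2)] conv[OF close(3)]
  note c = phi_isCont[THEN isCont_tendsto_compose]
  have "(\<lambda>n. (\<sigma> n * w) * \<phi>1 (\<eta>2 n)) \<longlonglongrightarrow> 0 * \<phi>1 x" "(\<lambda>n. \<sigma> n * \<phi>1 (\<eta>3 n)) \<longlonglongrightarrow> 0 * \<phi>1 x"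
    by (intro tendsto_intros d lim c \<eta>)+
  then have r: "(\<lambda>n. rb ((\<sigma> n * w) * \<phi>1 (\<eta>2 n))) \<longlonglongrightarrow> b2 0" "(\<lambda>n. rL (\<sigma> n * \<phi>1 (\<eta>3 n))) \<longlonglongrightarrow> L2 0"
    using isCont_tendsto_compose[OF rb(2)] isCont_tendsto_compose[OF rL(2)] by (simp_all add: rb(3) rL(3))
  have "(\<lambda>n. - (w ^ 3 / 12) * \<phi>3 (\<eta>1 n)
      + w ^ 3 * (\<phi>2 (\<eta>2 n) * \<phi>1 (\<eta>2 n)) * rb ((\<sigma> n * w) * \<phi>1 (\<eta>2 n))
      - w * (\<phi>2 (\<eta>3 n) * \<phi>1 (\<eta>3 n)) * rL (\<sigma> n * \<phi>1 (\<eta>3 n))) \<longlonglongrightarrow> T x w"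
    unfolding T_def by (intro tendsto_intros c \<eta> r)
  moreover have "rho g \<mu> \<phi> (\<sigma> n) x (x + \<sigma> n * w) / \<sigma> n ^ 3 = - (w ^ 3 / 12) * \<phi>3 (\<eta>1 n)
      + w ^ 3 * (\<phi>2 (\<eta>2 n) * \<phi>1 (\<eta>2 n)) * rb ((\<sigma> n * w) * \<phi>1 (\<eta>2 n))
      - w * (\<phi>2 (\<eta>3 n) * \<phi>1 (\<eta>3 n)) * rL (\<sigma> n * \<phi>1 (\<eta>3 n))" for n
  proof -
    have "(- ((s * w) ^ 3 / 12) * A + (s * w) ^ 3 * B * C - (s * w) * s\<^sup>2 * D * E) / s ^ 3
        = - (w ^ 3 / 12) * A + w ^ 3 * B * C - w * D * E" if "s > 0" for A B C D E s :: real
      using that by (simp add: field_simps power2_eq_square power3_eq_cube)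
    from this[OF pos[of n]] show ?thesis unfolding eq .
  qed
  ultimately show ?thesis by simp
qed

section \<open>Growth envelope and uniform bound for the scaled log-ratio\<close>

definition q :: "real \<Rightarrow> real" where "q s = max (\<bar>s\<bar> powr H) (\<bar>s\<bar> powr \<gamma>)"

lemma q_mono: "\<bar>s\<bar> \<le> \<bar>t\<bar> \<Longrightarrow> q s \<le> q t"
  unfolding q_def using params by (intro max.mono powr_mono2) auto

lemma q_nonneg: "0 \<le> q s" by (simp add: q_def le_max_iff_disj)

lemma q_1: "q 1 = 1" by (simp add: q_def)

text \<open>Here the conditions \<open>2 + 2 * H \<le> \<xi>\<close> and
  \<open>2 + 2 * \<gamma> \<le> \<xi>\<close> enter: they let the moment of order \<xi> control the
  square of a first-order bound on long jumps.\<close>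

lemma sq_q_le: "1 \<le> \<bar>s\<bar> \<Longrightarrow> (s * q s)\<^sup>2 \<le> \<bar>s\<bar> powr \<xi>"
proof -
  assume s: "1 \<le> \<bar>s\<bar>"
  have "(s * \<bar>s\<bar> powr p)\<^sup>2 \<le> \<bar>s\<bar> powr \<xi>" if "2 + 2 * p \<le> \<xi>" for p
  proof -
    have "(s * \<bar>s\<bar> powr p)\<^sup>2 = (\<bar>s\<bar> powr 1 * \<bar>s\<bar> powr p)\<^sup>2" by (simp add: power_mult_distrib)
    also have "\<dots> = \<bar>s\<bar> powr (2 + 2 * p)"
      unfolding power2_eq_square powr_add[symmetric] by (simp add: algebra_simps)
    also have "\<dots> \<le> \<bar>s\<bar> powr \<xi>" using s that by (intro powr_mono)
    finally show ?thesis .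
  qed
  from this[of H] this[of \<gamma>] params show ?thesis by (auto simp: q_def max_def)
qed

text \<open>One envelope, the sum of 1, the four absolute values and the Hoelder constant, serves
  all four functions. It controls them at x + s and not only at x, because the intermediate points
  of the expansion move away from x.\<close>

lemma growth:
  obtains F where "F \<in> borel_measurable borel" "\<And>x. 1 \<le> F x"
    "integrable lborel (\<lambda>x. (F x)\<^sup>2 * (1 + apow (\<phi>1 x) \<beta>) * exp (\<phi> x))"
    "\<And>x s. \<bar>\<phi>3 (x + s)\<bar> \<le> F x * (1 + q s)"
    "\<And>x s. \<bar>\<phi>2 (x + s) * \<phi>1 (x + s)\<bar> \<le> F x * (1 + q s)"
    "\<And>x s. \<bar>\<phi>1 (x + s) ^ 3\<bar> \<le> F x * (1 + q s)"
    "\<And>x s. \<bar>\<phi>2 (x + s) * apow (\<phi>1 (x + s)) (1 + \<beta>)\<bar> \<le> F x * (1 + q s)"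
proof -
  define S where "S = {\<phi>3, \<lambda>x. \<phi>2 x * \<phi>1 x, \<lambda>x. \<phi>1 x ^ 3, \<lambda>x. \<phi>2 x * apow (\<phi>1 x) (1 + \<beta>)}"
  let ?W = "\<lambda>x. (1 + apow (\<phi>1 x) \<beta>) * exp (\<phi> x)"
  have Wpos: "?W x > 0" for x using apow_nonneg[of "\<phi>1 x" \<beta>] by (intro mult_pos_pos) auto
  note A = A1[unfolded assumption1_def, folded S_def]
  have Smeas: "f \<in> borel_measurable borel" if "f \<in> S" for f using that by (auto simp: S_def)
  from A have int: "integrable lborel (\<lambda>x. \<bar>f x\<bar> powr (2 + \<epsilon>) * ?W x)" if "f \<in> S" for f
    using that by (auto simp: mult.assoc)
  from A obtain K where K: "integrable lborel (\<lambda>x. (K x)\<^sup>2 * (1 + apow (\<phi>1 x) \<beta>) * exp (\<phi> x))"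
    "\<forall>f\<in>S. \<forall>x \<delta>. \<bar>f (x + \<delta>) - f x\<bar> \<le> K x * max (\<bar>\<delta>\<bar> powr H) (\<bar>\<delta>\<bar> powr \<gamma>)"
    by blast
  have Kq: "\<bar>f (x + s) - f x\<bar> \<le> K x * q s" if "f \<in> S" for f x s
    using K(2) that by (auto simp: q_def)
  have K0: "0 \<le> K x" for x
    using Kq[of \<phi>3 x 1] by (auto simp: S_def q_1 intro: order_trans[OF abs_ge_zero])
  have Kint: "integrable lborel (\<lambda>x. (K x)\<^sup>2 * ?W x)" using K(1) by (simp add: mult.assoc)
  \<comment> \<open>Measurability of \<open>K\<close> is extracted from integrability of its
    weighted square: the weight is positive and \<open>K\<close> is nonnegative, so \<open>K\<close>
    is a square root of a quotient of measurable functions.\<close>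
  have Kmeas: "K \<in> borel_measurable borel"
  proof -
    have "(\<lambda>x. sqrt ((K x)\<^sup>2 * ?W x / ?W x)) \<in> borel_measurable borel"
      using borel_measurable_integrable[OF Kint] by measurable
    moreover have "(\<lambda>x. sqrt ((K x)\<^sup>2 * ?W x / ?W x)) = K"
      using Wpos K0 by (auto simp: fun_eq_iff less_le)
    ultimately show ?thesis by simp
  qed
  \<comment> \<open>Where |\<phi>'| \<le> 1 the weight is at most 2; elsewhere the integrable power
    of |\<phi>'^3| is at least 1.\<close>
  have Wint: "integrable lborel ?W"
  proof (rule Bochner_Integration.integrable_bound)
    show "integrable lborel (\<lambda>x. 2 * exp (\<phi> x) + \<bar>\<phi>1 x ^ 3\<bar> powr (2 + \<epsilon>) * ?W x)"
      using int[of "\<lambda>x. \<phi>1 x ^ 3"] dens by (auto simp: S_def)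
    have "?W x \<le> 2 * exp (\<phi> x) + \<bar>\<phi>1 x ^ 3\<bar> powr (2 + \<epsilon>) * ?W x" for x
    proof (cases "\<bar>\<phi>1 x\<bar> \<le> 1")
      case True
      then have "apow (\<phi>1 x) \<beta> \<le> apow 1 \<beta>" using params by (intro apow_mono) auto
      then have "?W x \<le> 2 * exp (\<phi> x)" by (intro mult_right_mono) (auto simp: apow_def split: if_splits)
      then show ?thesis using Wpos[of x] by (simp add: add_increasing2)
    next
      case False
      then have "1 \<le> \<bar>\<phi>1 x ^ 3\<bar>" by (simp add: power_abs one_le_power)
      then have "1 \<le> \<bar>\<phi>1 x ^ 3\<bar> powr (2 + \<epsilon>)" using params by (intro ge_one_powr_ge_zero) auto
      from mult_right_mono[OF this, of "?W x"] Wpos[of x] show ?thesis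
        by (simp add: add_increasing)
    qed
    then show "AE x in lborel. norm (?W x) \<le> norm (2 * exp (\<phi> x) + \<bar>\<phi>1 x ^ 3\<bar> powr (2 + \<epsilon>) * ?W x)"
      using Wpos by (auto intro!: AE_I2 intro: order_trans[OF _ abs_ge_self] simp: less_imp_le abs_of_pos)
  qed simp
  have int2: "integrable lborel (\<lambda>x. (f x)\<^sup>2 * ?W x)" if "f \<in> S" for f
  proof (rule integrable_abs_bound)
    show "integrable lborel (\<lambda>x. ?W x + \<bar>f x\<bar> powr (2 + \<epsilon>) * ?W x)"
      by (intro Bochner_Integration.integrable_add Wint int that)
    show "\<bar>(f x)\<^sup>2 * ?W x\<bar> \<le> ?W x + \<bar>f x\<bar> powr (2 + \<epsilon>) * ?W x" for x
      unfolding abs_mult[of _ "?W x"] abs_of_pos[OF Wpos]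
      using mult_right_mono[OF power_le_one_plus_powr[of 2 "2 + \<epsilon>" "f x"], of "?W x"] Wpos[of x] params
      by (simp add: distrib_right)
    show "(\<lambda>x. (f x)\<^sup>2 * ?W x) \<in> borel_measurable lborel" using Smeas[OF that] by simp
  qed
  define F where "F x = 1 + (\<bar>\<phi>3 x\<bar> + \<bar>\<phi>2 x * \<phi>1 x\<bar> + \<bar>\<phi>1 x ^ 3\<bar> + \<bar>\<phi>2 x * apow (\<phi>1 x) (1 + \<beta>)\<bar>) + K x" for x
  have Fmeas: "F \<in> borel_measurable borel" unfolding F_def using Kmeas by measurable
  have F: "\<bar>f (x + s)\<bar> \<le> F x * (1 + q s)" if "f \<in> S" for f x s
  proof -
    have "\<bar>f x\<bar> \<le> F x" using that K0[of x] by (auto simp: S_def F_def)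
    moreover have "K x \<le> F x" by (simp add: F_def)
    ultimately have "\<bar>f x\<bar> + K x * q s \<le> F x + F x * q s"
      using q_nonneg by (intro add_mono mult_right_mono)
    with Kq[OF that, of x s] show ?thesis by (simp add: distrib_left)
  qed
  show ?thesis
  proof (rule that[of F])
    show "F \<in> borel_measurable borel" by fact
    show "1 \<le> F x" for x using K0 by (simp add: F_def)
    show "\<bar>\<phi>3 (x + s)\<bar> \<le> F x * (1 + q s)" "\<bar>\<phi>2 (x + s) * \<phi>1 (x + s)\<bar> \<le> F x * (1 + q s)"
      "\<bar>\<phi>1 (x + s) ^ 3\<bar> \<le> F x * (1 + q s)"
      "\<bar>\<phi>2 (x + s) * apow (\<phi>1 (x + s)) (1 + \<beta>)\<bar> \<le> F x * (1 + q s)" for x s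
      using F[of \<phi>3] F[of "\<lambda>x. \<phi>2 x * \<phi>1 x"] F[of "\<lambda>x. \<phi>1 x ^ 3"] F[of "\<lambda>x. \<phi>2 x * apow (\<phi>1 x) (1 + \<beta>)"]
      by (auto simp: S_def)
    let ?Y = "\<lambda>x. ?W x + (\<phi>3 x)\<^sup>2 * ?W x + (\<phi>2 x * \<phi>1 x)\<^sup>2 * ?W x + (\<phi>1 x ^ 3)\<^sup>2 * ?W x
      + (\<phi>2 x * apow (\<phi>1 x) (1 + \<beta>))\<^sup>2 * ?W x + (K x)\<^sup>2 * ?W x"
    have "integrable lborel (\<lambda>x. (F x)\<^sup>2 * ?W x)"
    proof (rule integrable_abs_bound)
      show "integrable lborel (\<lambda>x. 6 * ?Y x)"
        using int2[of \<phi>3] int2[of "\<lambda>x. \<phi>2 x * \<phi>1 x"] int2[of "\<lambda>x. \<phi>1 x ^ 3"]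
          int2[of "\<lambda>x. \<phi>2 x * apow (\<phi>1 x) (1 + \<beta>)"] Kint Wint
        by (intro Bochner_Integration.integrable_add integrable_mult_right) (auto simp: S_def)
      \<comment> \<open>Cauchy-Schwarz for six summands; the difference of the two sides is the sum
        of the 15 squared pairwise differences.\<close>
      have sq6: "(1 + (a + c + d + e) + k)\<^sup>2 \<le> 6 * (1 + a\<^sup>2 + c\<^sup>2 + d\<^sup>2 + e\<^sup>2 + k\<^sup>2)" for a c d e k :: real
      proof -
        have "6 * (1 + a\<^sup>2 + c\<^sup>2 + d\<^sup>2 + e\<^sup>2 + k\<^sup>2) - (1 + (a + c + d + e) + k)\<^sup>2
          = (1 - a)\<^sup>2 + (1 - c)\<^sup>2 + (1 - d)\<^sup>2 + (1 - e)\<^sup>2 + (1 - k)\<^sup>2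
          + (a - c)\<^sup>2 + (a - d)\<^sup>2 + (a - e)\<^sup>2 + (a - k)\<^sup>2
          + (c - d)\<^sup>2 + (c - e)\<^sup>2 + (c - k)\<^sup>2 + (d - e)\<^sup>2 + (d - k)\<^sup>2 + (e - k)\<^sup>2"
          by (simp add: power2_eq_square algebra_simps)
        moreover have "0 \<le> \<dots>" by (intro add_nonneg_nonneg zero_le_power2)
        ultimately have "0 \<le> 6 * (1 + a\<^sup>2 + c\<^sup>2 + d\<^sup>2 + e\<^sup>2 + k\<^sup>2) - (1 + (a + c + d + e) + k)\<^sup>2"
          by (simp only:)
        then show ?thesis by (simp only: diff_ge_0_iff_ge)
      qed
      show "\<bar>(F x)\<^sup>2 * ?W x\<bar> \<le> 6 * ?Y x" for x
      proof -
        have "(F x)\<^sup>2 \<le> 6 * (1 + (\<phi>3 x)\<^sup>2 + (\<phi>2 x * \<phi>1 x)\<^sup>2 + (\<phi>1 x ^ 3)\<^sup>2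
            + (\<phi>2 x * apow (\<phi>1 x) (1 + \<beta>))\<^sup>2 + (K x)\<^sup>2)"
          using sq6[of "\<bar>\<phi>3 x\<bar>" "\<bar>\<phi>2 x * \<phi>1 x\<bar>" "\<bar>\<phi>1 x ^ 3\<bar>" "\<bar>\<phi>2 x * apow (\<phi>1 x) (1 + \<beta>)\<bar>" "K x"]
          unfolding F_def power2_abs .
        from mult_right_mono[OF this less_imp_le[OF Wpos[of x]]]
        have "(F x)\<^sup>2 * ?W x \<le> 6 * ?Y x" by (simp only: distrib_right mult.assoc mult_1_left)
        moreover have "0 \<le> (F x)\<^sup>2 * ?W x" by (rule mult_nonneg_nonneg[OF zero_le_power2 less_imp_le[OF Wpos]])
        ultimately show ?thesis by simp
      qed
    qed (use Fmeas in simp)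
    then show "integrable lborel (\<lambda>x. (F x)\<^sup>2 * (1 + apow (\<phi>1 x) \<beta>) * exp (\<phi> x))"
      by (simp add: mult.assoc)
  qed
qed

text \<open>The growth of \<open>rL\<close> at \<sigma> \<phi>' multiplies \<phi>'' \<phi>' by
  |\<phi>'|^\<beta>; the product is the fourth function controlled by the hypotheses.\<close>

lemma phi2_phi1_apow: "\<bar>\<phi>2 x * \<phi>1 x\<bar> * apow (\<phi>1 x) \<beta> = \<bar>\<phi>2 x * apow (\<phi>1 x) (1 + \<beta>)\<bar>"
proof -
  have "\<bar>\<phi>1 x\<bar> * apow (\<phi>1 x) \<beta> = apow (\<phi>1 x) (1 + \<beta>)"
    using params by (auto simp: apow_def powr_add)
  then show ?thesis
    using apow_nonneg[of "\<phi>1 x" "1 + \<beta>"] by (simp add: abs_mult mult.assoc)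
qed

lemma rho_scaled_bound:
  obtains G where "G \<in> borel_measurable borel" "\<And>x. 0 \<le> G x"
    "integrable lborel (\<lambda>x. G x * (1 + apow (\<phi>1 x) \<beta>) * exp (\<phi> x))"
    "\<And>\<sigma> x w. 0 < \<sigma> \<Longrightarrow> \<sigma> \<le> 1 \<Longrightarrow>
      (rho g \<mu> \<phi> \<sigma> x (x + \<sigma> * w) / \<sigma> ^ 3)\<^sup>2 \<le> G x * (1 + w ^ 6 + \<sigma> powr (\<xi> - 6) * \<bar>w\<bar> powr \<xi>)"
proof -
  obtain F where F: "F \<in> borel_measurable borel" "\<And>x. 1 \<le> F x"
    "integrable lborel (\<lambda>x. (F x)\<^sup>2 * (1 + apow (\<phi>1 x) \<beta>) * exp (\<phi> x))"
    "\<And>x s. \<bar>\<phi>3 (x + s)\<bar> \<le> F x * (1 + q s)"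
    "\<And>x s. \<bar>\<phi>2 (x + s) * \<phi>1 (x + s)\<bar> \<le> F x * (1 + q s)"
    "\<And>x s. \<bar>\<phi>1 (x + s) ^ 3\<bar> \<le> F x * (1 + q s)"
    "\<And>x s. \<bar>\<phi>2 (x + s) * apow (\<phi>1 (x + s)) (1 + \<beta>)\<bar> \<le> F x * (1 + q s)"
    by (rule growth; rule that)
  \<comment> \<open>On short jumps 1 + q \<le> 2, and \<open>c\<close> collects 2/12 from the
    trapezoidal error, 2 M from \<open>b\<close> and 4 CL from log Z. On long jumps
    \<open>c'\<close> collects 3 from the increment of \<phi>, 3 M from each of two values of
    \<open>b\<close>, and 4 CL from log Z.\<close>
  define c where "c = 1 / 6 + 2 * M + 4 * CL"
  define c' where "c' = 3 + 6 * M + 4 * CL"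
  have c0: "0 \<le> c" "0 \<le> c'" using M(1) CL_ge_1 by (auto simp: c_def c'_def)
  have bound: "\<bar>f \<eta>\<bar> \<le> F x * (1 + q d)"
    if "\<bar>\<eta> - x\<bar> \<le> \<bar>d\<bar>" "\<And>x s. \<bar>f (x + s)\<bar> \<le> F x * (1 + q s)" for f :: "real \<Rightarrow> real" and x \<eta> d
  proof -
    have "\<bar>f (x + (\<eta> - x))\<bar> \<le> F x * (1 + q (\<eta> - x))" by (rule that(2))
    also have "\<dots> \<le> F x * (1 + q d)"
      using F(2)[of x] q_mono[OF that(1)] by (intro mult_left_mono) auto
    finally show ?thesis by simp
  qed
  have Lpart: "\<bar>(\<phi>2 \<eta> * \<phi>1 \<eta>) * rL (\<sigma> * \<phi>1 \<eta>)\<bar> \<le> 2 * CL * (F x * (1 + q d))"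
    if \<sigma>: "0 < \<sigma>" "\<sigma> \<le> 1" and \<eta>: "\<bar>\<eta> - x\<bar> \<le> \<bar>d\<bar>" for \<sigma> \<eta> x d
  proof -
    have "\<bar>\<sigma> * \<phi>1 \<eta>\<bar> \<le> \<bar>\<phi>1 \<eta>\<bar>"
      using \<sigma> mult_right_mono[of \<sigma> 1 "\<bar>\<phi>1 \<eta>\<bar>"] by (simp add: abs_mult)
    then have "apow (\<sigma> * \<phi>1 \<eta>) \<beta> \<le> apow (\<phi>1 \<eta>) \<beta>" using params by (intro apow_mono) auto
    then have "CL * (1 + apow (\<sigma> * \<phi>1 \<eta>) \<beta>) \<le> CL * (1 + apow (\<phi>1 \<eta>) \<beta>)"
      using CL_ge_1 by (intro mult_left_mono) auto
    with rL(4)[of "\<sigma> * \<phi>1 \<eta>"] have "\<bar>rL (\<sigma> * \<phi>1 \<eta>)\<bar> \<le> CL * (1 + apow (\<phi>1 \<eta>) \<beta>)" by linarith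
    then have "\<bar>(\<phi>2 \<eta> * \<phi>1 \<eta>) * rL (\<sigma> * \<phi>1 \<eta>)\<bar> \<le> \<bar>\<phi>2 \<eta> * \<phi>1 \<eta>\<bar> * (CL * (1 + apow (\<phi>1 \<eta>) \<beta>))"
      unfolding abs_mult[of "\<phi>2 \<eta> * \<phi>1 \<eta>"] by (rule mult_left_mono) simp
    also have "\<dots> = CL * (\<bar>\<phi>2 \<eta> * \<phi>1 \<eta>\<bar> + \<bar>\<phi>2 \<eta> * \<phi>1 \<eta>\<bar> * apow (\<phi>1 \<eta>) \<beta>)"
      by (simp only: distrib_left mult_1_right mult_ac)
    also have "\<dots> \<le> CL * (F x * (1 + q d) + F x * (1 + q d))"
      unfolding phi2_phi1_apow
      using CL_ge_1 bound[OF \<eta> F(5)] bound[OF \<eta> F(7)] by (intro mult_left_mono add_mono) auto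
    finally show ?thesis by simp
  qed
  have small: "(rho g \<mu> \<phi> \<sigma> x (x + \<sigma> * w) / \<sigma> ^ 3)\<^sup>2 \<le> 4 * (c * F x)\<^sup>2 * (1 + w ^ 6)"
    if \<sigma>: "0 < \<sigma>" "\<sigma> \<le> 1" and w: "\<bar>\<sigma> * w\<bar> \<le> 1" for \<sigma> x w
  proof -
    define d where "d = \<sigma> * w"
    have "q d \<le> 1" using q_mono[of d 1] w by (simp add: d_def q_1)
    then have F2: "F x * (1 + q d) \<le> 2 * F x" using F(2)[of x] by simp
    obtain \<eta>1 \<eta>2 \<eta>3 where \<eta>: "\<bar>\<eta>1 - x\<bar> \<le> \<bar>d\<bar>" "\<bar>\<eta>2 - x\<bar> \<le> \<bar>d\<bar>" "\<bar>\<eta>3 - x\<bar> \<le> \<bar>d\<bar>"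
      and eq: "rho g \<mu> \<phi> \<sigma> x (x + d) = - (d ^ 3 / 12) * \<phi>3 \<eta>1 + d ^ 3 * (\<phi>2 \<eta>2 * \<phi>1 \<eta>2) * rb (d * \<phi>1 \<eta>2)
        - d * \<sigma>\<^sup>2 * (\<phi>2 \<eta>3 * \<phi>1 \<eta>3) * rL (\<sigma> * \<phi>1 \<eta>3)"
      using rho_expansion by blast
    have 1: "\<bar>- (d ^ 3 / 12) * \<phi>3 \<eta>1\<bar> \<le> (\<bar>d\<bar> ^ 3 / 12) * (2 * F x)"
      using mult_left_mono[OF order_trans[OF bound[OF \<eta>(1) F(4)] F2], of "\<bar>d\<bar> ^ 3 / 12"]
      by (simp add: abs_mult power_abs)
    have 2: "\<bar>d ^ 3 * (\<phi>2 \<eta>2 * \<phi>1 \<eta>2) * rb (d * \<phi>1 \<eta>2)\<bar> \<le> \<bar>d\<bar> ^ 3 * (2 * F x) * M"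
      unfolding abs_mult[of "d ^ 3 * _"] abs_mult[of "d ^ 3"] power_abs
      using order_trans[OF bound[OF \<eta>(2) F(5)] F2] rb(4) F(2)[of x]
      by (intro mult_mono) auto
    have 3: "\<bar>d * \<sigma>\<^sup>2 * (\<phi>2 \<eta>3 * \<phi>1 \<eta>3) * rL (\<sigma> * \<phi>1 \<eta>3)\<bar> \<le> (\<bar>d\<bar> * \<sigma>\<^sup>2) * (2 * CL * (2 * F x))"
    proof -
      have "\<bar>(\<phi>2 \<eta>3 * \<phi>1 \<eta>3) * rL (\<sigma> * \<phi>1 \<eta>3)\<bar> \<le> 2 * CL * (2 * F x)"
        using Lpart[OF \<sigma> \<eta>(3)] mult_left_mono[OF F2, of "2 * CL"] CL_ge_1 by linarith
      from mult_left_mono[OF this, of "\<bar>d\<bar> * \<sigma>\<^sup>2"] show ?thesis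
        by (simp add: abs_mult mult.assoc)
    qed
    have "\<bar>rho g \<mu> \<phi> \<sigma> x (x + d)\<bar> \<le> (\<bar>d\<bar> ^ 3 / 12) * (2 * F x) + \<bar>d\<bar> ^ 3 * (2 * F x) * M + (\<bar>d\<bar> * \<sigma>\<^sup>2) * (2 * CL * (2 * F x))"
      unfolding eq using 1 2 3 by linarith
    also have "\<dots> = \<sigma> ^ 3 * (F x * ((1 / 6 + 2 * M) * \<bar>w\<bar> ^ 3 + 4 * CL * \<bar>w\<bar>))"
      using \<sigma> by (simp add: d_def abs_mult power2_eq_square power3_eq_cube algebra_simps)
    finally have "\<bar>rho g \<mu> \<phi> \<sigma> x (x + d) / \<sigma> ^ 3\<bar> \<le> F x * ((1 / 6 + 2 * M) * \<bar>w\<bar> ^ 3 + 4 * CL * \<bar>w\<bar>)"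
      using \<sigma> by (simp add: abs_divide divide_le_eq mult.commute)
    also have "\<dots> \<le> F x * (c * \<bar>w\<bar> ^ 3 + c * \<bar>w\<bar>)"
      using F(2)[of x] M(1) CL_ge_1 by (intro mult_left_mono add_mono mult_right_mono) (auto simp: c_def)
    also have "\<dots> = (c * F x) * (\<bar>w\<bar> ^ 3 + \<bar>w\<bar>)" by (simp add: algebra_simps)
    finally have "\<bar>rho g \<mu> \<phi> \<sigma> x (x + d) / \<sigma> ^ 3\<bar>\<^sup>2 \<le> ((c * F x) * (\<bar>w\<bar> ^ 3 + \<bar>w\<bar>))\<^sup>2"
      by (intro power_mono) auto
    also have "\<dots> = (c * F x)\<^sup>2 * (\<bar>w\<bar> ^ 3 + \<bar>w\<bar>)\<^sup>2" by (rule power_mult_distrib)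
    also have "\<dots> \<le> (c * F x)\<^sup>2 * (4 * (1 + w ^ 6))"
    proof (rule mult_left_mono)
      have "(\<bar>w\<bar> ^ 3 + \<bar>w\<bar>)\<^sup>2 \<le> 2 * (\<bar>w\<bar> ^ 3)\<^sup>2 + 2 * \<bar>w\<bar>\<^sup>2"
        using zero_le_power2[of "\<bar>w\<bar> ^ 3 - \<bar>w\<bar>"] unfolding power2_sum power2_diff by linarith
      also have "(\<bar>w\<bar> ^ 3)\<^sup>2 = w ^ 6" by (simp add: power_mult[symmetric] power_even_abs)
      also have "\<bar>w\<bar>\<^sup>2 \<le> 1 + w ^ 6"
        using power_le_one_plus_powr[of 2 6 w] by (simp add: powr_numeral power_even_abs)
      finally show "(\<bar>w\<bar> ^ 3 + \<bar>w\<bar>)\<^sup>2 \<le> 4 * (1 + w ^ 6)" by simp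
    qed simp
    finally show ?thesis by (simp only: power2_abs d_def mult_ac)
  qed
  \<comment> \<open>The cubic expansion would cost |d|^3 q(d), whose square may exceed the moment of
    order \<xi>. Each increment is instead bounded to first order in d; after division by \<sigma>^6
    the factor \<sigma>^(\<xi> - 6) is left.\<close>
  have large: "(rho g \<mu> \<phi> \<sigma> x (x + \<sigma> * w) / \<sigma> ^ 3)\<^sup>2 \<le> (c' * F x)\<^sup>2 * (\<sigma> powr (\<xi> - 6) * \<bar>w\<bar> powr \<xi>)"
    if \<sigma>: "0 < \<sigma>" "\<sigma> \<le> 1" and w: "1 < \<bar>\<sigma> * w\<bar>" for \<sigma> x w
  proof -
    define d where "d = \<sigma> * w"
    define Q where "Q = F x * q d"
    have q1: "1 \<le> q d" using q_mono[of 1 d] w by (simp add: d_def q_1)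
    then have F2: "F x * (1 + q d) \<le> 2 * Q" using F(2)[of x] by (simp add: distrib_left Q_def)
    have Q1: "1 \<le> Q" using mult_mono[of 1 "F x" 1 "q d"] q1 F(2)[of x] by (simp add: Q_def)
    \<comment> \<open>Only \<phi>'^3 has a growth bound; |t| \<le> 1 + |t|^3 passes it to \<phi>',
      giving 1 + 2 Q \<le> 3 Q.\<close>
    have p1: "\<bar>\<phi>1 \<eta>\<bar> \<le> 3 * Q" if "\<bar>\<eta> - x\<bar> \<le> \<bar>d\<bar>" for \<eta>
    proof -
      have "\<bar>\<phi>1 \<eta>\<bar> \<le> 1 + \<bar>\<phi>1 \<eta> ^ 3\<bar>"
        using power_le_one_plus_powr[of 1 3 "\<phi>1 \<eta>"] by (simp add: powr_numeral power_abs)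
      with bound[OF that F(6)] F2 Q1 show ?thesis by linarith
    qed
    obtain \<eta> where \<eta>: "\<bar>\<eta> - x\<bar> \<le> \<bar>x + d - x\<bar>" "\<phi> (x + d) - \<phi> x = (x + d - x) * \<phi>1 \<eta>"
      using mvt_between[OF phi_DERIV(1)] by blast
    have 1: "\<bar>\<phi> (x + d) - \<phi> x\<bar> \<le> \<bar>d\<bar> * (3 * Q)"
      using p1[of \<eta>] \<eta> by (simp add: abs_mult mult_left_mono)
    have 2: "\<bar>b (\<phi>1 \<eta> * e)\<bar> \<le> \<bar>d\<bar> * (3 * M * Q)" if "\<bar>\<eta> - x\<bar> \<le> \<bar>d\<bar>" "\<bar>e\<bar> = \<bar>d\<bar>" for \<eta> e
    proof -
      have "\<bar>b (\<phi>1 \<eta> * e)\<bar> \<le> M * (\<bar>\<phi>1 \<eta>\<bar> * \<bar>d\<bar>)" using b_abs[of "\<phi>1 \<eta> * e"] that by (simp add: abs_mult)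
      also have "\<dots> \<le> M * ((3 * Q) * \<bar>d\<bar>)"
        using M(1) p1[OF that(1)] by (intro mult_left_mono mult_right_mono) auto
      finally show ?thesis by (simp add: mult_ac)
    qed
    obtain \<eta>3 where \<eta>3: "\<bar>\<eta>3 - x\<bar> \<le> \<bar>d\<bar>" "ln (h (\<sigma> * \<phi>1 x)) - ln (h (\<sigma> * \<phi>1 (x + d)))
      = - d * \<sigma>\<^sup>2 * (\<phi>2 \<eta>3 * \<phi>1 \<eta>3) * rL (\<sigma> * \<phi>1 \<eta>3)"
      using ln_Zs_diff by blast
    have 3: "\<bar>ln (h (\<sigma> * \<phi>1 x)) - ln (h (\<sigma> * \<phi>1 (x + d)))\<bar> \<le> \<bar>d\<bar> * (4 * CL * Q)"
    proof -
      have "\<bar>(\<phi>2 \<eta>3 * \<phi>1 \<eta>3) * rL (\<sigma> * \<phi>1 \<eta>3)\<bar> \<le> 4 * CL * Q"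
        using Lpart[OF \<sigma> \<eta>3(1)] mult_left_mono[OF F2, of "2 * CL"] CL_ge_1 by linarith
      moreover have s1: "\<sigma>\<^sup>2 \<le> 1" using \<sigma> by (intro power_le_one) auto
      ultimately have "(\<bar>d\<bar> * \<sigma>\<^sup>2) * \<bar>(\<phi>2 \<eta>3 * \<phi>1 \<eta>3) * rL (\<sigma> * \<phi>1 \<eta>3)\<bar> \<le> (\<bar>d\<bar> * 1) * (4 * CL * Q)"
        by (intro mult_mono) simp_all
      then show ?thesis unfolding \<eta>3(2) by (simp add: abs_mult mult.assoc)
    qed
    have "\<bar>rho g \<mu> \<phi> \<sigma> x (x + d)\<bar> \<le> \<bar>d\<bar> * (3 * Q) + (\<bar>d\<bar> * (3 * M * Q) + \<bar>d\<bar> * (3 * M * Q)) + \<bar>d\<bar> * (4 * CL * Q)"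
    proof -
      have "\<bar>b (\<phi>1 (x + d) * (- d))\<bar> \<le> \<bar>d\<bar> * (3 * M * Q)" "\<bar>b (\<phi>1 x * d)\<bar> \<le> \<bar>d\<bar> * (3 * M * Q)"
        by (rule 2; simp)+
      with 1 3 show ?thesis unfolding rho_eq by linarith
    qed
    also have "\<dots> = (c' * F x) * (\<bar>d\<bar> * q d)" by (simp add: c'_def Q_def algebra_simps)
    finally have "\<bar>rho g \<mu> \<phi> \<sigma> x (x + d)\<bar>\<^sup>2 \<le> ((c' * F x) * (\<bar>d\<bar> * q d))\<^sup>2"
      by (intro power_mono) auto
    also have "\<dots> = (c' * F x)\<^sup>2 * (d * q d)\<^sup>2" by (simp add: power_mult_distrib)
    also have "\<dots> \<le> (c' * F x)\<^sup>2 * \<bar>d\<bar> powr \<xi>"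
      using w by (intro mult_left_mono sq_q_le) (auto simp: d_def)
    finally have A: "(rho g \<mu> \<phi> \<sigma> x (x + d))\<^sup>2 \<le> (c' * F x)\<^sup>2 * \<bar>d\<bar> powr \<xi>" by simp
    have "\<bar>d\<bar> powr \<xi> = \<sigma> powr \<xi> * \<bar>w\<bar> powr \<xi>" using \<sigma> by (simp add: d_def abs_mult powr_mult)
    moreover have "\<sigma> powr \<xi> = \<sigma> powr (\<xi> - 6) * \<sigma> ^ 6"
      using \<sigma> by (simp add: powr_diff powr_numeral)
    ultimately have B: "\<bar>d\<bar> powr \<xi> = \<sigma> powr (\<xi> - 6) * \<bar>w\<bar> powr \<xi> * \<sigma> ^ 6" by simp
    have "(rho g \<mu> \<phi> \<sigma> x (x + d) / \<sigma> ^ 3)\<^sup>2 = (rho g \<mu> \<phi> \<sigma> x (x + d))\<^sup>2 / \<sigma> ^ 6"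
      by (simp add: power_divide power_mult[symmetric])
    also have "\<dots> \<le> ((c' * F x)\<^sup>2 * \<bar>d\<bar> powr \<xi>) / \<sigma> ^ 6"
      using A \<sigma> by (intro divide_right_mono) auto
    also have "\<dots> = (c' * F x)\<^sup>2 * (\<sigma> powr (\<xi> - 6) * \<bar>w\<bar> powr \<xi>)" using \<sigma> by (simp add: B)
    finally show ?thesis by (simp add: d_def)
  qed
  define G where "G x = (4 * c\<^sup>2 + c'\<^sup>2) * (F x)\<^sup>2" for x
  show ?thesis
  proof (rule that[of G])
    show "G \<in> borel_measurable borel" unfolding G_def using F(1) by measurable
    show "0 \<le> G x" for x by (simp add: G_def)
    show "integrable lborel (\<lambda>x. G x * (1 + apow (\<phi>1 x) \<beta>) * exp (\<phi> x))"
      using integrable_mult_right[OF F(3), of "4 * c\<^sup>2 + c'\<^sup>2"] by (simp add: G_def mult.assoc)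
    fix \<sigma> x w :: real assume \<sigma>: "0 < \<sigma>" "\<sigma> \<le> 1"
    have nn: "0 \<le> 1 + w ^ 6" by simp
    show "(rho g \<mu> \<phi> \<sigma> x (x + \<sigma> * w) / \<sigma> ^ 3)\<^sup>2 \<le> G x * (1 + w ^ 6 + \<sigma> powr (\<xi> - 6) * \<bar>w\<bar> powr \<xi>)"
    proof (cases "\<bar>\<sigma> * w\<bar> \<le> 1")
      case True
      have "4 * (c * F x)\<^sup>2 * (1 + w ^ 6) \<le> G x * (1 + w ^ 6 + \<sigma> powr (\<xi> - 6) * \<bar>w\<bar> powr \<xi>)"
        by (intro mult_mono) (auto simp: G_def power_mult_distrib distrib_right)
      with small[OF \<sigma> True, of x] show ?thesis by linarith
    next
      case False
      have "(c' * F x)\<^sup>2 * (\<sigma> powr (\<xi> - 6) * \<bar>w\<bar> powr \<xi>) \<le> G x * (1 + w ^ 6 + \<sigma> powr (\<xi> - 6) * \<bar>w\<bar> powr \<xi>)"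
        using nn by (intro mult_mono) (auto simp: G_def power_mult_distrib distrib_right)
      with large[OF \<sigma>, of w x] False show ?thesis by linarith
    qed
  qed
qed

subsection \<open>Second-order functionals of the log-ratio\<close>

sublocale pair: pair_sigma_finite lborel \<mu> ..

text \<open>The density with respect to \<open>\<mu>\<close> of the standardized jump W = (Y - X) /
  \<sigma> given X = x.\<close>

definition kern :: "real \<Rightarrow> real \<Rightarrow> real \<Rightarrow> real" where
  "kern \<sigma> x w = exp (b (\<sigma> * \<phi>1 x * w)) / h (\<sigma> * \<phi>1 x)"

definition dens_xw :: "real \<Rightarrow> real \<times> real \<Rightarrow> real" where
  "dens_xw \<sigma> p = exp (\<phi> (fst p)) * kern \<sigma> (fst p) (snd p)"

lemma kern_pos: "0 < kern \<sigma> x w"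
  using h_pos by (simp add: kern_def)

lemma kern_measurable [measurable]: "(\<lambda>p. kern \<sigma> (fst p) (snd p)) \<in> borel_measurable (borel \<Otimes>\<^sub>M borel)"
  and kern_measurable' [measurable]: "kern \<sigma> x \<in> borel_measurable borel"
  unfolding kern_def[abs_def] by measurable

lemma dens_xw_measurable [measurable]: "dens_xw \<sigma> \<in> borel_measurable (borel \<Otimes>\<^sub>M borel)"
  unfolding dens_xw_def[abs_def] by measurable

lemma dens_xw_nonneg: "0 \<le> dens_xw \<sigma> p"
  using kern_pos by (simp add: dens_xw_def less_imp_le)

lemma kern_integrable: "integrable \<mu> (kern \<sigma> x)"
  and kern_integral: "(\<integral>w. kern \<sigma> x w \<partial>\<mu>) = 1"
  and kern_powr_integrable: "integrable \<mu> (\<lambda>w. \<bar>w\<bar> powr \<xi> * kern \<sigma> x w)"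
  and kern_powr_le: "(\<integral>w. \<bar>w\<bar> powr \<xi> * kern \<sigma> x w \<partial>\<mu>) \<le> C\<mu> * (1 + apow (\<sigma> * \<phi>1 x) \<beta>)"
proof -
  show "integrable \<mu> (kern \<sigma> x)" "(\<integral>w. kern \<sigma> x w \<partial>\<mu>) = 1"
    unfolding kern_def[abs_def]
    using exp_b_integrable[of "\<sigma> * \<phi>1 x"] h_pos[of "\<sigma> * \<phi>1 x"] by (simp_all add: h_def)
  have eq: "(\<lambda>w. \<bar>w\<bar> powr \<xi> * kern \<sigma> x w) = (\<lambda>w. \<bar>w\<bar> powr \<xi> * exp (b (\<sigma> * \<phi>1 x * w)) / h (\<sigma> * \<phi>1 x))"
    by (simp add: kern_def fun_eq_iff)
  show "integrable \<mu> (\<lambda>w. \<bar>w\<bar> powr \<xi> * kern \<sigma> x w)"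
    unfolding eq using exp_b_powr_integrable[of "\<sigma> * \<phi>1 x"] by simp
  show "(\<integral>w. \<bar>w\<bar> powr \<xi> * kern \<sigma> x w \<partial>\<mu>) \<le> C\<mu> * (1 + apow (\<sigma> * \<phi>1 x) \<beta>)"
    unfolding eq using exp_b_powr_le[of "\<sigma> * \<phi>1 x"] h_pos[of "\<sigma> * \<phi>1 x"] by (simp add: divide_le_eq)
qed

lemma apow_scale: "0 \<le> \<sigma> \<Longrightarrow> \<sigma> \<le> 1 \<Longrightarrow> apow (\<sigma> * a) \<beta> \<le> apow a \<beta>"
  using params mult_right_mono[of \<sigma> 1 "\<bar>a\<bar>"] by (intro apow_mono) (auto simp: abs_mult)

lemma kern_powr_le':
  assumes "0 \<le> \<sigma>" "\<sigma> \<le> 1"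
  shows "(\<integral>w. \<bar>w\<bar> powr \<xi> * kern \<sigma> x w \<partial>\<mu>) \<le> C\<mu> * (1 + apow (\<phi>1 x) \<beta>)"
proof -
  have "C\<mu> * (1 + apow (\<sigma> * \<phi>1 x) \<beta>) \<le> C\<mu> * (1 + apow (\<phi>1 x) \<beta>)"
    using apow_scale[OF assms] params by (intro mult_left_mono add_left_mono) auto
  with kern_powr_le[of \<sigma> x] show ?thesis by linarith
qed

lemma jointXY_eq:
  "jointXY g \<mu> \<phi> \<sigma> = distr (density (lborel \<Otimes>\<^sub>M \<mu>) (\<lambda>p. ennreal (dens_xw \<sigma> p)))
     (borel \<Otimes>\<^sub>M borel) (\<lambda>p. (fst p, fst p + \<sigma> * snd p))"
proof -
  have "(\<lambda>(x, w). ennreal (exp (\<phi> x) * g (exp (\<sigma> * w * deriv \<phi> x)) / Zs g \<mu> \<phi> \<sigma> x)) = (\<lambda>p. ennreal (dens_xw \<sigma> p))"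
    by (auto simp: fun_eq_iff dens_xw_def kern_def Zs_eq deriv_phi exp_b mult_ac)
  moreover have "(\<lambda>(x, w). (x, x + \<sigma> * w)) = (\<lambda>p. (fst p, fst p + \<sigma> * snd p))" by auto
  ultimately show ?thesis unfolding jointXY_def by simp
qed

lemma shear_measurable [measurable]:
  "(\<lambda>p. (fst p, fst p + \<sigma> * snd p)) \<in> (lborel \<Otimes>\<^sub>M \<mu>) \<rightarrow>\<^sub>M (borel \<Otimes>\<^sub>M borel :: (real \<times> real) measure)"
  by measurable

lemma sets_pair [measurable_cong]: "sets (lborel \<Otimes>\<^sub>M \<mu>) = sets (borel \<Otimes>\<^sub>M borel)"
  by (intro sets_pair_measure_cong) (simp_all add: mu_sets)

lemma prob_space_jointXY: "prob_space (jointXY g \<mu> \<phi> \<sigma>)"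
proof -
  have "(\<integral>\<^sup>+p. ennreal (dens_xw \<sigma> p) \<partial>(lborel \<Otimes>\<^sub>M \<mu>)) = (\<integral>\<^sup>+x. \<integral>\<^sup>+w. ennreal (dens_xw \<sigma> (x, w)) \<partial>\<mu> \<partial>lborel)"
    by (rule mu.nn_integral_fst[symmetric]) simp
  also have "\<dots> = (\<integral>\<^sup>+x. ennreal (exp (\<phi> x)) \<partial>lborel)"
  proof (intro nn_integral_cong)
    fix x
    have "(\<integral>\<^sup>+w. ennreal (dens_xw \<sigma> (x, w)) \<partial>\<mu>) = ennreal (exp (\<phi> x)) * (\<integral>\<^sup>+w. ennreal (kern \<sigma> x w) \<partial>\<mu>)"
      by (simp add: dens_xw_def ennreal_mult' nn_integral_cmult kern_pos less_imp_le)
    also have "(\<integral>\<^sup>+w. ennreal (kern \<sigma> x w) \<partial>\<mu>) = 1"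
      using kern_integrable kern_pos by (simp add: nn_integral_eq_integral less_imp_le kern_integral)
    finally show "(\<integral>\<^sup>+w. ennreal (dens_xw \<sigma> (x, w)) \<partial>\<mu>) = ennreal (exp (\<phi> x))" by simp
  qed
  also have "\<dots> = 1" using dens by (simp add: nn_integral_eq_integral)
  finally have 1: "(\<integral>\<^sup>+p. ennreal (dens_xw \<sigma> p) \<partial>(lborel \<Otimes>\<^sub>M \<mu>)) = 1" .
  have "prob_space (density (lborel \<Otimes>\<^sub>M \<mu>) (\<lambda>p. ennreal (dens_xw \<sigma> p)))"
  proof
    have "(\<lambda>p. ennreal (dens_xw \<sigma> p)) \<in> borel_measurable (lborel \<Otimes>\<^sub>M \<mu>)" by measurable
    from emeasure_density[OF this sets.top]
    show "emeasure (density (lborel \<Otimes>\<^sub>M \<mu>) (\<lambda>p. ennreal (dens_xw \<sigma> p)))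
        (space (density (lborel \<Otimes>\<^sub>M \<mu>) (\<lambda>p. ennreal (dens_xw \<sigma> p)))) = 1"
      by (simp add: 1 cong: nn_integral_cong)
  qed
  then show ?thesis unfolding jointXY_eq by (rule prob_space.prob_space_distr) simp
qed

lemma joint_integrable_iff:
  fixes f :: "real \<times> real \<Rightarrow> real"
  assumes [measurable]: "f \<in> borel_measurable (borel \<Otimes>\<^sub>M borel)"
  shows "integrable (jointXY g \<mu> \<phi> \<sigma>) f \<longleftrightarrow>
    integrable (lborel \<Otimes>\<^sub>M \<mu>) (\<lambda>p. dens_xw \<sigma> p * f (fst p, fst p + \<sigma> * snd p))"
  unfolding jointXY_eq
  by (subst integrable_distr_eq) (simp_all add: integrable_density dens_xw_nonneg)

lemma joint_integral:
  fixes f :: "real \<times> real \<Rightarrow> real"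
  assumes [measurable]: "f \<in> borel_measurable (borel \<Otimes>\<^sub>M borel)"
  shows "(\<integral>p. f p \<partial>jointXY g \<mu> \<phi> \<sigma>) =
    (\<integral>p. dens_xw \<sigma> p * f (fst p, fst p + \<sigma> * snd p) \<partial>(lborel \<Otimes>\<^sub>M \<mu>))"
  unfolding jointXY_eq
  by (subst integral_distr) (simp_all add: integral_density dens_xw_nonneg)

text \<open>Integrating out the jump costs the factor 1 + |\<phi>'|^\<beta>, uniformly in \<sigma>
  \<le> 1; bounds in x must therefore be integrable with this weight.\<close>

lemma inner_integral_bound:
  assumes \<sigma>: "0 \<le> \<sigma>" "\<sigma> \<le> 1" and f [measurable]: "f \<in> borel_measurable borel"
    and bd: "\<And>w. \<bar>f w\<bar> \<le> D * (1 + \<bar>w\<bar> powr \<xi>)" and D: "0 \<le> D"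
  shows "integrable \<mu> (\<lambda>w. kern \<sigma> x w * f w)"
    and "(\<integral>w. \<bar>kern \<sigma> x w * f w\<bar> \<partial>\<mu>) \<le> D * ((1 + C\<mu>) * (1 + apow (\<phi>1 x) \<beta>))"
proof -
  let ?u = "\<lambda>w. D * (kern \<sigma> x w + \<bar>w\<bar> powr \<xi> * kern \<sigma> x w)"
  have u: "integrable \<mu> ?u"
    by (intro integrable_mult_right Bochner_Integration.integrable_add kern_integrable kern_powr_integrable)
  have le: "\<bar>kern \<sigma> x w * f w\<bar> \<le> ?u w" for w
    using mult_left_mono[OF bd[of w], of "kern \<sigma> x w"] kern_pos[of \<sigma> x w]
    by (simp add: abs_mult algebra_simps)
  show i: "integrable \<mu> (\<lambda>w. kern \<sigma> x w * f w)"
    by (rule integrable_abs_bound[OF u _ le]) measurable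
  have "(\<integral>w. \<bar>kern \<sigma> x w * f w\<bar> \<partial>\<mu>) \<le> (\<integral>w. ?u w \<partial>\<mu>)"
    by (intro integral_mono integrable_abs i u le)
  also have "\<dots> = D * (1 + (\<integral>w. \<bar>w\<bar> powr \<xi> * kern \<sigma> x w \<partial>\<mu>))"
    using kern_integrable kern_powr_integrable by (simp add: kern_integral)
  also have "\<dots> \<le> D * (1 + C\<mu> * (1 + apow (\<phi>1 x) \<beta>))"
    using D kern_powr_le'[OF \<sigma>] by (intro mult_left_mono add_left_mono) auto
  also have "\<dots> \<le> D * ((1 + C\<mu>) * (1 + apow (\<phi>1 x) \<beta>))"
    using D apow_nonneg[of "\<phi>1 x" \<beta>] by (intro mult_left_mono) (auto simp: algebra_simps)
  finally show "(\<integral>w. \<bar>kern \<sigma> x w * f w\<bar> \<partial>\<mu>) \<le> D * ((1 + C\<mu>) * (1 + apow (\<phi>1 x) \<beta>))" .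
qed

lemma joint_Fubini:
  fixes f :: "real \<times> real \<Rightarrow> real"
  assumes \<sigma>: "0 \<le> \<sigma>" "\<sigma> \<le> 1"
    and f [measurable]: "f \<in> borel_measurable (borel \<Otimes>\<^sub>M borel)"
    and bd: "\<And>x w. \<bar>f (x, w)\<bar> \<le> D x * (1 + \<bar>w\<bar> powr \<xi>)" and D: "\<And>x. 0 \<le> D x"
    and Dint: "integrable lborel (\<lambda>x. D x * (1 + apow (\<phi>1 x) \<beta>) * exp (\<phi> x))"
  shows "integrable (lborel \<Otimes>\<^sub>M \<mu>) (\<lambda>p. dens_xw \<sigma> p * f p)"
    and "(\<integral>p. dens_xw \<sigma> p * f p \<partial>(lborel \<Otimes>\<^sub>M \<mu>))
      = (\<integral>x. exp (\<phi> x) * (\<integral>w. kern \<sigma> x w * f (x, w) \<partial>\<mu>) \<partial>lborel)"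
proof -
  have fx: "(\<lambda>w. f (x, w)) \<in> borel_measurable borel" for x by measurable
  have eq: "dens_xw \<sigma> (x, w) * f (x, w) = exp (\<phi> x) * (kern \<sigma> x w * f (x, w))" for x w
    by (simp add: dens_xw_def)
  note inner = inner_integral_bound[OF \<sigma> fx bd D]
  show int: "integrable (lborel \<Otimes>\<^sub>M \<mu>) (\<lambda>p. dens_xw \<sigma> p * f p)"
  proof (rule pair.Fubini_integrable)
    show "AE x in lborel. integrable \<mu> (\<lambda>w. dens_xw \<sigma> (x, w) * f (x, w))"
      using inner(1) by (simp add: eq)
    have eq': "(\<integral>w. norm (dens_xw \<sigma> (x, w) * f (x, w)) \<partial>\<mu>)
        = exp (\<phi> x) * (\<integral>w. \<bar>kern \<sigma> x w * f (x, w)\<bar> \<partial>\<mu>)" for x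
      by (simp add: eq abs_mult)
    show "integrable lborel (\<lambda>x. \<integral>w. norm (dens_xw \<sigma> (x, w) * f (x, w)) \<partial>\<mu>)"
    proof (rule integrable_abs_bound)
      show "integrable lborel (\<lambda>x. (1 + C\<mu>) * (D x * (1 + apow (\<phi>1 x) \<beta>) * exp (\<phi> x)))"
        using Dint by (rule integrable_mult_right)
      show "\<bar>\<integral>w. norm (dens_xw \<sigma> (x, w) * f (x, w)) \<partial>\<mu>\<bar>
          \<le> (1 + C\<mu>) * (D x * (1 + apow (\<phi>1 x) \<beta>) * exp (\<phi> x))" for x
      proof -
        have "0 \<le> (\<integral>w. \<bar>kern \<sigma> x w * f (x, w)\<bar> \<partial>\<mu>)" by (rule Bochner_Integration.integral_nonneg) simp
        then show ?thesis
          unfolding eq' using mult_left_mono[OF inner(2)[of x], of "exp (\<phi> x)"]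
          by (simp add: abs_mult mult_ac)
      qed
    qed measurable
  qed measurable
  show "(\<integral>p. dens_xw \<sigma> p * f p \<partial>(lborel \<Otimes>\<^sub>M \<mu>))
      = (\<integral>x. exp (\<phi> x) * (\<integral>w. kern \<sigma> x w * f (x, w) \<partial>\<mu>) \<partial>lborel)"
    using pair.integral_fst'[OF int] by (simp add: eq)
qed

lemma rho_measurable [measurable]:
  "(\<lambda>p. rho g \<mu> \<phi> \<sigma> (fst p) (snd p)) \<in> borel_measurable (borel \<Otimes>\<^sub>M borel)"
  unfolding rho_def Zs_eq deriv_phi by measurable

lemma rho_shear_measurable [measurable]:
  "(\<lambda>p. rho g \<mu> \<phi> \<sigma> (fst p) (fst p + \<sigma> * snd p)) \<in> borel_measurable (borel \<Otimes>\<^sub>M borel)"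
  unfolding rho_def Zs_eq deriv_phi by measurable

lemma rho_shear_measurable' [measurable]:
  "(\<lambda>w. rho g \<mu> \<phi> \<sigma> x (x + \<sigma> * w)) \<in> borel_measurable borel"
  unfolding rho_def Zs_eq deriv_phi by measurable

section \<open>Second moment of the limiting cubic\<close>

lemma pow_integrable: "j \<le> 6 \<Longrightarrow> integrable \<mu> (\<lambda>z. z ^ j)"
proof (rule integrable_abs_bound)
  assume "j \<le> 6"
  then show "\<bar>z ^ j\<bar> \<le> 1 + \<bar>z\<bar> powr \<xi>" for z
    unfolding power_abs using params by (intro power_le_one_plus_powr) auto
qed (use powr_integrable in auto)

text \<open>The values of b''(0) and \<open>L2 0\<close> give T = w^3 P - w Q. Its square involves
  the moments of order 6, 4 and 2, the last of which is 1.\<close>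

lemma T_sq_integral:
  fixes x :: real
  defines "P \<equiv> - \<phi>3 x / 12 + (1 / 4 + gfrak g) * (\<phi>1 x * \<phi>2 x)" and "Q \<equiv> (1 / 2 + gfrak g) * (\<phi>1 x * \<phi>2 x)"
  shows "(\<integral>w. (T x w)\<^sup>2 \<partial>\<mu>) = mom \<mu> 6 * P\<^sup>2 - 2 * mom \<mu> 4 * (P * Q) + Q\<^sup>2"
proof -
  have "(T x w)\<^sup>2 = w ^ 6 * P\<^sup>2 - w ^ 4 * (2 * (P * Q)) + w ^ 2 * Q\<^sup>2" for w
  proof -
    have T: "T x w = w ^ 3 * P - w * Q"
      using gfrak_eq by (simp add: T_def P_def Q_def L2_0 algebra_simps)
    have "(w ^ 3 * p - w * q)\<^sup>2 = w ^ 6 * p\<^sup>2 - w ^ 4 * (2 * (p * q)) + w ^ 2 * q\<^sup>2" for p q :: real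
      by algebra
    then show ?thesis unfolding T .
  qed
  then show ?thesis
    using pow_integrable[of 6] pow_integrable[of 4] pow_integrable[of 2] sq_integral
    by (simp add: mom_def)
qed

lemma target_integral:
  assumes [measurable]: "f \<in> borel_measurable borel"
  shows "(\<integral>x. f x \<partial>target \<phi>) = (\<integral>x. exp (\<phi> x) * f x \<partial>lborel)"
  unfolding target_def by (subst integral_density) auto

lemma theta2_eq: "(\<integral>x. exp (\<phi> x) * (\<integral>w. (T x w)\<^sup>2 \<partial>\<mu>) \<partial>lborel) = theta2 g \<mu> \<phi>"
proof -
  obtain F where F: "F \<in> borel_measurable borel" "\<And>x. 1 \<le> F x"
    "integrable lborel (\<lambda>x. (F x)\<^sup>2 * (1 + apow (\<phi>1 x) \<beta>) * exp (\<phi> x))"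
    "\<And>x s. \<bar>\<phi>3 (x + s)\<bar> \<le> F x * (1 + q s)"
    "\<And>x s. \<bar>\<phi>2 (x + s) * \<phi>1 (x + s)\<bar> \<le> F x * (1 + q s)"
    by (rule growth; rule that)
  \<comment> \<open>At s = 0 the growth bounds thus reduce to plain domination by \<open>F\<close>,
    and products of two such functions are dominated by the integrable F^2.\<close>
  have q0: "q 0 = 0" using params by (simp add: q_def)
  have F3: "\<bar>\<phi>3 x\<bar> \<le> F x" and F12: "\<bar>\<phi>1 x * \<phi>2 x\<bar> \<le> F x" for x
    using F(4)[of x 0] F(5)[of x 0] by (simp_all add: q0 mult.commute)
  have int: "integrable lborel (\<lambda>x. exp (\<phi> x) * (u x * v x))"
    if "\<And>x. \<bar>u x\<bar> \<le> F x" "\<And>x. \<bar>v x\<bar> \<le> F x" "u \<in> borel_measurable borel" "v \<in> borel_measurable borel" for u v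
  proof (rule integrable_abs_bound[OF F(3)])
    show "(\<lambda>x. exp (\<phi> x) * (u x * v x)) \<in> borel_measurable lborel" using that by simp
    fix x
    have "\<bar>u x\<bar> * \<bar>v x\<bar> \<le> F x * F x" using that(1)[of x] that(2)[of x] F(2)[of x] by (intro mult_mono) auto
    also have "\<dots> \<le> (F x)\<^sup>2 * (1 + apow (\<phi>1 x) \<beta>)"
      using apow_nonneg[of "\<phi>1 x" \<beta>] by (simp add: power2_eq_square distrib_left)
    finally show "\<bar>exp (\<phi> x) * (u x * v x)\<bar> \<le> (F x)\<^sup>2 * (1 + apow (\<phi>1 x) \<beta>) * exp (\<phi> x)"
      by (simp add: abs_mult mult.commute)
  qed
  define A B C where "A x = exp (\<phi> x) * (\<phi>3 x * \<phi>3 x)" and "B x = exp (\<phi> x) * ((\<phi>1 x * \<phi>2 x) * (\<phi>1 x * \<phi>2 x))"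
    and "C x = exp (\<phi> x) * ((\<phi>1 x * \<phi>2 x) * \<phi>3 x)" for x
  have i: "integrable lborel A" "integrable lborel B" "integrable lborel C"
    unfolding A_def B_def C_def by (intro int F3 F12; measurable)+
  have eqs: "Aphi \<phi> = integral\<^sup>L lborel A" "Bphi \<phi> = integral\<^sup>L lborel B" "Cphi \<phi> = integral\<^sup>L lborel C"
    unfolding Aphi_def Bphi_def Cphi_def by (simp_all add: target_integral A_def[abs_def] B_def[abs_def] C_def[abs_def] power2_eq_square)
  have "exp (\<phi> x) * (\<integral>w. (T x w)\<^sup>2 \<partial>\<mu>) =
      mom \<mu> 6 * (A x / 144 + (1/4 + gfrak g)\<^sup>2 * B x - (1/6) * (1/4 + gfrak g) * C x)
   + mom \<mu> 4 * ((1/6) * (1/2 + gfrak g) * C x - 2 * (1/4 + gfrak g) * (1/2 + gfrak g) * B x)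
   + (1/2 + gfrak g)\<^sup>2 * B x" for x
  proof -
    have "e * (m6 * (- f / 12 + a * d)\<^sup>2 - 2 * m4 * ((- f / 12 + a * d) * (c * d)) + (c * d)\<^sup>2)
      = m6 * ((e * (f * f)) / 144 + a\<^sup>2 * (e * (d * d)) - (1/6) * a * (e * (d * f)))
        + m4 * ((1/6) * c * (e * (d * f)) - 2 * a * c * (e * (d * d))) + c\<^sup>2 * (e * (d * d))" for e m6 m4 f a d c :: real
      by (simp add: power2_eq_square algebra_simps add_divide_distrib diff_divide_distrib)
    then show ?thesis unfolding T_sq_integral A_def B_def C_def .
  qed
  then show ?thesis
    unfolding theta2_def eqs using i by simp
qed

lemma theta2_nonneg: "0 \<le> theta2 g \<mu> \<phi>"
  unfolding theta2_eq[symmetric]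
  by (intro Bochner_Integration.integral_nonneg mult_nonneg_nonneg) auto

text \<open>Two forms for two purposes: the first keeps the vanishing coefficient of |w|^\<xi>,
  needed for uniform integrability in w; the second is free of \<sigma> on the right, needed for
  integrability, local boundedness and domination in x.\<close>

lemma scaled_test_function_bound:
  fixes v :: "real \<Rightarrow> real"
  assumes v: "\<And>s. \<bar>v s\<bar> \<le> B * s\<^sup>2"
    and G: "\<And>x. 0 \<le> G x" "\<And>\<sigma> x w. 0 < \<sigma> \<Longrightarrow> \<sigma> \<le> 1 \<Longrightarrow>
      (rho g \<mu> \<phi> \<sigma> x (x + \<sigma> * w) / \<sigma> ^ 3)\<^sup>2 \<le> G x * (1 + w ^ 6 + \<sigma> powr (\<xi> - 6) * \<bar>w\<bar> powr \<xi>)"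
    and \<sigma>: "0 < \<sigma>" "\<sigma> \<le> 1"
  shows "\<bar>v (rho g \<mu> \<phi> \<sigma> x (x + \<sigma> * w)) / \<sigma> ^ 6\<bar> \<le> B * G x * (1 + w ^ 6 + \<sigma> powr (\<xi> - 6) * \<bar>w\<bar> powr \<xi>)"
    and "\<bar>v (rho g \<mu> \<phi> \<sigma> x (x + \<sigma> * w)) / \<sigma> ^ 6\<bar> \<le> 2 * B * G x * (1 + \<bar>w\<bar> powr \<xi>)"
proof -
  have B0: "0 \<le> B" using v[of 1] by (simp add: order_trans[OF abs_ge_zero])
  let ?\<rho> = "rho g \<mu> \<phi> \<sigma> x (x + \<sigma> * w)"
  have "\<bar>v ?\<rho> / \<sigma> ^ 6\<bar> \<le> B * ?\<rho>\<^sup>2 / \<sigma> ^ 6"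
    using v[of ?\<rho>] \<sigma> by (simp add: abs_divide divide_right_mono)
  also have "\<dots> = B * (?\<rho> / \<sigma> ^ 3)\<^sup>2" by (simp add: power_divide power_mult[symmetric])
  also have "\<dots> \<le> B * (G x * (1 + w ^ 6 + \<sigma> powr (\<xi> - 6) * \<bar>w\<bar> powr \<xi>))"
    using B0 \<sigma> by (intro mult_left_mono G(2))
  finally show 1: "\<bar>v ?\<rho> / \<sigma> ^ 6\<bar> \<le> B * G x * (1 + w ^ 6 + \<sigma> powr (\<xi> - 6) * \<bar>w\<bar> powr \<xi>)"
    by (simp add: mult.assoc)
  have "w ^ 6 \<le> 1 + \<bar>w\<bar> powr \<xi>"
    using power_le_one_plus_powr[of 6 \<xi> w] params by (simp add: power_even_abs)
  moreover have "\<sigma> powr (\<xi> - 6) \<le> 1" using \<sigma> params by (intro powr_le1) auto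
  then have "\<sigma> powr (\<xi> - 6) * \<bar>w\<bar> powr \<xi> \<le> 1 * \<bar>w\<bar> powr \<xi>" by (intro mult_right_mono) auto
  moreover have "1 + c + d \<le> 2 * (1 + p)" if "c \<le> 1 + p" "d \<le> 1 * p" for c d p :: real
    using that by simp
  ultimately have "1 + w ^ 6 + \<sigma> powr (\<xi> - 6) * \<bar>w\<bar> powr \<xi> \<le> 2 * (1 + \<bar>w\<bar> powr \<xi>)" by blast
  then have "B * G x * (1 + w ^ 6 + \<sigma> powr (\<xi> - 6) * \<bar>w\<bar> powr \<xi>) \<le> B * G x * (2 * (1 + \<bar>w\<bar> powr \<xi>))"
    using B0 G(1)[of x] by (intro mult_left_mono) auto
  with 1 show "\<bar>v ?\<rho> / \<sigma> ^ 6\<bar> \<le> 2 * B * G x * (1 + \<bar>w\<bar> powr \<xi>)" by (simp add: mult_ac)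
qed

lemma joint_test_function:
  fixes v :: "real \<Rightarrow> real"
  assumes [measurable]: "v \<in> borel_measurable borel" and v: "\<And>s. \<bar>v s\<bar> \<le> B * s\<^sup>2"
    and \<sigma>: "0 < \<sigma>" "\<sigma> \<le> 1"
  shows "integrable (jointXY g \<mu> \<phi> \<sigma>) (\<lambda>p. v (rho g \<mu> \<phi> \<sigma> (fst p) (snd p)))"
    and "(\<integral>p. v (rho g \<mu> \<phi> \<sigma> (fst p) (snd p)) \<partial>jointXY g \<mu> \<phi> \<sigma>) / \<sigma> ^ 6
      = (\<integral>x. exp (\<phi> x) * (\<integral>w. kern \<sigma> x w * (v (rho g \<mu> \<phi> \<sigma> x (x + \<sigma> * w)) / \<sigma> ^ 6) \<partial>\<mu>) \<partial>lborel)"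
proof -
  obtain G where G: "G \<in> borel_measurable borel" "\<And>x. 0 \<le> G x"
    "integrable lborel (\<lambda>x. G x * (1 + apow (\<phi>1 x) \<beta>) * exp (\<phi> x))"
    "\<And>\<sigma> x w. 0 < \<sigma> \<Longrightarrow> \<sigma> \<le> 1 \<Longrightarrow>
      (rho g \<mu> \<phi> \<sigma> x (x + \<sigma> * w) / \<sigma> ^ 3)\<^sup>2 \<le> G x * (1 + w ^ 6 + \<sigma> powr (\<xi> - 6) * \<bar>w\<bar> powr \<xi>)"
    by (rule rho_scaled_bound; rule that)
  have B0: "0 \<le> B" using v[of 1] by (simp add: order_trans[OF abs_ge_zero])
  define f where "f p = v (rho g \<mu> \<phi> \<sigma> (fst p) (fst p + \<sigma> * snd p)) / \<sigma> ^ 6" for p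
  have f [measurable]: "f \<in> borel_measurable (borel \<Otimes>\<^sub>M borel)" unfolding f_def[abs_def] by measurable
  have bd: "\<bar>f (x, w)\<bar> \<le> (2 * B * G x) * (1 + \<bar>w\<bar> powr \<xi>)" for x w
    unfolding f_def using scaled_test_function_bound(2)[OF v G(2,4) \<sigma>] by simp
  have D: "0 \<le> 2 * B * G x" for x using B0 G(2)[of x] by simp
  have Dint: "integrable lborel (\<lambda>x. 2 * B * G x * (1 + apow (\<phi>1 x) \<beta>) * exp (\<phi> x))"
    using integrable_mult_right[OF G(3), of "2 * B"] by (simp add: mult.assoc)
  note J = joint_Fubini[OF less_imp_le[OF \<sigma>(1)] \<sigma>(2) f bd D Dint]
  have eq: "dens_xw \<sigma> p * v (rho g \<mu> \<phi> \<sigma> (fst p) (fst p + \<sigma> * snd p)) = \<sigma> ^ 6 * (dens_xw \<sigma> p * f p)" for p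
    using \<sigma> by (simp add: f_def)
  show "integrable (jointXY g \<mu> \<phi> \<sigma>) (\<lambda>p. v (rho g \<mu> \<phi> \<sigma> (fst p) (snd p)))"
    by (subst joint_integrable_iff) (use J(1) in \<open>simp_all add: eq\<close>)
  have "(\<integral>p. v (rho g \<mu> \<phi> \<sigma> (fst p) (snd p)) \<partial>jointXY g \<mu> \<phi> \<sigma>) =
      \<sigma> ^ 6 * (\<integral>p. dens_xw \<sigma> p * f p \<partial>(lborel \<Otimes>\<^sub>M \<mu>))"
    by (subst joint_integral) (simp_all add: eq)
  then have R: "(\<integral>p. v (rho g \<mu> \<phi> \<sigma> (fst p) (snd p)) \<partial>jointXY g \<mu> \<phi> \<sigma>) / \<sigma> ^ 6 =
      (\<integral>p. dens_xw \<sigma> p * f p \<partial>(lborel \<Otimes>\<^sub>M \<mu>))"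
    using \<sigma> by simp
  show "(\<integral>p. v (rho g \<mu> \<phi> \<sigma> (fst p) (snd p)) \<partial>jointXY g \<mu> \<phi> \<sigma>) / \<sigma> ^ 6
      = (\<integral>x. exp (\<phi> x) * (\<integral>w. kern \<sigma> x w * (v (rho g \<mu> \<phi> \<sigma> x (x + \<sigma> * w)) / \<sigma> ^ 6) \<partial>\<mu>) \<partial>lborel)"
    unfolding R J(2) by (simp only: f_def fst_conv snd_conv)
qed

lemma kern_tendsto_1:
  assumes "\<sigma> \<longlonglongrightarrow> 0"
  shows "(\<lambda>n. kern (\<sigma> n) x w) \<longlonglongrightarrow> 1"
proof -
  have s: "(\<lambda>n. \<sigma> n * \<phi>1 x) \<longlonglongrightarrow> 0" by (rule tendsto_mult_left_zero[OF assms])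
  have "(\<lambda>n. b (\<sigma> n * \<phi>1 x * w)) \<longlonglongrightarrow> b 0"
    by (rule isCont_tendsto_compose[OF b_isCont(1) tendsto_mult_left_zero[OF s]])
  moreover have "(\<lambda>n. h (\<sigma> n * \<phi>1 x)) \<longlonglongrightarrow> h 0" by (rule isCont_tendsto_compose[OF h_isCont s])
  ultimately have "(\<lambda>n. kern (\<sigma> n) x w) \<longlonglongrightarrow> exp (b 0) / h 0"
    unfolding kern_def by (intro tendsto_intros) (simp_all add: h_0)
  then show ?thesis by (simp add: b_0 h_0)
qed

text \<open>The limit is taken in two stages: in w for fixed x by uniform moments of the kernel,
  since the weights vary with \<open>n\<close>, and then in x by dominated convergence with the
  envelope \<open>G\<close>.\<close>

lemma test_function_limit:
  fixes v :: "real \<Rightarrow> real"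
  assumes vm [measurable]: "v \<in> borel_measurable borel" and v: "\<And>s. \<bar>v s\<bar> \<le> B * s\<^sup>2"
    and c: "((\<lambda>s. v s / s\<^sup>2) \<longlongrightarrow> c) (at 0)"
    and \<sigma>: "\<And>n. 0 < \<sigma> n" "\<And>n. \<sigma> n \<le> 1" "\<sigma> \<longlonglongrightarrow> 0"
  shows "(\<lambda>n. (\<integral>p. v (rho g \<mu> \<phi> (\<sigma> n) (fst p) (snd p)) \<partial>jointXY g \<mu> \<phi> (\<sigma> n)) / \<sigma> n ^ 6)
    \<longlonglongrightarrow> c * theta2 g \<mu> \<phi>"
proof -
  obtain G where G: "G \<in> borel_measurable borel" "\<And>x. 0 \<le> G x"
    "integrable lborel (\<lambda>x. G x * (1 + apow (\<phi>1 x) \<beta>) * exp (\<phi> x))"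
    "\<And>\<sigma> x w. 0 < \<sigma> \<Longrightarrow> \<sigma> \<le> 1 \<Longrightarrow>
      (rho g \<mu> \<phi> \<sigma> x (x + \<sigma> * w) / \<sigma> ^ 3)\<^sup>2 \<le> G x * (1 + w ^ 6 + \<sigma> powr (\<xi> - 6) * \<bar>w\<bar> powr \<xi>)"
    by (rule rho_scaled_bound; rule that)
  have B0: "0 \<le> B" using v[of 1] by (simp add: order_trans[OF abs_ge_zero])
  define f where "f n x w = v (rho g \<mu> \<phi> (\<sigma> n) x (x + \<sigma> n * w)) / \<sigma> n ^ 6" for n x w
  have f_meas: "f n x \<in> borel_measurable borel" for n x unfolding f_def[abs_def] by measurable
  note bd = scaled_test_function_bound[OF v G(2,4) \<sigma>(1,2), folded f_def]
  have flim: "(\<lambda>n. f n x w) \<longlonglongrightarrow> c * (T x w)\<^sup>2" for x w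
  proof -
    \<comment> \<open>The quotient is filled in by its limit \<open>c\<close> at 0, because rho may
      vanish for some \<open>n\<close>.\<close>
    define u where "u s = (if s = 0 then c else v s / s\<^sup>2)" for s
    have v0: "v 0 = 0" using v[of 0] by simp
    have vu: "v s = s\<^sup>2 * u s" for s by (simp add: u_def v0)
    have "(u \<longlongrightarrow> c) (at 0)"
      by (rule Lim_transform_eventually[OF c]) (auto simp: u_def eventually_at_filter)
    then have u: "isCont u 0" by (simp add: isCont_def u_def)
    note S = rho_scaled_tendsto[OF \<sigma>(1,3), of x w]
    have "(\<lambda>n. rho g \<mu> \<phi> (\<sigma> n) x (x + \<sigma> n * w) / \<sigma> n ^ 3 * \<sigma> n ^ 3) \<longlonglongrightarrow> T x w * 0 ^ 3"
      by (intro tendsto_intros S \<sigma>(3))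
    moreover have "rho g \<mu> \<phi> (\<sigma> n) x (x + \<sigma> n * w) / \<sigma> n ^ 3 * \<sigma> n ^ 3 = rho g \<mu> \<phi> (\<sigma> n) x (x + \<sigma> n * w)" for n
      using \<sigma>(1)[of n] by simp
    ultimately have "(\<lambda>n. rho g \<mu> \<phi> (\<sigma> n) x (x + \<sigma> n * w)) \<longlonglongrightarrow> 0" by simp
    then have "(\<lambda>n. u (rho g \<mu> \<phi> (\<sigma> n) x (x + \<sigma> n * w))) \<longlonglongrightarrow> u 0" by (rule isCont_tendsto_compose[OF u])
    then have "(\<lambda>n. (rho g \<mu> \<phi> (\<sigma> n) x (x + \<sigma> n * w) / \<sigma> n ^ 3)\<^sup>2 * u (rho g \<mu> \<phi> (\<sigma> n) x (x + \<sigma> n * w)))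
        \<longlonglongrightarrow> (T x w)\<^sup>2 * c"
      by (intro tendsto_intros S) (simp add: u_def)
    moreover have "f n x w = (rho g \<mu> \<phi> (\<sigma> n) x (x + \<sigma> n * w) / \<sigma> n ^ 3)\<^sup>2 * u (rho g \<mu> \<phi> (\<sigma> n) x (x + \<sigma> n * w))" for n
      by (simp add: f_def vu power_divide power_mult[symmetric])
    ultimately show ?thesis by (simp add: mult.commute)
  qed
  have inner: "(\<lambda>n. \<integral>w. kern (\<sigma> n) x w * f n x w \<partial>\<mu>) \<longlonglongrightarrow> (\<integral>w. c * (T x w)\<^sup>2 \<partial>\<mu>)" for x
  proof (rule integral_tendsto_of_moment_bound(2)[where k = "\<lambda>n. kern (\<sigma> n) x" and x = \<xi>
        and B = "C\<mu> * (1 + apow (\<phi>1 x) \<beta>)" and C = "B * G x" and \<eta> = "\<lambda>n. B * G x * \<sigma> n powr (\<xi> - 6)"])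
    fix n z
    show "(\<lambda>w. kern (\<sigma> n) x w * f n x w) \<in> borel_measurable borel" using f_meas by measurable
    have "(\<lambda>n. kern (\<sigma> n) x z * f n x z) \<longlonglongrightarrow> 1 * (c * (T x z)\<^sup>2)"
      by (intro tendsto_mult kern_tendsto_1 flim \<sigma>(3))
    then show "(\<lambda>n. kern (\<sigma> n) x z * f n x z) \<longlonglongrightarrow> c * (T x z)\<^sup>2" by simp
    show "0 \<le> kern (\<sigma> n) x z" using kern_pos by (rule less_imp_le)
    show "integrable \<mu> (kern (\<sigma> n) x)" by (rule kern_integrable)
    show "integrable \<mu> (\<lambda>z. \<bar>z\<bar> powr \<xi> * kern (\<sigma> n) x z)" by (rule kern_powr_integrable)
    show "(\<integral>z. \<bar>z\<bar> powr \<xi> * kern (\<sigma> n) x z \<partial>\<mu>) \<le> C\<mu> * (1 + apow (\<phi>1 x) \<beta>)"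
      by (rule kern_powr_le'[OF less_imp_le[OF \<sigma>(1)] \<sigma>(2)])
    show "\<bar>kern (\<sigma> n) x z * f n x z\<bar>
        \<le> (B * G x * (1 + z ^ 6) + B * G x * \<sigma> n powr (\<xi> - 6) * \<bar>z\<bar> powr \<xi>) * kern (\<sigma> n) x z"
      using mult_right_mono[OF bd(1)[of n x z] less_imp_le[OF kern_pos[of "\<sigma> n" x z]]] kern_pos[of "\<sigma> n" x z]
      by (simp add: abs_mult algebra_simps)
    show "0 \<le> B * G x * \<sigma> n powr (\<xi> - 6)" using B0 G(2) by simp
  next
    have "(\<lambda>n. \<sigma> n powr (\<xi> - 6)) \<longlonglongrightarrow> 0"
      using \<sigma>(1) params by (intro tendsto_zero_powrI[OF \<sigma>(3) tendsto_const]) (auto simp: less_imp_le)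
    then show "(\<lambda>n. B * G x * \<sigma> n powr (\<xi> - 6)) \<longlonglongrightarrow> 0" by (rule tendsto_mult_right_zero)
  next
    fix R
    \<comment> \<open>The normalizing constants converge to \<open>h 0 = 1\<close>, so their
      inverses are bounded over all \<open>n\<close>; this bounds the kernel on balls uniformly in
      \<open>n\<close>.\<close>
    have "(\<lambda>n. inverse (h (\<sigma> n * \<phi>1 x))) \<longlonglongrightarrow> inverse (h 0)"
      using isCont_tendsto_compose[OF h_isCont tendsto_mult_left_zero[OF \<sigma>(3)], of "\<phi>1 x"]
      by (intro tendsto_inverse) (simp_all add: h_0)
    from convergentI[OF this, THEN convergent_imp_Bseq]
    obtain N where N: "\<And>n. \<bar>inverse (h (\<sigma> n * \<phi>1 x))\<bar> \<le> N" by (auto simp: Bseq_def)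
    have N0: "0 \<le> N" using N[of 0] by (rule order_trans[OF abs_ge_zero])
    have "\<bar>kern (\<sigma> n) x z * f n x z\<bar> \<le> (exp (M * \<bar>\<phi>1 x\<bar> * R) * N) * (2 * B * G x * (1 + \<bar>R\<bar> powr \<xi>))"
      if z: "\<bar>z\<bar> \<le> R" for n z
    proof -
      have "\<bar>\<sigma> n * \<phi>1 x\<bar> \<le> \<bar>\<phi>1 x\<bar>"
        using \<sigma>(1)[of n] mult_right_mono[OF \<sigma>(2)[of n], of "\<bar>\<phi>1 x\<bar>"] by (simp add: abs_mult)
      then have "exp (b (\<sigma> n * \<phi>1 x * z)) * \<bar>inverse (h (\<sigma> n * \<phi>1 x))\<bar> \<le> exp (M * \<bar>\<phi>1 x\<bar> * R) * N"
        using z N by (intro mult_mono exp_b_bound) auto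
      then have k: "\<bar>kern (\<sigma> n) x z\<bar> \<le> exp (M * \<bar>\<phi>1 x\<bar> * R) * N"
        by (simp add: kern_def abs_mult abs_divide divide_inverse)
      have "1 + \<bar>z\<bar> powr \<xi> \<le> 1 + \<bar>R\<bar> powr \<xi>" using z params by (intro add_left_mono powr_mono2) auto
      then have "2 * B * G x * (1 + \<bar>z\<bar> powr \<xi>) \<le> 2 * B * G x * (1 + \<bar>R\<bar> powr \<xi>)"
        using B0 G(2) by (intro mult_left_mono) auto
      with bd(2)[of n x z] have "\<bar>f n x z\<bar> \<le> 2 * B * G x * (1 + \<bar>R\<bar> powr \<xi>)" by linarith
      with k show ?thesis unfolding abs_mult using N0 by (intro mult_mono) auto
    qed
    then show "\<exists>D. \<forall>n z. \<bar>z\<bar> \<le> R \<longrightarrow> \<bar>kern (\<sigma> n) x z * f n x z\<bar> \<le> D" by blast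
  qed (use mu.finite_measure_axioms mu_sets params B0 G(2) in auto)
  have meas: "(\<lambda>x. \<integral>w. kern (\<sigma> n) x w * f n x w \<partial>\<mu>) \<in> borel_measurable borel" for n
  proof (rule mu.borel_measurable_lebesgue_integral)
    show "(\<lambda>(x, w). kern (\<sigma> n) x w * f n x w) \<in> borel_measurable (borel \<Otimes>\<^sub>M \<mu>)"
      unfolding f_def case_prod_beta by measurable
  qed
  have "(\<lambda>n. \<integral>x. exp (\<phi> x) * (\<integral>w. kern (\<sigma> n) x w * f n x w \<partial>\<mu>) \<partial>lborel)
      \<longlonglongrightarrow> (\<integral>x. exp (\<phi> x) * (\<integral>w. c * (T x w)\<^sup>2 \<partial>\<mu>) \<partial>lborel)"
  proof (rule integral_dominated_convergence[where w = "\<lambda>x. 2 * B * (1 + C\<mu>) * (G x * (1 + apow (\<phi>1 x) \<beta>) * exp (\<phi> x))"])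
    show "(\<lambda>x. exp (\<phi> x) * (\<integral>w. kern (\<sigma> n) x w * f n x w \<partial>\<mu>)) \<in> borel_measurable lborel" for n
      using meas[of n] by measurable
    have "(\<lambda>x. \<integral>w. c * (T x w)\<^sup>2 \<partial>\<mu>) \<in> borel_measurable borel"
      by (rule borel_measurable_LIMSEQ_real[OF inner meas])
    then show "(\<lambda>x. exp (\<phi> x) * (\<integral>w. c * (T x w)\<^sup>2 \<partial>\<mu>)) \<in> borel_measurable lborel" by measurable
    show "integrable lborel (\<lambda>x. 2 * B * (1 + C\<mu>) * (G x * (1 + apow (\<phi>1 x) \<beta>) * exp (\<phi> x)))"
      by (rule integrable_mult_right[OF G(3)])
    show "AE x in lborel. (\<lambda>n. exp (\<phi> x) * (\<integral>w. kern (\<sigma> n) x w * f n x w \<partial>\<mu>))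
        \<longlonglongrightarrow> exp (\<phi> x) * (\<integral>w. c * (T x w)\<^sup>2 \<partial>\<mu>)"
      by (intro AE_I2 tendsto_mult tendsto_const inner)
    have "\<bar>exp (\<phi> x) * (\<integral>w. kern (\<sigma> n) x w * f n x w \<partial>\<mu>)\<bar>
        \<le> 2 * B * (1 + C\<mu>) * (G x * (1 + apow (\<phi>1 x) \<beta>) * exp (\<phi> x))" for n x
    proof -
      have "\<bar>\<integral>w. kern (\<sigma> n) x w * f n x w \<partial>\<mu>\<bar> \<le> 2 * B * G x * ((1 + C\<mu>) * (1 + apow (\<phi>1 x) \<beta>))"
        using \<sigma>(1,2) B0 G(2) f_meas bd(2)
        by (intro order_trans[OF integral_abs_bound inner_integral_bound(2)]) (auto intro: less_imp_le)
      from mult_left_mono[OF this exp_ge_zero[of "\<phi> x"]] show ?thesis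
        by (simp only: abs_mult abs_exp_cancel mult_ac)
    qed
    then show "AE x in lborel. norm (exp (\<phi> x) * (\<integral>w. kern (\<sigma> n) x w * f n x w \<partial>\<mu>))
        \<le> 2 * B * (1 + C\<mu>) * (G x * (1 + apow (\<phi>1 x) \<beta>) * exp (\<phi> x))" for n
      by simp
  qed
  moreover have "(\<integral>x. exp (\<phi> x) * (\<integral>w. c * (T x w)\<^sup>2 \<partial>\<mu>) \<partial>lborel) = c * theta2 g \<mu> \<phi>"
    unfolding theta2_eq[symmetric] by (simp add: mult.left_commute[of _ c])
  ultimately show ?thesis
    unfolding joint_test_function(2)[OF vm v \<sigma>(1,2)] f_def[symmetric] by simp
qed

subsection \<open>Reversibility and the central limit theorem\<close>

text \<open>In the coordinates (x, w) with y = x + \<sigma> w, this involution exchanges x and y.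
  Translation invariance of Lebesgue measure handles the first coordinate for fixed w, and symmetry
  of \<open>\<mu>\<close> handles the second.\<close>

lemma flip_preserves:
  "distr (lborel \<Otimes>\<^sub>M \<mu>) (lborel \<Otimes>\<^sub>M \<mu>) (\<lambda>p. (fst p + \<sigma> * snd p, - snd p)) = lborel \<Otimes>\<^sub>M \<mu>"
proof (rule measure_eqI)
  show "sets (distr (lborel \<Otimes>\<^sub>M \<mu>) (lborel \<Otimes>\<^sub>M \<mu>) (\<lambda>p. (fst p + \<sigma> * snd p, - snd p))) = sets (lborel \<Otimes>\<^sub>M \<mu>)"
    by simp
  fix A assume "A \<in> sets (distr (lborel \<Otimes>\<^sub>M \<mu>) (lborel \<Otimes>\<^sub>M \<mu>) (\<lambda>p. (fst p + \<sigma> * snd p, - snd p)))"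
  then have A: "A \<in> sets (lborel \<Otimes>\<^sub>M \<mu>)" by (simp only: sets_distr)
  then have A' [measurable]: "A \<in> sets (borel \<Otimes>\<^sub>M borel)" by (simp only: sets_pair)
  let ?f = "indicator A :: real \<times> real \<Rightarrow> ennreal"
  have Phi: "(\<lambda>p. (fst p + \<sigma> * snd p, - snd p)) \<in> (lborel \<Otimes>\<^sub>M \<mu>) \<rightarrow>\<^sub>M (lborel \<Otimes>\<^sub>M \<mu>)" by measurable
  define u where "u w = (\<integral>\<^sup>+x. ?f (x, w) \<partial>lborel)" for w
  have u [measurable]: "u \<in> borel_measurable borel"
    unfolding u_def[abs_def] by measurable
  have "emeasure (distr (lborel \<Otimes>\<^sub>M \<mu>) (lborel \<Otimes>\<^sub>M \<mu>) (\<lambda>p. (fst p + \<sigma> * snd p, - snd p))) A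
      = (\<integral>\<^sup>+p. ?f p \<partial>distr (lborel \<Otimes>\<^sub>M \<mu>) (lborel \<Otimes>\<^sub>M \<mu>) (\<lambda>p. (fst p + \<sigma> * snd p, - snd p)))"
    using A by simp
  also have "\<dots> = (\<integral>\<^sup>+p. ?f (fst p + \<sigma> * snd p, - snd p) \<partial>(lborel \<Otimes>\<^sub>M \<mu>))"
    by (rule nn_integral_distr[OF Phi]) (use A in simp)
  also have "\<dots> = (\<integral>\<^sup>+w. \<integral>\<^sup>+x. ?f (fst (x, w) + \<sigma> * snd (x, w), - snd (x, w)) \<partial>lborel \<partial>\<mu>)"
    by (rule pair.nn_integral_snd[symmetric]) measurable
  also have "\<dots> = (\<integral>\<^sup>+w. u (- w) \<partial>\<mu>)"
  proof (rule nn_integral_cong)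
    fix w
    have "u (- w) = (\<integral>\<^sup>+x. ?f (x, - w) \<partial>lborel)" by (simp add: u_def)
    also have "\<dots> = ennreal \<bar>1\<bar> * (\<integral>\<^sup>+x. ?f (\<sigma> * w + 1 * x, - w) \<partial>lborel)"
      by (rule nn_integral_real_affine) simp_all
    finally show "(\<integral>\<^sup>+x. ?f (fst (x, w) + \<sigma> * snd (x, w), - snd (x, w)) \<partial>lborel) = u (- w)"
      by (simp add: add.commute)
  qed
  also have "\<dots> = (\<integral>\<^sup>+w. u w \<partial>distr \<mu> borel uminus)"
    by (rule nn_integral_distr[symmetric]) simp_all
  also have "\<dots> = (\<integral>\<^sup>+p. ?f p \<partial>(lborel \<Otimes>\<^sub>M \<mu>))"
    unfolding mu_sym u_def by (rule pair.nn_integral_snd) (use A in simp)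
  also have "\<dots> = emeasure (lborel \<Otimes>\<^sub>M \<mu>) A" using A by simp
  finally show "emeasure (distr (lborel \<Otimes>\<^sub>M \<mu>) (lborel \<Otimes>\<^sub>M \<mu>) (\<lambda>p. (fst p + \<sigma> * snd p, - snd p))) A
      = emeasure (lborel \<Otimes>\<^sub>M \<mu>) A" .
qed

lemma rho_antisym: "rho g \<mu> \<phi> \<sigma> y x = - rho g \<mu> \<phi> \<sigma> x y"
  by (simp add: rho_def)

text \<open>Reversibility: \<open>exp rho\<close> is the density of the law of \<open>(Y, X)\<close> with respect to that of
  \<open>(X, Y)\<close>.\<close>

lemma dens_xw_flip:
  "dens_xw \<sigma> (x + \<sigma> * w, - w) = dens_xw \<sigma> (x, w) * exp (rho g \<mu> \<phi> \<sigma> x (x + \<sigma> * w))"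
proof -
  have "exp (rho g \<mu> \<phi> \<sigma> x (x + \<sigma> * w)) = exp (\<phi> (x + \<sigma> * w)) / exp (\<phi> x)
      * (exp (b (\<phi>1 (x + \<sigma> * w) * (- (\<sigma> * w)))) / exp (b (\<phi>1 x * (\<sigma> * w))))
      * (h (\<sigma> * \<phi>1 x) / h (\<sigma> * \<phi>1 (x + \<sigma> * w)))"
    unfolding rho_eq exp_add exp_diff using h_pos by simp
  then show ?thesis
    using h_pos[of "\<sigma> * \<phi>1 x"] by (simp add: dens_xw_def kern_def mult_ac)
qed

text \<open>The function \<open>u s = s * exp s / (1 + exp s)\<close> satisfies \<open>u (- s) * exp s = - u s\<close>, so
  reversibility gives it mean zero; \<open>drift_part s = s - 2 * u s = - s * tanh (s / 2)\<close> is of second order.\<close>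

lemma rho_mean:
  assumes \<sigma>: "0 < \<sigma>" "\<sigma> \<le> 1"
  shows "integrable (jointXY g \<mu> \<phi> \<sigma>) (\<lambda>p. rho g \<mu> \<phi> \<sigma> (fst p) (snd p))"
    and "(\<integral>p. rho g \<mu> \<phi> \<sigma> (fst p) (snd p) \<partial>jointXY g \<mu> \<phi> \<sigma>)
      = (\<integral>p. drift_part (rho g \<mu> \<phi> \<sigma> (fst p) (snd p)) \<partial>jointXY g \<mu> \<phi> \<sigma>)"
proof -
  interpret J: prob_space "jointXY g \<mu> \<phi> \<sigma>" by (rule prob_space_jointXY)
  have sets_J [measurable_cong]: "sets (jointXY g \<mu> \<phi> \<sigma>) = sets (borel \<Otimes>\<^sub>M borel)"
    by (simp add: jointXY_eq)
  let ?\<rho> = "\<lambda>p. rho g \<mu> \<phi> \<sigma> (fst p) (snd p)"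
  have sq: "integrable (jointXY g \<mu> \<phi> \<sigma>) (\<lambda>p. (?\<rho> p)\<^sup>2)"
    by (rule joint_test_function(1)[where v = "\<lambda>s. s\<^sup>2" and B = 1]) (use \<sigma> in auto)
  have le: "\<bar>s\<bar> \<le> 1 + s\<^sup>2" for s :: real
    using power_le_one_plus_powr[of 1 2 s] by (simp add: powr_numeral)
  show \<rho>int: "integrable (jointXY g \<mu> \<phi> \<sigma>) ?\<rho>"
    by (rule integrable_abs_bound[of _ "\<lambda>p. 1 + (?\<rho> p)\<^sup>2"]) (use sq le in auto)
  define u where "u s = s * (exp s / (1 + exp s))" for s :: real
  have um [measurable]: "u \<in> borel_measurable borel" unfolding u_def[abs_def] by measurable
  have u_flip: "exp s * u (- s) = - u s" for s
  proof -
    have "exp s * (exp (- s) / (1 + exp (- s))) = exp s / (1 + exp s)"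
      using exp_gt_zero[of s] by (simp add: exp_minus field_simps add_pos_pos)
    moreover have "exp s * u (- s) = - (s * (exp s * (exp (- s) / (1 + exp (- s)))))"
      by (simp only: u_def mult_minus_left mult_minus_right mult.left_commute)
    ultimately show ?thesis by (simp only: u_def)
  qed
  have u_le: "\<bar>u s\<bar> \<le> 1 + s\<^sup>2" for s
  proof -
    have "0 < 1 + exp s" by (simp add: add_pos_pos)
    then have "\<bar>exp s / (1 + exp s)\<bar> \<le> 1" by (simp add: abs_divide divide_le_eq)
    then have "\<bar>u s\<bar> \<le> \<bar>s\<bar> * 1" unfolding u_def abs_mult by (rule mult_left_mono) simp
    with le[of s] show ?thesis by simp
  qed
  \<comment> \<open>\<open>u\<close> grows at most linearly, so the second moment of rho suffices
    and no exponential moment enters.\<close>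
  have uint: "integrable (jointXY g \<mu> \<phi> \<sigma>) (\<lambda>p. u (?\<rho> p))"
    by (rule integrable_abs_bound[of _ "\<lambda>p. 1 + (?\<rho> p)\<^sup>2"]) (use sq u_le in auto)
  let ?I = "\<integral>p. dens_xw \<sigma> p * u (rho g \<mu> \<phi> \<sigma> (fst p) (fst p + \<sigma> * snd p)) \<partial>(lborel \<Otimes>\<^sub>M \<mu>)"
  \<comment> \<open>Under the flip the integrand turns into its own negative, by
    \<open>dens_xw_flip\<close>, \<open>rho_antisym\<close> and \<open>u_flip\<close>, so the
    integral equals its negative.\<close>
  have "?I = (\<integral>p. dens_xw \<sigma> p * u (rho g \<mu> \<phi> \<sigma> (fst p) (fst p + \<sigma> * snd p))
      \<partial>distr (lborel \<Otimes>\<^sub>M \<mu>) (lborel \<Otimes>\<^sub>M \<mu>) (\<lambda>p. (fst p + \<sigma> * snd p, - snd p)))"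
    by (simp only: flip_preserves)
  also have "\<dots> = (\<integral>p. dens_xw \<sigma> (fst p + \<sigma> * snd p, - snd p)
      * u (rho g \<mu> \<phi> \<sigma> (fst p + \<sigma> * snd p) (fst p)) \<partial>(lborel \<Otimes>\<^sub>M \<mu>))"
    by (subst integral_distr) simp_all
  also have "\<dots> = (\<integral>p. - (dens_xw \<sigma> p * u (rho g \<mu> \<phi> \<sigma> (fst p) (fst p + \<sigma> * snd p))) \<partial>(lborel \<Otimes>\<^sub>M \<mu>))"
    unfolding dens_xw_flip rho_antisym[of \<sigma> "_ + _"] mult.assoc u_flip by simp
  finally have "?I = 0" by simp
  then have u0: "(\<integral>p. u (?\<rho> p) \<partial>jointXY g \<mu> \<phi> \<sigma>) = 0" by (subst joint_integral) simp_all
  have op: "drift_part s = s - 2 * u s" for s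
  proof -
    have "1 + exp s \<noteq> 0" using exp_gt_zero[of s] by linarith
    then have "(1 - exp s) / (1 + exp s) = 1 - 2 * (exp s / (1 + exp s))" by (simp add: field_simps)
    then have "drift_part s = s * (1 - 2 * (exp s / (1 + exp s)))" by (simp only: drift_part_def)
    then show ?thesis by (simp add: u_def right_diff_distrib)
  qed
  show "(\<integral>p. ?\<rho> p \<partial>jointXY g \<mu> \<phi> \<sigma>) = (\<integral>p. drift_part (?\<rho> p) \<partial>jointXY g \<mu> \<phi> \<sigma>)"
    using \<rho>int uint u0 by (simp add: op)
qed

text \<open>The bound \<sigma> \<le> 1 holds from some index on, and shifting the sequence does not
  affect the limit.\<close>

lemma test_function_limit':
  fixes v :: "real \<Rightarrow> real"
  assumes vm: "v \<in> borel_measurable borel" and v: "\<And>s. \<bar>v s\<bar> \<le> B * s\<^sup>2"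
    and c: "((\<lambda>s. v s / s\<^sup>2) \<longlongrightarrow> c) (at 0)"
    and \<sigma>: "\<And>n. 0 < \<sigma> n" "\<sigma> \<longlonglongrightarrow> 0"
  shows "(\<lambda>n. (\<integral>p. v (rho g \<mu> \<phi> (\<sigma> n) (fst p) (snd p)) \<partial>jointXY g \<mu> \<phi> (\<sigma> n)) / \<sigma> n ^ 6)
    \<longlonglongrightarrow> c * theta2 g \<mu> \<phi>"
proof -
  have "\<forall>\<^sub>F n in sequentially. \<sigma> n < 1" by (rule order_tendstoD(2)[OF \<sigma>(2)]) simp
  then obtain k where "\<And>n. k \<le> n \<Longrightarrow> \<sigma> n < 1" by (auto simp: eventually_sequentially)
  then have "\<sigma> (n + k) \<le> 1" for n by (simp add: less_imp_le)
  from test_function_limit[OF vm v c \<sigma>(1) this LIMSEQ_ignore_initial_segment[OF \<sigma>(2)]]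
  show ?thesis by (rule LIMSEQ_offset)
qed

lemma rho_sq_limit:
  assumes "\<And>n. 0 < \<sigma> n" "\<sigma> \<longlonglongrightarrow> 0"
  shows "(\<lambda>n. (\<integral>p. (rho g \<mu> \<phi> (\<sigma> n) (fst p) (snd p))\<^sup>2 \<partial>jointXY g \<mu> \<phi> (\<sigma> n)) / \<sigma> n ^ 6)
    \<longlonglongrightarrow> theta2 g \<mu> \<phi>"
proof -
  have "((\<lambda>s. s\<^sup>2 / s\<^sup>2) \<longlongrightarrow> 1) (at (0::real))"
    by (rule Lim_transform_eventually[OF tendsto_const]) (auto simp: eventually_at_filter)
  from test_function_limit'[OF _ _ this assms, of 1] show ?thesis by simp
qed

text \<open>The integrand exp (i t s) - 1 is split into cos (t s) - 1, i (sin (t s) - t s) and i t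
  s. The first two are test functions of second order with coefficients - t^2 / 2 and 0; in the
  third the mean of s is replaced by that of \<open>drift_part\<close>, with coefficient - 1/2.
  Hence the limiting mean is minus half the limiting variance.\<close>

lemma char_rho_limit:
  assumes \<sigma>: "\<And>n. 0 < \<sigma> n" "\<sigma> \<longlonglongrightarrow> 0" and l: "(\<lambda>n. real n * \<sigma> n ^ 6) \<longlonglongrightarrow> L"
  shows "(\<lambda>n. of_nat n * (char (distr (jointXY g \<mu> \<phi> (\<sigma> n)) borel (\<lambda>p. rho g \<mu> \<phi> (\<sigma> n) (fst p) (snd p))) t - 1))
    \<longlonglongrightarrow> - complex_of_real (L * theta2 g \<mu> \<phi> * t\<^sup>2 / 2) + \<i> * of_real (t * (- (L * theta2 g \<mu> \<phi>) / 2))"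
proof -
  define E where "E v n = (\<integral>p. v (rho g \<mu> \<phi> (\<sigma> n) (fst p) (snd p)) \<partial>jointXY g \<mu> \<phi> (\<sigma> n))" for v :: "real \<Rightarrow> real" and n
  have lim: "(\<lambda>n. real n * E v n) \<longlonglongrightarrow> L * (c * theta2 g \<mu> \<phi>)"
    if "v \<in> borel_measurable borel" "\<And>s. \<bar>v s\<bar> \<le> B * s\<^sup>2" "((\<lambda>s. v s / s\<^sup>2) \<longlongrightarrow> c) (at 0)" for v B c
  proof -
    have "(\<lambda>n. (real n * \<sigma> n ^ 6) * (E v n / \<sigma> n ^ 6)) \<longlonglongrightarrow> L * (c * theta2 g \<mu> \<phi>)"
      unfolding E_def by (intro tendsto_mult l test_function_limit'[OF that \<sigma>])
    moreover have "(real n * \<sigma> n ^ 6) * (E v n / \<sigma> n ^ 6) = real n * E v n" for n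
      using \<sigma>(1)[of n] by simp
    ultimately show ?thesis by simp
  qed
  have cosv: "\<bar>cos (t * s) - 1\<bar> \<le> t\<^sup>2 * s\<^sup>2" for s
    using abs_cos_minus_1_le[of "t * s"] by (simp add: power_mult_distrib)
  have sinv: "\<bar>sin (t * s) - t * s\<bar> \<le> t\<^sup>2 * s\<^sup>2" for s
    using abs_sin_diff_le(1)[of "t * s"] by (simp add: power_mult_distrib)
  have oddv: "\<bar>drift_part s\<bar> \<le> 1 * s\<^sup>2" for s using drift_part_le[of s] by simp
  have om: "drift_part \<in> borel_measurable borel" unfolding drift_part_def[abs_def] by measurable
  have l1: "(\<lambda>n. real n * E (\<lambda>s. cos (t * s) - 1) n) \<longlonglongrightarrow> L * (- (t\<^sup>2 / 2) * theta2 g \<mu> \<phi>)"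
    by (rule lim[OF _ cosv cos_second_order]) measurable
  have l2: "(\<lambda>n. real n * E (\<lambda>s. sin (t * s) - t * s) n) \<longlonglongrightarrow> 0"
    using lim[OF _ sinv sin_second_order] by simp
  have l3: "(\<lambda>n. real n * E drift_part n) \<longlonglongrightarrow> L * (- (1 / 2) * theta2 g \<mu> \<phi>)"
    by (rule lim[OF om oddv drift_part_second_order])
  have "(\<lambda>n. complex_of_real (real n * E (\<lambda>s. cos (t * s) - 1) n)
      + \<i> * of_real (real n * E (\<lambda>s. sin (t * s) - t * s) n + t * (real n * E drift_part n)))
    \<longlonglongrightarrow> of_real (L * (- (t\<^sup>2 / 2) * theta2 g \<mu> \<phi>)) + \<i> * of_real (0 + t * (L * (- (1 / 2) * theta2 g \<mu> \<phi>)))"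
    by (intro tendsto_add tendsto_of_real tendsto_mult[OF tendsto_const] l1 l2 l3)
  moreover have "\<forall>\<^sub>F n in sequentially. complex_of_real (real n * E (\<lambda>s. cos (t * s) - 1) n)
      + \<i> * of_real (real n * E (\<lambda>s. sin (t * s) - t * s) n + t * (real n * E drift_part n))
    = of_nat n * (char (distr (jointXY g \<mu> \<phi> (\<sigma> n)) borel (\<lambda>p. rho g \<mu> \<phi> (\<sigma> n) (fst p) (snd p))) t - 1)"
    using order_tendstoD(2)[OF \<sigma>(2) zero_less_one]
  proof eventually_elim
    case (elim n)
    then have n: "\<sigma> n \<le> 1" by simp
    let ?J = "jointXY g \<mu> \<phi> (\<sigma> n)" and ?\<rho> = "\<lambda>p. rho g \<mu> \<phi> (\<sigma> n) (fst p) (snd p)"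
    interpret J: prob_space ?J by (rule prob_space_jointXY)
    have sets_J [measurable_cong]: "sets ?J = sets (borel \<Otimes>\<^sub>M borel)" by (simp add: jointXY_eq)
    note \<rho> = rho_mean[OF \<sigma>(1) n]
    have ci: "integrable ?J (\<lambda>p. cos (t * ?\<rho> p))" and si: "integrable ?J (\<lambda>p. sin (t * ?\<rho> p))"
      by (auto intro!: J.integrable_const_bound[where B = 1])
    have "char (distr ?J borel ?\<rho>) t = (CLINT p|?J. iexp (t * ?\<rho> p))"
      unfolding char_def by (subst integral_distr) simp_all
    also have "\<dots> = (CLINT p|?J. complex_of_real (cos (t * ?\<rho> p)) + \<i> * of_real (sin (t * ?\<rho> p)))"
    proof -
      have "iexp y = complex_of_real (cos y) + \<i> * of_real (sin y)" for y
        by (simp add: exp_Euler cos_of_real sin_of_real)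
      then show ?thesis by (simp only:)
    qed
    also have "\<dots> = of_real (\<integral>p. cos (t * ?\<rho> p) \<partial>?J) + \<i> * of_real (\<integral>p. sin (t * ?\<rho> p) \<partial>?J)"
      using ci si by simp
    also have "(\<integral>p. cos (t * ?\<rho> p) \<partial>?J) = 1 + E (\<lambda>s. cos (t * s) - 1) n"
      unfolding E_def using ci by (simp add: J.prob_space)
    also have "(\<integral>p. sin (t * ?\<rho> p) \<partial>?J) = E (\<lambda>s. sin (t * s) - t * s) n + t * E drift_part n"
      unfolding E_def \<rho>(2)[symmetric] using si \<rho>(1) by simp
    finally show ?case by (simp add: algebra_simps)
  qed
  ultimately have "(\<lambda>n. of_nat n * (char (distr (jointXY g \<mu> \<phi> (\<sigma> n)) borel (\<lambda>p. rho g \<mu> \<phi> (\<sigma> n) (fst p) (snd p))) t - 1))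
    \<longlonglongrightarrow> of_real (L * (- (t\<^sup>2 / 2) * theta2 g \<mu> \<phi>)) + \<i> * of_real (0 + t * (L * (- (1 / 2) * theta2 g \<mu> \<phi>)))"
    by (rule Lim_transform_eventually)
  moreover have "of_real (L * (- (t\<^sup>2 / 2) * theta2 g \<mu> \<phi>)) + \<i> * of_real (0 + t * (L * (- (1 / 2) * theta2 g \<mu> \<phi>)))
    = - complex_of_real (L * theta2 g \<mu> \<phi> * t\<^sup>2 / 2) + \<i> * of_real (t * (- (L * theta2 g \<mu> \<phi>) / 2))"
    by (simp add: mult_ac)
  ultimately show ?thesis by (simp only:)
qed

lemma sum_rho_weak_conv:
  assumes \<sigma>: "\<And>n. 0 < \<sigma> n" "\<sigma> \<longlonglongrightarrow> 0" and l: "(\<lambda>n. real n powr (1 / 6) * \<sigma> n) \<longlonglongrightarrow> l"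
    and pos: "0 < theta2 g \<mu> \<phi>" "0 < l"
  shows "weak_conv_m
     (\<lambda>n. distr (PiM {1..n} (\<lambda>i. jointXY g \<mu> \<phi> (\<sigma> n))) borel
             (\<lambda>\<omega>. \<Sum>i\<in>{1..n}. rho g \<mu> \<phi> (\<sigma> n) (fst (\<omega> i)) (snd (\<omega> i))))
     (density lborel (normal_density (- (l ^ 6 * theta2 g \<mu> \<phi>) / 2) (sqrt (l ^ 6 * theta2 g \<mu> \<phi>))))"
proof (rule row_sums_weak_conv_normal)
  show "prob_space (jointXY g \<mu> \<phi> (\<sigma> n))" for n by (rule prob_space_jointXY)
  show "(\<lambda>p. rho g \<mu> \<phi> (\<sigma> n) (fst p) (snd p)) \<in> borel_measurable (jointXY g \<mu> \<phi> (\<sigma> n))" for n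
    using rho_measurable by (simp add: jointXY_eq)
  have p: "0 < l ^ 6 * theta2 g \<mu> \<phi>" using pos by simp
  then show "0 < sqrt (l ^ 6 * theta2 g \<mu> \<phi>)" by simp
  \<comment> \<open>At n = 0 both sides are 0, since 0 powr (1 / 6) = 0.\<close>
  have "(real n powr (1 / 6) * \<sigma> n) ^ 6 = real n * \<sigma> n ^ 6" for n
    by (cases "n = 0") (simp_all add: power_mult_distrib powr_power)
  with tendsto_power[OF l, of 6] have "(\<lambda>n. real n * \<sigma> n ^ 6) \<longlonglongrightarrow> l ^ 6" by simp
  from char_rho_limit[OF \<sigma> this]
  show "(\<lambda>n. of_nat n * (char (distr (jointXY g \<mu> \<phi> (\<sigma> n)) borel (\<lambda>p. rho g \<mu> \<phi> (\<sigma> n) (fst p) (snd p))) t - 1))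
    \<longlonglongrightarrow> - complex_of_real ((sqrt (l ^ 6 * theta2 g \<mu> \<phi>))\<^sup>2 * t\<^sup>2 / 2)
      + \<i> * of_real (t * (- (l ^ 6 * theta2 g \<mu> \<phi>) / 2))" for t
    using p by (simp add: less_imp_le)
qed

end

theorem theorem2:
  fixes \<phi> g :: "real \<Rightarrow> real" and \<mu> :: "real measure"
    and H \<gamma> \<beta> \<epsilon> C\<mu> :: real and \<sigma> :: "nat \<Rightarrow> real"
  assumes dens: "integrable lborel (\<lambda>x. exp (\<phi> x))" "(\<integral>x. exp (\<phi> x) \<partial>lborel) = 1"
    and bal: "balancing g" "g 1 = 1"
    and mu_prob: "prob_space \<mu>" "sets \<mu> = sets borel"
    and mu_sym: "distr \<mu> borel uminus = \<mu>"
    and mu_centred: "integrable \<mu> (\<lambda>z. z)" "(\<integral>z. z \<partial>\<mu>) = 0"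
    and A1: "assumption1 \<phi> g \<mu> H \<gamma> \<beta> \<epsilon> C\<mu>"
    and sigma_pos: "\<forall>n. \<sigma> n > 0"
    and sigma_lim: "\<sigma> \<longlonglongrightarrow> 0"
  shows "theta2 g \<mu> \<phi> \<ge> 0
    \<and> (\<lambda>n. (\<integral>p. (rho g \<mu> \<phi> (\<sigma> n) (fst p) (snd p))\<^sup>2 \<partial>jointXY g \<mu> \<phi> (\<sigma> n)) / (\<sigma> n) ^ 6)
        \<longlonglongrightarrow> theta2 g \<mu> \<phi>
    \<and> (\<forall>l::real. theta2 g \<mu> \<phi> > 0 \<longrightarrow> l > 0 \<longrightarrow>
         (\<lambda>n. real n powr (1/6) * \<sigma> n) \<longlonglongrightarrow> l \<longrightarrow>
         weak_conv_m
           (\<lambda>n. distr (PiM {1..n} (\<lambda>i. jointXY g \<mu> \<phi> (\<sigma> n))) borel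
                   (\<lambda>\<omega>. \<Sum>i\<in>{1..n}. rho g \<mu> \<phi> (\<sigma> n) (fst (\<omega> i)) (snd (\<omega> i))))
           (density lborel (normal_density (- (l ^ 6 * theta2 g \<mu> \<phi>) / 2)
                                           (sqrt (l ^ 6 * theta2 g \<mu> \<phi>)))))"
proof -
  interpret locally_balanced \<phi> g \<mu> H \<gamma> \<beta> \<epsilon> C\<mu>
    using dens bal mu_prob mu_sym mu_centred A1 by (intro locally_balanced.intro)
  have \<sigma>: "0 < \<sigma> n" for n using sigma_pos by simp
  show ?thesis
    using theta2_nonneg rho_sq_limit[OF \<sigma> sigma_lim] sum_rho_weak_conv[OF \<sigma> sigma_lim] by blast
qed

end
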